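(* Let $\mathbb K$ be a field, let $d$ be a nonnegative integer and let $A,A^*$ be matrices in $\mathrm{Mat}_{d+1}(\mathbb K)$. Assume $A$ is tridiagonal and $A^*$ is diagonal. Then the following (i), (ii) are equivalent. (i) The pair $A,A^*$ is a Leonard pair in $\mathrm{Mat}_{d+1}(\mathbb K)$ which is in $TD$-$D$ canonical form. (ii) There exists a parameter array $(\theta_i,\theta^*_i,i=0..d;\varphi_j,\phi_j,j=1..d)$ over $\mathbb K$ such that $$A_{ii}=\theta_i+\frac{\varphi_i}{\theta^*_i-\theta^*_{i-1}}+\frac{\varphi_{i+1}}{\theta^*_i-\theta^*_{i+1}}\qquad(0\le i\le d),$$ $$A_{i-1,i}=\varphi_i\frac{\prod_{h=0}^{i-2}(\theta^*_{i-1}-\theta^*_h)}{\prod_{h=0}^{i-1}(\theta^*_i-\theta^*_h)}\qquad(1\le i\le d),$$ $$A_{i,i-1}=\phi_i\frac{\prod_{h=i+1}^{d}(\theta^*_i-\theta^*_h)}{\prod_{h=i}^{d}(\theta^*_{i-1}-\theta^*_h)}\qquad(1\le i\le d),$$ $$A^*_{ii}=\theta^*_i\qquad(0\le i\le d).$$ Suppose (i), (ii) hold. Then the parameter array in (ii) is uniquely determined by $A,A^*$. This parameter array is the designated parameter array for $A,A^*$.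
   Context: $\mathrm{Mat}_{d+1}(\mathbb K)$ is the algebra of $(d+1)\times(d+1)$ matrices over $\mathbb K$, rows and columns indexed by $0,1,\dots,d$. A matrix is tridiagonal if every nonzero entry lies on the diagonal, subdiagonal or superdiagonal. Leonard pairs and systems. Let $\mathcal A$ be a $\mathbb K$-algebra isomorphic to $\mathrm{Mat}_{d+1}(\mathbb K)$. An element $A\in\mathcal A$ is multiplicity-free if it has $d+1$ distinct eigenvalues in $\mathbb K$; if these are $\theta_0,\dots,\theta_d$, the primitive idempotent of $A$ associated with $\theta_i$ is $E_i=\prod_{j\ne i}(A-\theta_jI)/(\theta_i-\theta_j)$. For multiplicity-free $A,A^*\in\mathcal A$ ($A^*$ is just a name, not an adjoint), an idempotent sequence for $A,A^*$ is an ordering $E_0,\dots,E_d$ of the primitive idempotents of $A$ such that $E_iA^*E_j=0$ if $|i-j|>1$ and $E_iA^*E_j\ne0$ if $|i-j|=1$ ($0\le i,j\le d$); a dual idempotent sequence for $A,A^*$ is an idempotent sequence for $A^*,A$. A Leonard pair in $\mathcal A$ is an ordered pair $A,A^*$ of multiplicity-free elements of $\mathcal A$ for which an idempotent sequence and a dual idempotent sequence exist. A Leonard system in $\mathcal A$ is a sequence $\Phi=(A,A^*;E_i,E^*_i,i=0..d)$ where $A,A^*\in\mathcal A$ are multiplicity-free, $E_0,\dots,E_d$ is an idempotent sequence for $A,A^*$ and $E^*_0,\dots,E^*_d$ is a dual idempotent sequence for $A,A^*$; then $A,A^*$ is a Leonard pair, said to be associated with $\Phi$. The eigenvalue sequence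 (resp. dual eigenvalue sequence) of $\Phi$ is $\theta_0,\dots,\theta_d$ (resp. $\theta^*_0,\dots,\theta^*_d$), where $\theta_i$ (resp. $\theta^*_i$) is the eigenvalue of $A$ (resp. $A^*$) associated with $E_i$ (resp. $E^*_i$). An eigenvalue sequence of a Leonard pair is the eigenvalue sequence of an associated Leonard system; if $\theta_0,\dots,\theta_d$ is one, then the only other one is $\theta_d,\dots,\theta_0$. Split sequences. Let $V$ be an irreducible left $\mathcal A$-module (unique up to isomorphism, of dimension $d+1$) and set $U_i=(E^*_0V+\cdots+E^*_iV)\cap(E_iV+\cdots+E_dV)$. It is known that each $U_i$ has dimension 1, $V$ is the direct sum of $U_0,\dots,U_d$, $(A-\theta_iI)U_i=U_{i+1}$ ($0\le i\le d-1$), $(A-\theta_dI)U_d=0$, $(A^*-\theta^*_iI)U_i=U_{i-1}$ ($1\le i\le d$), $(A^*-\theta_0^*I)U_0=0$. For $1\le i\le d$, $\varphi_i$ is the (nonzero) eigenvalue of $(A-\theta_{i-1}I)(A^*-\theta^*_iI)$ on $U_i$. The sequence $\varphi_1,\dots,\varphi_d$ is the first split sequence of $\Phi$. The second split sequence $\phi_1,\dots,\phi_d$ of $\Phi$ is the first split sequence of $\Phi^\Downarrow=(A,A^*;E_{d-i},E^*_i,i=0..d)$. Parameter arrays. A parameter array over $\mathbb K$ of diameter $d$ is a sequence $(\theta_i,\theta^*_i,i=0..d;\varphi_j,\phi_j,j=1..d)$ of scalars in $\mathbb K$ such that: (1) $\varphi_i\ne0$, $\phi_i\ne0$ ($1\le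 i\le d$); (2) $\theta_i\ne\theta_j$, $\theta^*_i\ne\theta^*_j$ if $i\ne j$; (3) $\varphi_i=\phi_1\sum_{h=0}^{i-1}\frac{\theta_h-\theta_{d-h}}{\theta_0-\theta_d}+(\theta^*_i-\theta^*_0)(\theta_{i-1}-\theta_d)$ ($1\le i\le d$); (4) $\phi_i=\varphi_1\sum_{h=0}^{i-1}\frac{\theta_h-\theta_{d-h}}{\theta_0-\theta_d}+(\theta^*_i-\theta^*_0)(\theta_{d-i+1}-\theta_0)$ ($1\le i\le d$); (5) the expressions $\frac{\theta_{i-2}-\theta_{i+1}}{\theta_{i-1}-\theta_i}$ and $\frac{\theta^*_{i-2}-\theta^*_{i+1}}{\theta^*_{i-1}-\theta^*_i}$ are equal and independent of $i$ for $2\le i\le d-1$. The parameter array of a Leonard system $\Phi$ consists of its eigenvalue sequence, dual eigenvalue sequence, first split sequence and second split sequence; it is known that this sequence is a parameter array over $\mathbb K$ of diameter $d$, and that $\Phi\mapsto$ (parameter array of $\Phi$) induces a bijection from isomorphism classes of Leonard systems over $\mathbb K$ to parameter arrays over $\mathbb K$. Conventions: $\varphi_0=0$, $\varphi_{d+1}=0$, and $\theta^*_{-1},\theta^*_{d+1}$ are indeterminates (so the terms with numerator $\varphi_0$ or $\varphi_{d+1}$ are $0$). $TD$-$D$ canonical form. A Leonard pair $A,A^*$ with eigenvalue sequence $\theta_0,\dots,\theta_d$ is in $TD$-$D$ canonical form if its ambient algebra is $\mathrm{Mat}_{d+1}(\mathbb K)$, $A$ is tridiagonal and $A^*$ is diagonal,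 and $A$ has constant row sum (all row sums equal) with this sum equal to $\theta_0$ or $\theta_d$. For such a pair there is a unique eigenvalue sequence $\theta_0,\dots,\theta_d$ with $A$ having constant row sum $\theta_0$, and $A^*_{00},\dots,A^*_{dd}$ is a dual eigenvalue sequence. The designated Leonard system for $A,A^*$ is the Leonard system associated with $A,A^*$ having this eigenvalue sequence and having dual eigenvalue sequence $A^*_{00},\dots,A^*_{dd}$; the designated parameter array for $A,A^*$ is its parameter array. *)

theory Defs
  imports "Jordan_Normal_Form.Char_Poly" "HOL-Library.FuncSet"
begin

text \<open>
  The ambient algebra is the algebra of (d+1) x (d+1) matrices over a field, that is
  \<^term>\<open>carrier_mat (d+1) (d+1)\<close>, with rows and columns indexed by 0,...,d; its irreducible
  left module is \<^term>\<open>carrier_vec (d+1)\<close>. Finite sequences are functions on the naturals of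
  which only the values on the stated index range matter. The matrix called A* in the
  literature is written \<open>As\<close>; the star is just part of the name, and likewise \<open>Es\<close>, \<open>\<theta>s\<close>.
\<close>

definition tridiagonal_mat :: "'a::zero mat \<Rightarrow> bool" where
  "tridiagonal_mat A \<longleftrightarrow>
     (\<forall>i<dim_row A. \<forall>j<dim_col A. A $$ (i,j) \<noteq> 0 \<longrightarrow> i = j \<or> i = j + 1 \<or> j = i + 1)"

definition multiplicity_free :: "nat \<Rightarrow> 'a::field mat \<Rightarrow> bool" where
  "multiplicity_free d A \<longleftrightarrow>
     A \<in> carrier_mat (d+1) (d+1) \<and> card {t. eigenvalue A t} = d + 1"

definition primitive_idempotent :: "nat \<Rightarrow> 'a::field mat \<Rightarrow> (nat \<Rightarrow> 'a) \<Rightarrow> nat \<Rightarrow> 'a mat" where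
  "primitive_idempotent d A \<theta> i =
     foldr (\<lambda>j M. ((1 / (\<theta> i - \<theta> j)) \<cdot>\<^sub>m (A - \<theta> j \<cdot>\<^sub>m 1\<^sub>m (d+1))) * M)
       (filter (\<lambda>j. j \<noteq> i) [0..<d+1]) (1\<^sub>m (d+1))"

text \<open>
  \<open>E\<^sub>0,...,E\<^sub>d\<close> is an ordering of the primitive idempotents of A, and \<open>\<theta>\<^sub>i\<close> is the eigenvalue of A
  associated with \<open>E\<^sub>i\<close>. For multiplicity-free A, \<open>\<theta>\<close> is determined by \<open>E\<close> on 0,...,d.
\<close>
definition associated_eigenvalues ::
    "nat \<Rightarrow> 'a::field mat \<Rightarrow> (nat \<Rightarrow> 'a mat) \<Rightarrow> (nat \<Rightarrow> 'a) \<Rightarrow> bool" where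
  "associated_eigenvalues d A E \<theta> \<longleftrightarrow>
     bij_betw \<theta> {0..d} {t. eigenvalue A t} \<and> (\<forall>i\<le>d. E i = primitive_idempotent d A \<theta> i)"

definition idempotent_sequence ::
    "nat \<Rightarrow> 'a::field mat \<Rightarrow> 'a mat \<Rightarrow> (nat \<Rightarrow> 'a mat) \<Rightarrow> bool" where
  "idempotent_sequence d A As E \<longleftrightarrow>
     (\<exists>\<theta>. associated_eigenvalues d A E \<theta>) \<and>
     (\<forall>i\<le>d. \<forall>j\<le>d.
        (\<bar>int i - int j\<bar> > 1 \<longrightarrow> E i * As * E j = 0\<^sub>m (d+1) (d+1)) \<and>
        (\<bar>int i - int j\<bar> = 1 \<longrightarrow> E i * As * E j \<noteq> 0\<^sub>m (d+1) (d+1)))"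

definition leonard_pair :: "nat \<Rightarrow> 'a::field mat \<Rightarrow> 'a mat \<Rightarrow> bool" where
  "leonard_pair d A As \<longleftrightarrow>
     multiplicity_free d A \<and> multiplicity_free d As \<and>
     (\<exists>E. idempotent_sequence d A As E) \<and> (\<exists>Es. idempotent_sequence d As A Es)"

definition leonard_system ::
    "nat \<Rightarrow> 'a::field mat \<Rightarrow> 'a mat \<Rightarrow> (nat \<Rightarrow> 'a mat) \<Rightarrow> (nat \<Rightarrow> 'a mat) \<Rightarrow> bool" where
  "leonard_system d A As E Es \<longleftrightarrow>
     multiplicity_free d A \<and> multiplicity_free d As \<and>
     idempotent_sequence d A As E \<and> idempotent_sequence d As A Es"

definition leonard_pair_eigenvalue_sequence ::
    "nat \<Rightarrow> 'a::field mat \<Rightarrow> 'a mat \<Rightarrow> (nat \<Rightarrow> 'a) \<Rightarrow> bool" where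
  "leonard_pair_eigenvalue_sequence d A As \<theta> \<longleftrightarrow>
     (\<exists>E Es. leonard_system d A As E Es \<and> associated_eigenvalues d A E \<theta>)"

definition image_space :: "nat \<Rightarrow> 'a::field mat \<Rightarrow> 'a vec set" where
  "image_space d M = (\<lambda>v. M *\<^sub>v v) ` carrier_vec (d+1)"

definition sum_of_subspaces :: "nat \<Rightarrow> (nat \<Rightarrow> 'a::field vec set) \<Rightarrow> nat set \<Rightarrow> 'a vec set" where
  "sum_of_subspaces d W S =
     {finsum_vec TYPE('a) (d+1) w S | w. \<forall>h\<in>S. w h \<in> W h}"

text \<open>\<open>U\<^sub>i = (E*\<^sub>0 V + ... + E*\<^sub>i V) \<inter> (E\<^sub>i V + ... + E\<^sub>d V)\<close>\<close>
definition split_space ::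
    "nat \<Rightarrow> (nat \<Rightarrow> 'a::field mat) \<Rightarrow> (nat \<Rightarrow> 'a mat) \<Rightarrow> nat \<Rightarrow> 'a vec set" where
  "split_space d E Es i =
     sum_of_subspaces d (\<lambda>h. image_space d (Es h)) {0..i} \<inter>
     sum_of_subspaces d (\<lambda>h. image_space d (E h)) {i..d}"

text \<open>
  Since \<open>U\<^sub>i\<close> is one-dimensional for a Leonard system, the eigenvalue on \<open>U\<^sub>i\<close> is the scalar by
  which the operator acts there; the nonzero vector guarantees that this scalar is unique.
\<close>
definition first_split_sequence ::
    "nat \<Rightarrow> 'a::field mat \<Rightarrow> 'a mat \<Rightarrow> (nat \<Rightarrow> 'a mat) \<Rightarrow> (nat \<Rightarrow> 'a mat) \<Rightarrow> (nat \<Rightarrow> 'a) \<Rightarrow> bool" where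
  "first_split_sequence d A As E Es \<phi> \<longleftrightarrow>
     (\<exists>\<theta> \<theta>s. associated_eigenvalues d A E \<theta> \<and> associated_eigenvalues d As Es \<theta>s \<and>
       (\<forall>i\<in>{1..d}.
          (\<exists>u\<in>split_space d E Es i. u \<noteq> 0\<^sub>v (d+1)) \<and>
          (\<forall>u\<in>split_space d E Es i.
             ((A - \<theta> (i-1) \<cdot>\<^sub>m 1\<^sub>m (d+1)) * (As - \<theta>s i \<cdot>\<^sub>m 1\<^sub>m (d+1))) *\<^sub>v u = \<phi> i \<cdot>\<^sub>v u)))"

definition second_split_sequence ::
    "nat \<Rightarrow> 'a::field mat \<Rightarrow> 'a mat \<Rightarrow> (nat \<Rightarrow> 'a mat) \<Rightarrow> (nat \<Rightarrow> 'a mat) \<Rightarrow> (nat \<Rightarrow> 'a) \<Rightarrow> bool" where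
  "second_split_sequence d A As E Es \<phi> \<longleftrightarrow> first_split_sequence d A As (\<lambda>i. E (d - i)) Es \<phi>"

record 'a scalar_array =
  eig :: "nat \<Rightarrow> 'a"
  dual_eig :: "nat \<Rightarrow> 'a"
  split1 :: "nat \<Rightarrow> 'a"
  split2 :: "nat \<Rightarrow> 'a"

text \<open>
  Fixing the values outside the index ranges makes equality of records the same as equality of
  the finite sequences.
\<close>
definition array_of_diameter :: "nat \<Rightarrow> 'a scalar_array \<Rightarrow> bool" where
  "array_of_diameter d p \<longleftrightarrow>
     eig p \<in> extensional {0..d} \<and> dual_eig p \<in> extensional {0..d} \<and>
     split1 p \<in> extensional {1..d} \<and> split2 p \<in> extensional {1..d}"

definition parameter_array :: "nat \<Rightarrow> 'a::field scalar_array \<Rightarrow> bool" where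
  "parameter_array d p \<longleftrightarrow> array_of_diameter d p \<and>
    (let \<theta> = eig p; \<theta>s = dual_eig p; \<phi>1 = split1 p; \<phi>2 = split2 p in
     (\<forall>i\<in>{1..d}. \<phi>1 i \<noteq> 0 \<and> \<phi>2 i \<noteq> 0) \<and>
     (\<forall>i\<le>d. \<forall>j\<le>d. i \<noteq> j \<longrightarrow> \<theta> i \<noteq> \<theta> j \<and> \<theta>s i \<noteq> \<theta>s j) \<and>
     (\<forall>i\<in>{1..d}. \<phi>1 i = \<phi>2 1 * (\<Sum>h=0..<i. (\<theta> h - \<theta> (d - h)) / (\<theta> 0 - \<theta> d))
                          + (\<theta>s i - \<theta>s 0) * (\<theta> (i - 1) - \<theta> d)) \<and>
     (\<forall>i\<in>{1..d}. \<phi>2 i = \<phi>1 1 * (\<Sum>h=0..<i. (\<theta> h - \<theta> (d - h)) / (\<theta> 0 - \<theta> d))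
                          + (\<theta>s i - \<theta>s 0) * (\<theta> (d - i + 1) - \<theta> 0)) \<and>
     (\<exists>c. \<forall>i\<in>{2..d-1}.
        (\<theta> (i-2) - \<theta> (i+1)) / (\<theta> (i-1) - \<theta> i) = c \<and>
        (\<theta>s (i-2) - \<theta>s (i+1)) / (\<theta>s (i-1) - \<theta>s i) = c))"

definition parameter_array_of_system ::
    "nat \<Rightarrow> 'a::field mat \<Rightarrow> 'a mat \<Rightarrow> (nat \<Rightarrow> 'a mat) \<Rightarrow> (nat \<Rightarrow> 'a mat) \<Rightarrow> 'a scalar_array \<Rightarrow> bool" where
  "parameter_array_of_system d A As E Es p \<longleftrightarrow> array_of_diameter d p \<and>
     associated_eigenvalues d A E (eig p) \<and> associated_eigenvalues d As Es (dual_eig p) \<and>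
     first_split_sequence d A As E Es (split1 p) \<and> second_split_sequence d A As E Es (split2 p)"

definition constant_row_sum :: "nat \<Rightarrow> 'a::field mat \<Rightarrow> 'a \<Rightarrow> bool" where
  "constant_row_sum d A c \<longleftrightarrow> (\<forall>i\<le>d. (\<Sum>j=0..d. A $$ (i,j)) = c)"

definition TD_D_canonical_form :: "nat \<Rightarrow> 'a::field mat \<Rightarrow> 'a mat \<Rightarrow> bool" where
  "TD_D_canonical_form d A As \<longleftrightarrow>
     leonard_pair d A As \<and> tridiagonal_mat A \<and> diagonal_mat As \<and>
     (\<exists>\<theta>. leonard_pair_eigenvalue_sequence d A As \<theta> \<and>
          (constant_row_sum d A (\<theta> 0) \<or> constant_row_sum d A (\<theta> d)))"

definition designated_leonard_system ::
    "nat \<Rightarrow> 'a::field mat \<Rightarrow> 'a mat \<Rightarrow> (nat \<Rightarrow> 'a mat) \<Rightarrow> (nat \<Rightarrow> 'a mat) \<Rightarrow> bool" where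
  "designated_leonard_system d A As E Es \<longleftrightarrow>
     leonard_system d A As E Es \<and>
     (\<exists>\<theta>. associated_eigenvalues d A E \<theta> \<and> constant_row_sum d A (\<theta> 0)) \<and>
     associated_eigenvalues d As Es (\<lambda>i. As $$ (i,i))"

definition designated_parameter_array ::
    "nat \<Rightarrow> 'a::field mat \<Rightarrow> 'a mat \<Rightarrow> 'a scalar_array \<Rightarrow> bool" where
  "designated_parameter_array d A As p \<longleftrightarrow>
     (\<exists>E Es. designated_leonard_system d A As E Es \<and> parameter_array_of_system d A As E Es p)"

text \<open>
  The case distinctions on the diagonal implement \<open>\<phi>\<^sub>0 = \<phi>\<^sub>d\<^sub>+\<^sub>1 = 0\<close>, with \<open>\<theta>*\<close> at -1 and d+1
  being indeterminates.
\<close>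
definition TD_D_entries :: "nat \<Rightarrow> 'a::field mat \<Rightarrow> 'a mat \<Rightarrow> 'a scalar_array \<Rightarrow> bool" where
  "TD_D_entries d A As p \<longleftrightarrow>
    (let \<theta> = eig p; \<theta>s = dual_eig p; \<phi>1 = split1 p; \<phi>2 = split2 p in
     (\<forall>i\<le>d. A $$ (i,i) = \<theta> i
        + (if i = 0 then 0 else \<phi>1 i / (\<theta>s i - \<theta>s (i-1)))
        + (if i = d then 0 else \<phi>1 (i+1) / (\<theta>s i - \<theta>s (i+1)))) \<and>
     (\<forall>i\<in>{1..d}. A $$ (i-1,i) =
        \<phi>1 i * ((\<Prod>h=0..<i-1. \<theta>s (i-1) - \<theta>s h) / (\<Prod>h=0..<i. \<theta>s i - \<theta>s h))) \<and>
     (\<forall>i\<in>{1..d}. A $$ (i,i-1) =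
        \<phi>2 i * ((\<Prod>h=i+1..d. \<theta>s i - \<theta>s h) / (\<Prod>h=i..d. \<theta>s (i-1) - \<theta>s h))) \<and>
     (\<forall>i\<le>d. As $$ (i,i) = \<theta>s i))"

end

theory Submission
  imports Defs
begin

text \<open>
  Identify \<open>K^(d+1)\<close> with the functions on the nodes \<open>\<theta>*\<^sub>0,\<dots>,\<theta>*\<^sub>d\<close>, hence with the polynomials of
  degree at most \<open>d\<close>, so that \<open>A*\<close> is multiplication by \<open>x\<close>. If the row sums of \<open>A\<close> are \<open>\<theta>\<^sub>0\<close>, the sum of
  the first \<open>n+1\<close> eigenspaces of \<open>A\<close> is the space of polynomials of degree at most \<open>n\<close>, and
  tridiagonality of \<open>A\<close> gives \<open>A t\<^sub>n = \<theta>\<^sub>n t\<^sub>n + \<phi>\<^sub>n t\<^sub>n\<^sub>-\<^sub>1\<close> for the Newton polynomials \<open>t\<^sub>n\<close> of the nodes,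
  together with an analogous relation (with the second split sequence) for the nodes in reversed
  order. Conversely, these relations with distinct eigenvalues and nonzero split sequences give a
  Leonard system, because an irreducible tridiagonal matrix is self-adjoint for a diagonal form.
  So everything reduces to deciding when a matrix defined by its action on the \<open>t\<^sub>n\<close> is tridiagonal.
  For sequences with a common three-term recurrence this follows from an Askey-Wilson relation
  \<open>A*\<^sup>2 A - \<beta> A* A A* + A A*\<^sup>2 - \<gamma> (A* A + A A*) - \<rho> A = g(A*)\<close>, whose off-diagonal entries are multiples of
  \<open>(\<theta>*\<^sub>i - \<theta>*\<^sub>j\<^sub>-\<^sub>1) (\<theta>*\<^sub>i - \<theta>*\<^sub>j\<^sub>+\<^sub>1) A\<^sub>i\<^sub>j\<close>; only the corner entry \<open>A\<^sub>d\<^sub>0\<close> needs a separate computation.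
\<close>

text \<open>Nothing is assumed about the characteristic or about \<beta>, so closed forms of the
  sequences, which split into cases, are avoided: each identity between the two sequences comes from
  their recurrences and a few initial values. For this purpose the sequences are continued to all
  integers. The continuation also explains the exceptional corner. The factor of
  \<open>A\<^sub>i\<^sub>j\<close> can be written with the neighbours of i or with those of j.
  Elsewhere below the subdiagonal one choice stays inside 0..d, where the nodes are distinct; at
  (d,0) both choices leave this range, and the outer terms may coincide with nodes, for instance
  when the sequence has period d+1. The reversed nodes give Newton polynomials spanning the same
  flag of degrees. Comparing coefficients just below the leading ones expresses the second split
  sequence through the first; this is the source of the second split condition. Over a general field
  the diagonal form may have isotropic vectors, so nonzero norms of eigenvectors come from
  nondegeneracy instead of positivity.\<close>

hide_const (open) Module.smult

section \<open>Recurrent sequences\<close>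

locale recurrent =
  fixes \<beta> \<gamma> :: "'a::field" and s :: "int \<Rightarrow> 'a"
  assumes rec: "s (i - 1) + s (i + 1) = \<beta> * s i + \<gamma>"
begin

lemma up: "s (i + 2) = \<beta> * s (i + 1) + \<gamma> - s i"
proof -
  have "s i + s (i + 2) = \<beta> * s (i + 1) + \<gamma>"
    using rec[of "i + 1"] by (simp add: add.assoc)
  then show ?thesis by Groebner_Basis.algebra
qed

lemma down: "s (i - 1) = \<beta> * s i + \<gamma> - s (i + 1)"
  using rec[of i] by Groebner_Basis.algebra

text \<open>The subtracted constant is the value of the quadratic at the first two terms, a quantity
  that the recurrence conserves. At the nodes i and j the conic is the factor of
  \<open>A\<^sub>i\<^sub>j\<close> in the Askey-Wilson relation.\<close>

definition conic :: "'a \<Rightarrow> 'a \<Rightarrow> 'a" where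
  "conic x y = x\<^sup>2 - \<beta> * x * y + y\<^sup>2 - \<gamma> * (x + y)
     - ((s 0)\<^sup>2 - \<beta> * s 0 * s 1 + (s 1)\<^sup>2 - \<gamma> * (s 0 + s 1))"

lemma conic_commute: "conic x y = conic y x"
  unfolding conic_def by Groebner_Basis.algebra

text \<open>For fixed \<open>s (i + 1)\<close> the conic is a monic quadratic in the other variable,
  and its two roots sum to \<open>\<beta> * s (i + 1) + \<gamma>\<close>, that is to
  \<open>s i + s (i + 2)\<close>. Hence it takes equal values at these two points.\<close>

lemma conic_step: "conic (s i) (s (i + 1)) = conic (s (i + 1)) (s (i + 2))"
  unfolding up conic_def by Groebner_Basis.algebra

lemma conic_zero: "conic (s i) (s (i + 1)) = 0"
proof (induction i rule: int_induct[where k = 0])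
  case base
  then show ?case by (simp add: conic_def)
next
  case (step1 i)
  then show ?case using conic_step[of i] by (simp add: add.assoc)
next
  case (step2 i)
  then show ?case using conic_step[of "i - 1"] by (simp add: add.commute)
qed

text \<open>Vieta: the two neighbours of \<open>s i\<close> are the roots of the monic quadratic
  \<open>conic (s i)\<close>.\<close>

lemma conic_eq: "conic (s i) y = (y - s (i - 1)) * (y - s (i + 1))"
  using conic_zero[of i] down[of i] unfolding conic_def by Groebner_Basis.algebra

end

section \<open>Two sequences with a common three-term recurrence\<close>

locale recurrent_pair = s: recurrent \<beta> \<gamma> s + t: recurrent \<beta> \<delta> t
  for \<beta> \<gamma> \<delta> :: "'a::field" and s t :: "int \<Rightarrow> 'a" +
  fixes d :: nat
begin

definition gap_s :: "nat \<Rightarrow> 'a" where "gap_s n = s (int n) - s (int d - int n)"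
definition gap_t :: "nat \<Rightarrow> 'a" where "gap_t n = t (int n) - t (int d - int n)"

text \<open>The constant \<gamma> cancels between a term and its mirror image, so the recurrence
  becomes homogeneous with the same \<beta>. This is what makes the Casoratian of two gap sequences
  constant.\<close>

lemma gap_s_rec: "gap_s (Suc (Suc n)) = \<beta> * gap_s (Suc n) - gap_s n"
proof -
  have "s (int n + 2) = \<beta> * s (int n + 1) + \<gamma> - s (int n)"
    "s (int d - int n) = \<beta> * s (int d - int n - 1) + \<gamma> - s (int d - int n - 2)"
    using s.up[of n] s.up[of "int d - int n - 2"] by simp_all
  moreover have "gap_s (Suc (Suc n)) = s (int n + 2) - s (int d - int n - 2)"
    "gap_s (Suc n) = s (int n + 1) - s (int d - int n - 1)"
    by (simp_all add: gap_s_def algebra_simps)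
  ultimately show ?thesis unfolding gap_s_def[of n] by Groebner_Basis.algebra
qed

lemma gap_t_rec: "gap_t (Suc (Suc n)) = \<beta> * gap_t (Suc n) - gap_t n"
proof -
  have "t (int n + 2) = \<beta> * t (int n + 1) + \<delta> - t (int n)"
    "t (int d - int n) = \<beta> * t (int d - int n - 1) + \<delta> - t (int d - int n - 2)"
    using t.up[of n] t.up[of "int d - int n - 2"] by simp_all
  moreover have "gap_t (Suc (Suc n)) = t (int n + 2) - t (int d - int n - 2)"
    "gap_t (Suc n) = t (int n + 1) - t (int d - int n - 1)"
    by (simp_all add: gap_t_def algebra_simps)
  ultimately show ?thesis unfolding gap_t_def[of n] by Groebner_Basis.algebra
qed

lemma casoratian_const:
  "gap_s (Suc n) * gap_t n - gap_s n * gap_t (Suc n) = gap_s 1 * gap_t 0 - gap_s 0 * gap_t 1"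
proof (induction n)
  case (Suc n)
  then show ?case using gap_s_rec[of n] gap_t_rec[of n] by Groebner_Basis.algebra
qed simp

text \<open>The Casoratian of the two gap sequences vanishes at the centre of \<open>0,\<dots>,d\<close>.\<close>

lemma casoratian_zero: "gap_s (Suc n) * gap_t n = gap_s n * gap_t (Suc n)"
proof -
  define k where "k = d div 2"
  have "d = 2 * k \<or> d = 2 * k + 1" unfolding k_def by presburger
  then have "gap_s (Suc k) * gap_t k - gap_s k * gap_t (Suc k) = 0"
  proof
    assume "d = 2 * k"
    then have "int d - int k = int k" by simp
    then have "gap_s k = 0" "gap_t k = 0" by (simp_all only: gap_s_def gap_t_def diff_self)
    then show ?thesis by simp
  next
    assume "d = 2 * k + 1"
    then have "int d - int k = int (Suc k)" "int d - int (Suc k) = int k" by simp_all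
    then have "gap_s (Suc k) = - gap_s k" "gap_t (Suc k) = - gap_t k"
      by (simp_all only: gap_s_def gap_t_def minus_diff_eq)
    then show ?thesis by simp
  qed
  then show ?thesis using casoratian_const[of n] casoratian_const[of k] by simp
qed

text \<open>Both sides satisfy the same second-order recurrence in n, and they agree at n = 1
  because the Casoratian vanishes. No division takes place, so zero gaps are allowed.\<close>

lemma gap_proportional: "gap_s n * gap_t 0 = gap_s 0 * gap_t n"
proof (induction n rule: induct_nat_012)
  case 1
  show ?case using casoratian_zero[of 0] by simp
next
  case (ge2 n)
  then show ?case using gap_s_rec[of n] gap_t_rec[of n] by Groebner_Basis.algebra
qed simp

definition sum_s :: "nat \<Rightarrow> 'a" where "sum_s n = (\<Sum>h<n. gap_s h)"
definition sum_t :: "nat \<Rightarrow> 'a" where "sum_t n = (\<Sum>h<n. gap_t h)"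

lemma sum_s_simps [simp]: "sum_s 0 = 0" "sum_s (Suc n) = sum_s n + gap_s n"
  by (simp_all add: sum_s_def)

lemma sum_t_simps [simp]: "sum_t 0 = 0" "sum_t (Suc n) = sum_t n + gap_t n"
  by (simp_all add: sum_t_def)

text \<open>If the gaps at 0 are nonzero, the normalised sums occurring in the split conditions are
  therefore the same for both sequences.\<close>

lemma sum_proportional: "sum_s n * gap_t 0 = gap_s 0 * sum_t n"
  unfolding sum_s_def sum_t_def sum_distrib_left sum_distrib_right
  by (rule sum.cong) (simp_all add: gap_proportional)

lemma gap_t_antisym: "n \<le> d \<Longrightarrow> gap_t (d - n) = - gap_t n"
  by (simp add: gap_t_def of_nat_diff)

text \<open>The gaps at h and d - h cancel. This is the reason why \<open>\<phi> r (Suc d)\<close>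
  vanishes.\<close>

lemma sum_t_Suc_d: "sum_t (Suc d) = 0"
proof -
  have "(\<Sum>h<Suc d. t (int d - int h)) = (\<Sum>h<Suc d. t (int (Suc d - Suc h)))"
    by (rule sum.cong) (auto simp: of_nat_diff)
  also have "\<dots> = (\<Sum>h<Suc d. t (int h))"
    by (rule sum.nat_diff_reindex)
  finally show ?thesis by (simp only: sum_t_def gap_t_def sum_subtractf) simp
qed

lemma sum_t_flip: "n \<le> Suc d \<Longrightarrow> sum_t (Suc d - n) = sum_t n"
proof (induction n)
  case 0
  then show ?case using sum_t_Suc_d by simp
next
  case (Suc n)
  then have "Suc d - n = Suc (d - n)" by simp
  then have "sum_t (Suc d - n) = sum_t (d - n) + gap_t (d - n)" by simp
  then show ?case using Suc gap_t_antisym[of n] by simp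
qed

text \<open>Put D_n = (s n - s (n+1), t n - t (n+1)). The claim equates the determinant of D_(n+1),
  D_1 with that of D_n, D_0. All D_n obey one homogeneous recurrence, hence so do both determinants
  as functions of n, and the first two values agree.\<close>

lemma wedge_shift:
  "(s (int n + 1) - s (int n + 2)) * (t 1 - t 2) - (t (int n + 1) - t (int n + 2)) * (s 1 - s 2)
   = (s (int n) - s (int n + 1)) * (t 0 - t 1) - (t (int n) - t (int n + 1)) * (s 0 - s 1)"
proof (induction n rule: induct_nat_012)
  case 1
  have "s 2 = \<beta> * s 1 + \<gamma> - s 0" "t 2 = \<beta> * t 1 + \<delta> - t 0"
    "s 3 = \<beta> * s 2 + \<gamma> - s 1" "t 3 = \<beta> * t 2 + \<delta> - t 1"
    using s.up[of 0] t.up[of 0] s.up[of 1] t.up[of 1] by simp_all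
  then have "s 2 - s 3 = \<beta> * (s 1 - s 2) - (s 0 - s 1)" "t 2 - t 3 = \<beta> * (t 1 - t 2) - (t 0 - t 1)"
    by Groebner_Basis.algebra+
  moreover have i: "int (Suc 0) = 1" "(1::int) + 1 = 2" "(1::int) + 2 = 3"
    by simp_all
  ultimately show ?case unfolding i by Groebner_Basis.algebra
next
  case (ge2 n)
  have r: "s (int n + 2) = \<beta> * s (int n + 1) + \<gamma> - s (int n)"
    "t (int n + 2) = \<beta> * t (int n + 1) + \<delta> - t (int n)"
    "s (int n + 3) = \<beta> * s (int n + 2) + \<gamma> - s (int n + 1)"
    "t (int n + 3) = \<beta> * t (int n + 2) + \<delta> - t (int n + 1)"
    "s (int n + 4) = \<beta> * s (int n + 3) + \<gamma> - s (int n + 2)"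
    "t (int n + 4) = \<beta> * t (int n + 3) + \<delta> - t (int n + 2)"
    using s.up[of n] t.up[of n] s.up[of "int n + 1"] t.up[of "int n + 1"]
      s.up[of "int n + 2"] t.up[of "int n + 2"] by (simp_all add: add.assoc)
  have i: "int (Suc n) = int n + 1" "int n + 1 + 1 = int n + 2" "int n + 1 + 2 = int n + 3"
    "int (Suc (Suc n)) = int n + 2" "int n + 2 + 1 = int n + 3" "int n + 2 + 2 = int n + 4"
    by simp_all
  show ?case using ge2 r unfolding i by Groebner_Basis.algebra
qed simp

text \<open>Passing from n to n + 1 changes the left side by \<open>wedge_shift\<close>, so it stays
  constant. At n = d - 1 the identity ties the last two terms to the first three.\<close>

lemma corner:
  "s (int n + 1) * (t 2 - t 1) - t (int n + 1) * (s 2 - s 1)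
   + s (int n) * (t 0 - t 1) - t (int n) * (s 0 - s 1)
   + t 1 * (s 0 + s 2) - s 1 * (t 0 + t 2) = 0"
proof (induction n)
  case 0
  show ?case by simp Groebner_Basis.algebra
next
  case (Suc n)
  have i: "int (Suc n) = int n + 1" "int n + 1 + 1 = int n + 2" by simp_all
  show ?case using Suc wedge_shift[of n] unfolding i by Groebner_Basis.algebra
qed

text \<open>This is the \<open>split1\<close> condition of a parameter array, with r in place of
  \<open>split2 1 / (t 0 - t d)\<close>. At n = 0 the term \<open>t (-1)\<close> meets a zero
  factor, and at n = d + 1 both summands vanish, so the two boundary conventions hold
  automatically.\<close>

definition \<phi> :: "'a \<Rightarrow> nat \<Rightarrow> 'a" where
  "\<phi> r n = r * sum_t n + (s (int n) - s 0) * (t (int n - 1) - t (int d))"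

lemma \<phi>_0 [simp]: "\<phi> r 0 = 0"
  by (simp add: \<phi>_def)

lemma \<phi>_Suc_d [simp]: "\<phi> r (Suc d) = 0"
  using sum_t_Suc_d by (simp add: \<phi>_def)

text \<open>After collecting all terms on one side, this is up to sign the value of row d on
  \<open>(x - s d) * (x - s (d - 1))\<close> computed in \<open>corner_row_sum\<close>. The terms
  with r cancel by \<open>sum_proportional\<close>; the rest is \<open>corner\<close>.\<close>

lemma corner_\<phi>:
  assumes "d \<ge> 1"
  shows "gap_s 0 * (t 2 * (s (int d) - s 1) + \<phi> r 2 + sum_s 2 * t 1 - t 0 * (s 0 - s (int d - 1)))
    = sum_s 2 * \<phi> r 1"
proof -
  have "int (d - 1) + 1 = int d" "int (d - 1) = int d - 1" using assms by simp_all
  with corner[of "d - 1"]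
  have c: "s (int d) * (t 2 - t 1) - t (int d) * (s 2 - s 1)
   + s (int d - 1) * (t 0 - t 1) - t (int d - 1) * (s 0 - s 1)
   + t 1 * (s 0 + s 2) - s 1 * (t 0 + t 2) = 0" by simp
  have p: "sum_s 2 * gap_t 0 = gap_s 0 * sum_t 2" by (rule sum_proportional)
  have e: "\<phi> r 2 = r * sum_t 2 + (s 2 - s 0) * (t 1 - t (int d))"
    "\<phi> r 1 = r * gap_t 0 + (s 1 - s 0) * gap_t 0"
    "gap_s 0 = s 0 - s (int d)" "gap_t 0 = t 0 - t (int d)"
    "sum_s 2 = s 0 - s (int d) + s 1 - s (int d - 1)"
    "sum_t 2 = t 0 - t (int d) + t 1 - t (int d - 1)"
    by (simp_all add: \<phi>_def numeral_2_eq_2 gap_s_def gap_t_def)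
  show ?thesis using c p e by Groebner_Basis.algebra
qed

text \<open>The right side of \<open>reversed_parameter\<close> minus its left side; the terms with
  r cancel.\<close>

definition defect :: "nat \<Rightarrow> 'a" where
  "defect n = (s 1 - s 0) * sum_t n + (s (int d - int n + 1) - s 0) * (t (int n) - t 0)
     - (s (int n) - s 0) * (t (int n - 1) - t (int d)) + (t (int n) - t (int n - 1)) * sum_s n"

text \<open>With F the shift in n this reads
  \<open>(F - 1) (F^2 - \<beta> F + 1) defect = 0\<close>. A third-order equation reduces the
  vanishing of \<open>defect\<close> to three initial values.\<close>

lemma defect_rec:
  "defect (Suc (Suc (Suc n))) - \<beta> * defect (Suc (Suc n)) + defect (Suc n)
   = defect (Suc (Suc n)) - \<beta> * defect (Suc n) + defect n"
proof -
  have i: "int (Suc n) = int n + 1" "int (Suc (Suc n)) = int n + 2"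
    "int (Suc (Suc (Suc n))) = int n + 3" "int d - (int n + 1) + 1 = int d - int n"
    "int d - (int n + 2) + 1 = int d - int n - 1" "int d - (int n + 3) + 1 = int d - int n - 2"
    "int n + 1 - 1 = int n" "int n + 2 - 1 = int n + 1" "int n + 3 - 1 = int n + 2" by simp_all
  have r: "s (int n + 2) = \<beta> * s (int n + 1) + \<gamma> - s (int n)"
    "t (int n + 2) = \<beta> * t (int n + 1) + \<delta> - t (int n)"
    "s (int n + 3) = \<beta> * s (int n + 2) + \<gamma> - s (int n + 1)"
    "t (int n + 3) = \<beta> * t (int n + 2) + \<delta> - t (int n + 1)"
    "t (int n - 1) = \<beta> * t (int n) + \<delta> - t (int n + 1)"
    "s (int d - int n + 1) = \<beta> * s (int d - int n) + \<gamma> - s (int d - int n - 1)"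
    "s (int d - int n) = \<beta> * s (int d - int n - 1) + \<gamma> - s (int d - int n - 2)"
    using s.up[of n] t.up[of n] s.up[of "int n + 1"] t.up[of "int n + 1"] t.down[of "int n"]
      s.up[of "int d - int n - 1"] s.up[of "int d - int n - 2"] by (simp_all add: algebra_simps)
  have g: "gap_s n = s (int n) - s (int d - int n)" "gap_s (Suc n) = s (int n + 1) - s (int d - int n - 1)"
    "gap_s (Suc (Suc n)) = s (int n + 2) - s (int d - int n - 2)"
    by (simp_all add: gap_s_def algebra_simps)
  have h: "gap_t (Suc (Suc n)) = \<beta> * gap_t (Suc n) - gap_t n" by (rule gap_t_rec)
  show ?thesis unfolding defect_def sum_s_simps sum_t_simps i using r g h by Groebner_Basis.algebra
qed

lemma defect_zero: "defect n = 0" if "d \<ge> 1"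
proof -
  have "int (d - 1) + 1 = int d" "int (d - 1) = int d - 1" using that by simp_all
  \<comment> \<open>The values at 0 and 1 vanish by cancellation; the value at 2 is the instance of
    \<open>corner\<close> at the far end of the nodes.\<close>
  with corner[of "d - 1"]
  have "s (int d) * (t 2 - t 1) - t (int d) * (s 2 - s 1)
   + s (int d - 1) * (t 0 - t 1) - t (int d - 1) * (s 0 - s 1)
   + t 1 * (s 0 + s 2) - s 1 * (t 0 + t 2) = 0" by simp
  moreover have "defect (Suc (Suc 0)) = (s 1 - s 0) * (gap_t 0 + gap_t 1) + (s (int d - 1) - s 0) * (t 2 - t 0)
     - (s 2 - s 0) * (t 1 - t (int d)) + (t 2 - t 1) * (gap_s 0 + gap_s 1)"
    by (simp add: defect_def)
  ultimately have 2: "defect (Suc (Suc 0)) = 0"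
    unfolding gap_s_def gap_t_def by simp Groebner_Basis.algebra
  have "defect n = 0 \<and> defect (Suc n) = 0 \<and> defect (Suc (Suc n)) = 0"
  proof (induction n)
    case 0
    have "defect 0 = 0" "defect (Suc 0) = 0"
      by (simp_all add: defect_def gap_s_def gap_t_def algebra_simps)
    then show ?case using 2 by simp
  next
    case (Suc n)
    then show ?case using defect_rec[of n] by simp
  qed
  then show ?thesis by simp
qed

text \<open>The coefficient of y in \<open>quad r n y\<close>, simplified by the recurrences of s
  and t.\<close>

definition invariant :: "'a \<Rightarrow> nat \<Rightarrow> 'a" where
  "invariant r n = \<phi> r n - \<beta> * \<phi> r (Suc n) + \<phi> r (Suc (Suc n))
     + t (int n) * (s (int n) - s (int n - 1)) + t (int n + 1) * (s (int n + 1) - s (int n + 2))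
     - \<delta> * (s (int n) + s (int n + 1))"

lemma invariant_Suc: "invariant r (Suc n) = invariant r n"
proof -
  have i: "int (Suc n) = int n + 1" "int (Suc (Suc n)) = int n + 2"
    "int (Suc (Suc (Suc n))) = int n + 3"
    "int n + 1 - 1 = int n" "int n + 2 - 1 = int n + 1" "int n + 3 - 1 = int n + 2"
    "int n + 1 + 1 = int n + 2" "int n + 1 + 2 = int n + 3" by simp_all
  have r: "s (int n + 2) = \<beta> * s (int n + 1) + \<gamma> - s (int n)"
    "t (int n + 2) = \<beta> * t (int n + 1) + \<delta> - t (int n)"
    "s (int n + 3) = \<beta> * s (int n + 2) + \<gamma> - s (int n + 1)"
    "t (int n - 1) = \<beta> * t (int n) + \<delta> - t (int n + 1)"
    "s (int n - 1) = \<beta> * s (int n) + \<gamma> - s (int n + 1)"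
    using s.up[of n] t.up[of n] s.up[of "int n + 1"] t.down[of "int n"] s.down[of "int n"]
    by (simp_all add: add.assoc)
  have h: "gap_t (Suc (Suc n)) = \<beta> * gap_t (Suc n) - gap_t n" by (rule gap_t_rec)
  show ?thesis unfolding invariant_def \<phi>_def sum_t_simps i using r h by Groebner_Basis.algebra
qed

text \<open>The factor by which the matrix weighted with the conic multiplies the n-th Newton
  polynomial at y, see \<open>conic_act\<close>. Its independence of n makes it the polynomial g of
  the Askey-Wilson relation.\<close>

definition quad :: "'a \<Rightarrow> nat \<Rightarrow> 'a \<Rightarrow> 'a" where
  "quad r n y = t (int n + 2) * (y - s (int n)) * (y - s (int n + 1)) + \<phi> r (Suc (Suc n)) * (y - s (int n))
     + (s (int n) + s (int n + 1) - \<beta> * y - \<gamma>) * (t (int n + 1) * (y - s (int n)) + \<phi> r (Suc n))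
     + s.conic y (s (int n)) * t (int n) + \<phi> r n * (y - s (int n + 1))"

text \<open>As a quadratic in y, \<open>quad\<close> has leading coefficient \<delta> by the
  recurrence of t and linear coefficient \<open>invariant\<close>. The comparison of the constant
  terms also needs that consecutive terms of s lie on the conic.\<close>

lemma quad_Suc: "quad r (Suc n) y = quad r n y"
proof -
  have i: "int (Suc n) = int n + 1"
    "int n + 1 + 1 = int n + 2" "int n + 1 + 2 = int n + 3" by simp_all
  have r: "s (int n + 2) = \<beta> * s (int n + 1) + \<gamma> - s (int n)"
    "t (int n + 2) = \<beta> * t (int n + 1) + \<delta> - t (int n)"
    "t (int n + 3) = \<beta> * t (int n + 2) + \<delta> - t (int n + 1)"
    "s (int n - 1) = \<beta> * s (int n) + \<gamma> - s (int n + 1)"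
    "s (int n + 3) = \<beta> * s (int n + 2) + \<gamma> - s (int n + 1)"
    using s.up[of n] t.up[of n] s.up[of "int n + 1"] t.up[of "int n + 1"] s.down[of "int n"]
    by (simp_all add: add.assoc)
  have "invariant r (Suc n) = invariant r n" by (rule invariant_Suc)
  note inv = this[unfolded invariant_def i]
  have j: "int n + 1 - 1 = int n" by simp
  have c: "s.conic (s (int n)) (s (int n + 1)) = 0" by (rule s.conic_zero)
  show ?thesis
    using inv r c unfolding quad_def s.conic_def i j by Groebner_Basis.algebra
qed

lemma quad_const: "quad r n y = quad r 0 y"
  by (induction n) (simp_all add: quad_Suc)

end

section \<open>Polynomials on a finite set of nodes\<close>

definition node_poly :: "(nat \<Rightarrow> 'a::field) \<Rightarrow> nat \<Rightarrow> 'a poly" where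
  "node_poly s n = (\<Prod>k<n. [:- s k, 1:])"

lemma node_poly_0 [simp]: "node_poly s 0 = 1"
  by (simp add: node_poly_def)

lemma node_poly_Suc: "node_poly s (Suc n) = node_poly s n * [:- s n, 1:]"
  by (simp only: node_poly_def prod.lessThan_Suc)

lemma poly_node_poly: "poly (node_poly s n) x = (\<Prod>k<n. x - s k)"
  by (simp add: node_poly_def poly_prod)

lemma poly_node_poly_Suc: "poly (node_poly s (Suc n)) x = poly (node_poly s n) x * (x - s n)"
  by (simp add: poly_node_poly)

lemma monic_node_poly: "degree (node_poly s n) = n \<and> coeff (node_poly s n) n = 1"
proof (induction n)
  case (Suc n)
  then have "node_poly s n \<noteq> 0" by auto
  then have "degree (node_poly s (Suc n)) = Suc n"
    using Suc by (simp only: node_poly_Suc) (subst degree_mult_eq, auto)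
  moreover have "lead_coeff (node_poly s (Suc n)) = 1"
    using Suc unfolding node_poly_Suc lead_coeff_mult by simp
  ultimately show ?case by simp
qed simp

lemmas degree_node_poly [simp] = monic_node_poly[THEN conjunct1]
  and lead_coeff_node_poly [simp] = monic_node_poly[THEN conjunct2]

text \<open>This coefficient is the first place where the Newton polynomials of the nodes and of the
  reversed nodes differ, and the difference enters the formula for the second split
  sequence.\<close>

lemma coeff_node_poly_Suc: "coeff (node_poly s (Suc n)) n = - (\<Sum>k<Suc n. s k)"
proof (induction n)
  case 0
  show ?case by (simp add: node_poly_Suc)
next
  case (Suc n)
  have "coeff (node_poly s (Suc (Suc n))) (Suc n)
    = coeff (node_poly s (Suc n)) n - s (Suc n) * coeff (node_poly s (Suc n)) (Suc n)"
    by (simp only: node_poly_Suc[of s "Suc n"]) (simp add: algebra_simps)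
  then show ?case using Suc by simp
qed

lemma poly_node_poly_zero: "k < n \<Longrightarrow> poly (node_poly s n) (s k) = 0"
  by (auto simp: poly_node_poly)

lemma poly_node_poly_nonzero:
  "inj_on s {..d} \<Longrightarrow> n \<le> i \<Longrightarrow> i \<le> d \<Longrightarrow> poly (node_poly s n) (s i) \<noteq> 0"
  using inj_onD[of s "{..d}" i] by (fastforce simp: poly_node_poly)

lemma poly_eq_0_of_nodes:
  assumes "inj_on s {..<n}" "\<And>k. k < n \<Longrightarrow> poly p (s k) = 0" "degree p < n"
  shows "p = (0::'a::field poly)"
proof (rule ccontr)
  assume p: "p \<noteq> 0"
  have "n = card (s ` {..<n})" using assms(1) by (simp add: card_image)
  also have "\<dots> \<le> card {x. poly p x = 0}"
    by (rule card_mono) (use p assms(2) in \<open>auto simp: poly_roots_finite\<close>)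
  also have "\<dots> \<le> degree p" using p by (rule card_poly_roots_bound)
  finally show False using assms(3) by simp
qed

lemma degree_diff_smult_less:
  assumes "degree p \<le> n" "degree q \<le> n" "coeff q n = 1" "n > 0"
  shows "degree (p - smult (coeff p n) q :: 'a::field poly) < n"
proof -
  have "degree (p - smult (coeff p n) q) \<le> n"
    using assms by (auto intro!: degree_diff_le order.trans[OF degree_smult_le])
  moreover have "coeff (p - smult (coeff p n) q) n = 0" using assms by simp
  ultimately show ?thesis
    using assms(4) by (metis le_neq_implies_less leading_coeff_0_iff degree_0)
qed

lemma coeff_mult_degree_bounds:
  assumes "degree p \<le> m" "degree q \<le> n"
  shows "coeff (p * q :: 'a::field poly) (m + n) = coeff p m * coeff q n"
proof (cases "degree p = m \<and> degree q = n")
  case True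
  then show ?thesis using coeff_mult_degree_sum[of p q] by simp
next
  case False
  then have "degree p + degree q < m + n" "coeff p m = 0 \<or> coeff q n = 0"
    using assms by (auto simp: coeff_eq_0)
  then show ?thesis
    using degree_mult_le[of p q] by (auto simp: coeff_eq_0)
qed

lemma poly_eq_smult_node_poly:
  assumes "inj_on s {..<n}" "\<And>k. k < n \<Longrightarrow> poly p (s k) = 0" "degree p \<le> n"
  shows "p = smult (coeff p n) (node_poly s n)"
proof (cases "n = 0")
  case True
  then obtain a where "p = [:a:]" using assms(3) by (metis degree_eq_zeroE le_zero_eq)
  then show ?thesis using True by simp
next
  case False
  have "p - smult (coeff p n) (node_poly s n) = 0"
  proof (rule poly_eq_0_of_nodes)
    show "degree (p - smult (coeff p n) (node_poly s n)) < n"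
      using assms False by (intro degree_diff_smult_less) auto
  qed (use assms in \<open>auto simp: poly_node_poly_zero\<close>)
  then show ?thesis by simp
qed

lemma poly_eq_of_nodes:
  assumes "inj_on s {..d}" "\<And>k. k \<le> d \<Longrightarrow> poly p (s k) = poly q (s k)" "degree p \<le> d" "degree q \<le> d"
  shows "p = (q::'a::field poly)"
proof -
  have "p - q = 0"
  proof (rule poly_eq_0_of_nodes)
    show "inj_on s {..<Suc d}" using assms(1) by (simp add: lessThan_Suc_atMost)
    show "degree (p - q) < Suc d" using assms by (meson degree_diff_le less_Suc_eq_le)
  qed (use assms in auto)
  then show ?thesis by simp
qed

lemma interpolation_ex:
  fixes f s :: "nat \<Rightarrow> 'a::field"
  assumes "inj_on s {..d}"
  shows "\<exists>p. degree p \<le> d \<and> (\<forall>k\<le>d. poly p (s k) = f k)"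
  using assms
proof (induction d)
  case 0
  show ?case by (rule exI[of _ "[:f 0:]"]) simp
next
  case (Suc d)
  then obtain p where p: "degree p \<le> d" "\<forall>k\<le>d. poly p (s k) = f k"
    using inj_on_subset[OF Suc.prems] by (metis atMost_subset_iff le_SucI order_refl)
  let ?t = "node_poly s (Suc d)"
  have t: "poly ?t (s (Suc d)) \<noteq> 0" by (rule poly_node_poly_nonzero[OF Suc.prems]) auto
  define q where "q = p + smult ((f (Suc d) - poly p (s (Suc d))) / poly ?t (s (Suc d))) ?t"
  have "degree q \<le> Suc d" unfolding q_def
    using p(1) by (intro degree_add_le) (auto intro: order.trans[OF degree_smult_le])
  moreover have "poly q (s k) = f k" if "k \<le> Suc d" for k
  proof (cases "k = Suc d")
    case True
    then show ?thesis using t by (simp add: q_def)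
  next
    case False
    then have "poly ?t (s k) = 0" using that by (intro poly_node_poly_zero) simp
    then show ?thesis using p(2) that False by (simp add: q_def)
  qed
  ultimately show ?case by blast
qed

text \<open>The values of the Newton polynomials at the nodes form a triangular matrix with nonzero
  diagonal. Read from n = d downwards, the conditions remove the entries of f one at a time.\<close>

lemma node_functional_zero:
  fixes f s :: "nat \<Rightarrow> 'a::field"
  assumes inj: "inj_on s {..d}"
    and zero: "\<And>n. m \<le> n \<Longrightarrow> n \<le> d \<Longrightarrow> (\<Sum>j\<le>d. f j * poly (node_poly s n) (s j)) = 0"
  shows "m \<le> j \<Longrightarrow> j \<le> d \<Longrightarrow> f j = 0"
proof (induction "d - j" arbitrary: j rule: less_induct)
  case less
  have "(\<Sum>k\<le>d. f k * poly (node_poly s j) (s k)) = (\<Sum>k\<in>{j}. f k * poly (node_poly s j) (s k))"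
  proof (rule sum.mono_neutral_right)
    show "\<forall>k\<in>{..d} - {j}. f k * poly (node_poly s j) (s k) = 0"
    proof
      fix k assume k: "k \<in> {..d} - {j}"
      show "f k * poly (node_poly s j) (s k) = 0"
      proof (cases "k < j")
        case True
        then show ?thesis by (simp add: poly_node_poly_zero)
      next
        case False
        then have "f k = 0" using less.hyps[of k] less.prems k by auto
        then show ?thesis by simp
      qed
    qed
  qed (use less in auto)
  then have "f j * poly (node_poly s j) (s j) = 0" using zero less by simp
  then show ?case using poly_node_poly_nonzero[OF inj, of j j] less by simp
qed

text \<open>Back substitution in the same triangular system: changing f at m does not disturb the
  conditions for n > m, since those Newton polynomials vanish at node m. The lemma serves to define
  matrix rows and dual vectors by prescribed pairings.\<close>

lemma node_functional_ex:
  fixes b s :: "nat \<Rightarrow> 'a::field"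
  assumes inj: "inj_on s {..d}"
  shows "\<exists>f. \<forall>n\<le>d. (\<Sum>j\<le>d. f j * poly (node_poly s n) (s j)) = b n"
proof -
  have "\<exists>f. \<forall>n. m \<le> n \<and> n \<le> d \<longrightarrow> (\<Sum>j\<le>d. f j * poly (node_poly s n) (s j)) = b n"
    if "m \<le> Suc d" for m
    using that
  proof (induction m rule: inc_induct)
    case base
    then show ?case by auto
  next
    case (step m)
    then obtain f where f: "\<And>n. Suc m \<le> n \<Longrightarrow> n \<le> d \<Longrightarrow> (\<Sum>j\<le>d. f j * poly (node_poly s n) (s j)) = b n"
      by blast
    have m: "m \<le> d" using step by simp
    define S where "S = (\<Sum>j\<in>{..d} - {m}. f j * poly (node_poly s m) (s j))"
    define g where "g = f(m := (b m - S) / poly (node_poly s m) (s m))"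
    have split: "(\<Sum>j\<le>d. g j * poly (node_poly s n) (s j))
      = g m * poly (node_poly s n) (s m) + (\<Sum>j\<in>{..d} - {m}. f j * poly (node_poly s n) (s j))" for n
    proof -
      have "(\<Sum>j\<in>{..d} - {m}. g j * poly (node_poly s n) (s j))
        = (\<Sum>j\<in>{..d} - {m}. f j * poly (node_poly s n) (s j))"
        by (rule sum.cong) (auto simp: g_def)
      then show ?thesis using m by (subst sum.remove[of _ m]) auto
    qed
    have "(\<Sum>j\<le>d. g j * poly (node_poly s n) (s j)) = b n" if "m \<le> n" "n \<le> d" for n
    proof (cases "n = m")
      case True
      then show ?thesis
        using poly_node_poly_nonzero[OF inj, of m m] m unfolding split by (simp add: g_def S_def)
    next
      case False
      then have n: "m < n" using that by simp
      have "(\<Sum>j\<le>d. f j * poly (node_poly s n) (s j))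
        = f m * poly (node_poly s n) (s m) + (\<Sum>j\<in>{..d} - {m}. f j * poly (node_poly s n) (s j))"
        using m by (subst sum.remove[of _ m]) auto
      then show ?thesis
        using f[of n] n that unfolding split by (simp add: poly_node_poly_zero)
    qed
    then show ?case by blast
  qed
  from this[of 0] show ?thesis by simp
qed

lemma poly_basis_expand:
  fixes v :: "nat \<Rightarrow> 'a::field poly"
  assumes "\<And>n. n \<le> m \<Longrightarrow> degree (v n) \<le> n \<and> coeff (v n) n \<noteq> 0" "degree p \<le> m"
  shows "\<exists>c. p = (\<Sum>k\<le>m. smult (c k) (v k))"
  using assms
proof (induction m arbitrary: p)
  case 0
  then obtain a b where "p = [:a:]" "v 0 = [:b:]" by (metis degree_eq_zeroE le_zero_eq)
  then show ?case using 0 by (intro exI[of _ "\<lambda>_. a / b"]) auto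
next
  case (Suc m)
  define q where "q = smult (1 / coeff (v (Suc m)) (Suc m)) (v (Suc m))"
  have q: "degree q \<le> Suc m" "coeff q (Suc m) = 1" using Suc.prems by (auto simp: q_def)
  then have "degree (p - smult (coeff p (Suc m)) q) < Suc m"
    using Suc.prems by (intro degree_diff_smult_less) auto
  then have "degree (p - smult (coeff p (Suc m)) q) \<le> m" by simp
  from Suc.IH[OF _ this] Suc.prems obtain c
    where c: "p - smult (coeff p (Suc m)) q = (\<Sum>k\<le>m. smult (c k) (v k))" by (meson le_SucI)
  define e where "e = coeff p (Suc m) / coeff (v (Suc m)) (Suc m)"
  have "p = (\<Sum>k\<le>m. smult (c k) (v k)) + smult e (v (Suc m))"
    using c by (simp add: q_def e_def algebra_simps)
  also have "(\<Sum>k\<le>m. smult (c k) (v k)) = (\<Sum>k\<le>m. smult ((c(Suc m := e)) k) (v k))"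
    by (rule sum.cong) auto
  finally show ?case by (intro exI[of _ "c(Suc m := e)"]) simp
qed

section \<open>Matrices acting on polynomials\<close>

text \<open>Row i of \<open>a\<close> gives the image of a polynomial at node i, so \<open>a\<close>
  is specified by a bidiagonal action on the Newton basis. At n = 0 the truncated index n - 1 is
  harmless by \<open>\<phi>_0\<close>.\<close>

locale split_action =
  fixes d :: nat and a :: "nat \<Rightarrow> nat \<Rightarrow> 'a::field" and s \<theta> \<phi> :: "nat \<Rightarrow> 'a"
  assumes s_inj: "inj_on s {..d}"
    and \<phi>_0: "\<phi> 0 = 0"
    and act: "n \<le> d \<Longrightarrow> i \<le> d \<Longrightarrow> (\<Sum>j\<le>d. a i j * poly (node_poly s n) (s j))
      = \<theta> n * poly (node_poly s n) (s i) + \<phi> n * poly (node_poly s (n - 1)) (s i)"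
begin

lemma node_nonzero: "n \<le> i \<Longrightarrow> i \<le> d \<Longrightarrow> poly (node_poly s n) (s i) \<noteq> 0"
  by (rule poly_node_poly_nonzero[OF s_inj])

lemma s_neq: "i \<le> d \<Longrightarrow> j \<le> d \<Longrightarrow> i \<noteq> j \<Longrightarrow> s i \<noteq> s j"
  using s_inj by (auto simp: inj_on_def)

text \<open>For n >= i + 2 both Newton polynomials on the right of \<open>act\<close> vanish at node
  i, so row i annihilates all of these and \<open>node_functional_zero\<close> applies.\<close>

lemma upper_zero:
  assumes "i \<le> d" "j \<le> d" "i + 1 < j"
  shows "a i j = 0"
proof (rule node_functional_zero[OF s_inj, where m = "i + 2"])
  fix n assume n: "i + 2 \<le> n" "n \<le> d"
  show "(\<Sum>j\<le>d. a i j * poly (node_poly s n) (s j)) = 0"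
    using act[OF n(2) assms(1)] n by (simp add: poly_node_poly_zero)
qed (use assms in auto)

lemma sum_upper:
  assumes "i \<le> d" "n = Suc i" "n \<le> d"
  shows "(\<Sum>j\<le>d. a i j * poly (node_poly s n) (s j)) = a i n * poly (node_poly s n) (s n)"
proof -
  have "(\<Sum>j\<le>d. a i j * poly (node_poly s n) (s j)) = (\<Sum>j\<in>{n}. a i j * poly (node_poly s n) (s j))"
  proof (rule sum.mono_neutral_right)
    show "\<forall>j\<in>{..d} - {n}. a i j * poly (node_poly s n) (s j) = 0"
    proof
      fix j assume "j \<in> {..d} - {n}"
      then consider "j < n" | "j > n" "j \<le> d" by fastforce
      then show "a i j * poly (node_poly s n) (s j) = 0"
        using assms by cases (auto simp: poly_node_poly_zero upper_zero)
    qed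
  qed (use assms in auto)
  then show ?thesis by simp
qed

lemma super_entry:
  assumes "i < d"
  shows "a i (Suc i) * poly (node_poly s (Suc i)) (s (Suc i)) = \<phi> (Suc i) * poly (node_poly s i) (s i)"
  using sum_upper[of i "Suc i"] act[of "Suc i" i] assms
  by (simp add: poly_node_poly_zero)

text \<open>On the i-th Newton polynomial row i sees only the columns i and i + 1: earlier nodes are
  zeros of the polynomial, and later entries are zero. The contribution of column i + 1 is known
  from \<open>super_entry\<close>.\<close>

lemma diag_entry:
  assumes "i \<le> d"
  shows "a i i = \<theta> i + (if i = 0 then 0 else \<phi> i / (s i - s (i - 1)))
    + (if i = d then 0 else \<phi> (Suc i) / (s i - s (Suc i)))"
proof -
  let ?t = "poly (node_poly s i)"
  have "(\<Sum>j\<le>d. a i j * ?t (s j)) = (\<Sum>j\<in>{i..min d (Suc i)}. a i j * ?t (s j))"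
  proof (rule sum.mono_neutral_right)
    show "\<forall>j\<in>{..d} - {i..min d (Suc i)}. a i j * ?t (s j) = 0"
    proof
      fix j assume "j \<in> {..d} - {i..min d (Suc i)}"
      then consider "j < i" | "j > Suc i" "j \<le> d" by fastforce
      then show "a i j * ?t (s j) = 0"
        using assms by cases (auto simp: poly_node_poly_zero upper_zero)
    qed
  qed auto
  also have "\<dots> = a i i * ?t (s i) + (if i = d then 0 else a i (Suc i) * ?t (s (Suc i)))"
  proof (cases "i = d")
    case False
    then have "{i..min d (Suc i)} = {i, Suc i}" using assms by auto
    then show ?thesis using False by simp
  qed simp
  finally have sum: "a i i * ?t (s i) + (if i = d then 0 else a i (Suc i) * ?t (s (Suc i)))
    = \<theta> i * ?t (s i) + \<phi> i * poly (node_poly s (i - 1)) (s i)"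
    using act[OF assms assms] by simp
  have t: "?t (s i) \<noteq> 0" using assms by (intro node_nonzero) auto
  have 1: "(if i = d then 0 else a i (Suc i) * ?t (s (Suc i)))
    = - (if i = d then 0 else \<phi> (Suc i) / (s i - s (Suc i))) * ?t (s i)"
  proof (cases "i = d")
    case False
    then have "s i - s (Suc i) \<noteq> 0" using s_neq[of i "Suc i"] assms by simp
    moreover have "a i (Suc i) * (?t (s (Suc i)) * (s (Suc i) - s i)) = \<phi> (Suc i) * ?t (s i)"
      using super_entry[of i] assms False by (simp add: poly_node_poly_Suc)
    then have "a i (Suc i) * ?t (s (Suc i)) * (s i - s (Suc i)) = - \<phi> (Suc i) * ?t (s i)"
      by (simp add: algebra_simps)
    ultimately have "a i (Suc i) * ?t (s (Suc i)) = - \<phi> (Suc i) * ?t (s i) / (s i - s (Suc i))"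
      by (metis nonzero_eq_divide_eq)
    then show ?thesis using False by simp
  qed simp
  have 2: "\<phi> i * poly (node_poly s (i - 1)) (s i)
    = (if i = 0 then 0 else \<phi> i / (s i - s (i - 1))) * ?t (s i)"
  proof (cases i)
    case (Suc m)
    then have "s i - s m \<noteq> 0" using s_neq[of i m] assms by simp
    then have "\<phi> i / (s i - s m) * (poly (node_poly s m) (s i) * (s i - s m)) = \<phi> i * poly (node_poly s m) (s i)"
      by simp
    then show ?thesis using Suc by (simp only: poly_node_poly_Suc) simp
  qed (simp add: \<phi>_0)
  have cancel: "x = w + u + v" if "x * t + - v * t = w * t + u * t" "t \<noteq> 0" for x t u v w :: 'a
  proof -
    have "x * t = (w + u + v) * t" using that(1) by Groebner_Basis.algebra
    then show ?thesis using that(2) by simp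
  qed
  show ?thesis by (rule cancel[OF sum[unfolded 1 2] t])
qed

text \<open>The Newton basis has one polynomial in each degree, so the bidiagonal action is
  triangular for the flag of degrees, with \<theta> on its diagonal. Leading coefficients can then
  be followed for any polynomial.\<close>

lemma preserves_degree_flag:
  assumes "n \<le> d" "degree p \<le> n"
  shows "\<exists>q. degree q \<le> n \<and> coeff q n = \<theta> n * coeff p n
    \<and> (\<forall>i\<le>d. (\<Sum>j\<le>d. a i j * poly p (s j)) = poly q (s i))"
  using assms
proof (induction n arbitrary: p)
  case 0
  then obtain c where p: "p = [:c:]" by (metis degree_eq_zeroE le_zero_eq)
  have "(\<Sum>j\<le>d. a i j * c) = \<theta> 0 * c" if "i \<le> d" for i
    using act[of 0 i] that by (simp add: \<phi>_0 flip: sum_distrib_right)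
  then show ?case unfolding p by (intro exI[of _ "[:\<theta> 0 * c:]"]) auto
next
  case (Suc n)
  let ?t = "node_poly s (Suc n)"
  define c where "c = coeff p (Suc n)"
  define p' where "p' = p - smult c ?t"
  have "degree p' < Suc n" unfolding p'_def c_def
    using Suc.prems by (intro degree_diff_smult_less) (auto)
  then obtain q where q: "degree q \<le> n"
    "\<And>i. i \<le> d \<Longrightarrow> (\<Sum>j\<le>d. a i j * poly p' (s j)) = poly q (s i)"
    using Suc.IH[of p'] Suc.prems by auto
  define r where "r = q + smult (c * \<theta> (Suc n)) ?t + smult (c * \<phi> (Suc n)) (node_poly s n)"
  have "degree r \<le> Suc n" unfolding r_def using q(1)
    by (intro degree_add_le order.trans[OF degree_smult_le]) (auto)
  moreover have "coeff r (Suc n) = \<theta> (Suc n) * c" unfolding r_def using q(1)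
    by (simp add: coeff_eq_0)
  moreover have "(\<Sum>j\<le>d. a i j * poly p (s j)) = poly r (s i)" if "i \<le> d" for i
  proof -
    have p: "p = p' + smult c ?t" by (simp add: p'_def)
    have "(\<Sum>j\<le>d. a i j * poly p (s j))
      = (\<Sum>j\<le>d. a i j * poly p' (s j)) + c * (\<Sum>j\<le>d. a i j * poly ?t (s j))"
      unfolding p by (simp add: sum.distrib sum_distrib_left algebra_simps)
    then show ?thesis using q(2)[OF that] act[OF Suc.prems(1) that]
      by (simp add: r_def algebra_simps)
  qed
  ultimately show ?case unfolding c_def by blast
qed

end

section \<open>Tridiagonal matrices and the reversed nodes\<close>

locale tridiagonal_action = split_action +
  assumes lower_zero: "i \<le> d \<Longrightarrow> j + 1 < i \<Longrightarrow> a i j = 0"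
begin

text \<open>The second split sequence, listed backwards. The sum is the difference, just below the
  leading coefficient, between the reversed and the original Newton polynomial of degree n; the
  formula results from comparing coefficients of degree n - 1 in \<open>act_rev\<close>.\<close>

definition \<psi> :: "nat \<Rightarrow> 'a" where
  "\<psi> n = \<phi> n - (\<theta> n - \<theta> (n - 1)) * (\<Sum>k<n. s k - s (d - k))"

definition s_rev :: "nat \<Rightarrow> 'a" where "s_rev k = s (d - k)"

lemma s_rev_inj: "inj_on s_rev {..d}"
  using s_inj unfolding inj_on_def s_rev_def by (metis atMost_iff diff_diff_cancel diff_le_self)

text \<open>The image of the reversed Newton polynomial of degree n, minus \<theta> n times the
  polynomial, has degree below n. The rows of the last n - 1 nodes meet only columns among the last
  n nodes, all zeros of the polynomial, so the difference vanishes at those nodes. Only a multiple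
  of the reversed polynomial of degree n - 1 is left.\<close>

lemma act_rev:
  assumes "n \<le> d" "i \<le> d"
  shows "(\<Sum>j\<le>d. a i j * poly (node_poly s_rev n) (s j))
    = \<theta> n * poly (node_poly s_rev n) (s i) + \<psi> n * poly (node_poly s_rev (n - 1)) (s i)"
proof (cases n)
  case 0
  then show ?thesis using act[of 0 i] assms by (simp add: \<psi>_def \<phi>_0)
next
  case (Suc m)
  let ?h = "node_poly s_rev n" and ?t = "node_poly s n"
  define X where "X = (\<Sum>k<n. s k - s (d - k))"
  define p where "p = ?h - ?t - smult X (node_poly s m)"
  have c: "coeff ?h m = coeff ?t m + X"
    unfolding Suc coeff_node_poly_Suc X_def by (simp add: s_rev_def sum_subtractf)
  have "degree p \<le> m \<and> coeff p m = 0"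
  proof -
    have "degree p \<le> n" unfolding p_def
      by (intro degree_diff_le order.trans[OF degree_smult_le]) (auto simp: Suc)
    moreover have "coeff p n = 0" by (simp add: p_def Suc coeff_eq_0)
    ultimately have "degree p \<le> m"
      using Suc by (metis degree_0 le0 le_antisym le_degree leading_coeff_0_iff not_less_eq_eq)
    moreover have "coeff p m = 0" using c by (simp add: p_def)
    ultimately show ?thesis by simp
  qed
  \<comment> \<open>The remainder p has no coefficient in degree m, and neither has its image, so
    the coefficient wanted below comes only from the two explicit Newton polynomials.\<close>
  then obtain q where q: "degree q \<le> m" "coeff q m = 0"
    "\<And>i. i \<le> d \<Longrightarrow> (\<Sum>j\<le>d. a i j * poly p (s j)) = poly q (s i)"
    using preserves_degree_flag[of m p] assms Suc by auto
  define r where "r = smult (\<theta> n) ?t + smult (\<phi> n) (node_poly s m)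
    + smult X (smult (\<theta> m) (node_poly s m) + smult (\<phi> m) (node_poly s (m - 1))) + q"
  have r: "(\<Sum>j\<le>d. a i j * poly ?h (s j)) = poly r (s i)" if "i \<le> d" for i
  proof -
    have "?h = ?t + smult X (node_poly s m) + p" by (simp add: p_def)
    then have "(\<Sum>j\<le>d. a i j * poly ?h (s j)) = (\<Sum>j\<le>d. a i j * poly ?t (s j))
      + X * (\<Sum>j\<le>d. a i j * poly (node_poly s m) (s j)) + (\<Sum>j\<le>d. a i j * poly p (s j))"
      by (simp add: sum.distrib sum_distrib_left algebra_simps)
    then show ?thesis
      using act[OF assms(1) that] act[of m i] q(3)[OF that] that assms Suc
      by (simp add: r_def algebra_simps)
  qed
  define g where "g = r - smult (\<theta> n) ?h"
  have deg1: "degree (smult (\<phi> m) (node_poly s (m - 1))) \<le> m"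
    by (intro order.trans[OF degree_smult_le]) simp
  have deg2: "coeff (smult (\<phi> m) (node_poly s (m - 1))) m = 0"
    by (cases m) (simp_all add: \<phi>_0 coeff_eq_0)
  have "degree g \<le> n" unfolding g_def r_def using q(1) Suc
    by (intro degree_diff_le degree_add_le order.trans[OF degree_smult_le]) (auto)
  moreover have "coeff g n = 0"
    using q(1) Suc by (simp add: g_def r_def coeff_eq_0)
  ultimately have g: "degree g \<le> m"
    using Suc by (metis degree_0 le0 le_antisym le_degree leading_coeff_0_iff not_less_eq_eq)
  have "coeff g m = \<phi> n + X * \<theta> m - \<theta> n * X"
    using deg2 q(2) unfolding g_def r_def by (simp add: c algebra_simps)
  then have gm: "coeff g m = \<psi> n" unfolding \<psi>_def X_def Suc by (simp add: algebra_simps)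
  have "g = smult (coeff g m) (node_poly s_rev m)"
  proof (rule poly_eq_smult_node_poly[OF _ _ g])
    show "inj_on s_rev {..<m}" by (rule inj_on_subset[OF s_rev_inj]) (use Suc assms in auto)
    fix k assume k: "k < m"
    define i where "i = d - k"
    have i: "1 \<le> i" "i \<le> d" "d - n < i - 1" "s_rev k = s i" using k Suc assms by (auto simp: i_def s_rev_def)
    have h0: "poly ?h (s j) = 0" if "i - 1 \<le> j" "j \<le> d" for j
      using poly_node_poly_zero[of "d - j" n s_rev] that i assms by (simp add: s_rev_def)
    have "(\<Sum>j\<le>d. a i j * poly ?h (s j)) = 0"
    proof (rule sum.neutral, rule ballI)
      fix j assume "j \<in> {..d}"
      then consider "j + 1 < i" | "i - 1 \<le> j" "j \<le> d" by fastforce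
      then show "a i j * poly ?h (s j) = 0"
        using i by cases (auto simp: lower_zero h0)
    qed
    then show "poly g (s_rev k) = 0"
      using r[OF i(2)] h0[of i] i by (simp add: g_def)
  qed
  from arg_cong[OF this, of "\<lambda>p. poly p (s i)"]
  have "poly r (s i) = \<theta> n * poly ?h (s i) + \<psi> n * poly (node_poly s_rev m) (s i)"
    unfolding gm unfolding g_def poly_diff poly_smult by (metis add.commute diff_eq_eq)
  then show ?thesis using r[OF assms(2)] Suc by simp
qed

text \<open>Reversing the order of rows and columns keeps the hypotheses, so statements on the
  superdiagonal also yield statements on the subdiagonal.\<close>

lemma rev_action: "tridiagonal_action d (\<lambda>i j. a (d - i) (d - j)) s_rev \<theta> \<psi>"
proof
  show "inj_on s_rev {..d}" by (rule s_rev_inj)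
  show "\<psi> 0 = 0" by (simp add: \<psi>_def \<phi>_0)
next
  fix n i assume "n \<le> d" "i \<le> d"
  have "(\<Sum>j\<le>d. a (d - i) (d - j) * poly (node_poly s_rev n) (s_rev j))
    = (\<Sum>j\<le>d. a (d - i) j * poly (node_poly s_rev n) (s j))"
    by (rule sum.reindex_bij_witness[of _ "\<lambda>j. d - j" "\<lambda>j. d - j"]) (auto simp: s_rev_def)
  then show "(\<Sum>j\<le>d. a (d - i) (d - j) * poly (node_poly s_rev n) (s_rev j))
    = \<theta> n * poly (node_poly s_rev n) (s_rev i) + \<psi> n * poly (node_poly s_rev (n - 1)) (s_rev i)"
    using act_rev[OF \<open>n \<le> d\<close>, of "d - i"] by (simp add: s_rev_def)
next
  fix i j :: nat assume "i \<le> d" "j + 1 < i"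
  then show "a (d - i) (d - j) = 0" by (intro upper_zero) auto
qed

lemma sub_entry:
  assumes "1 \<le> i" "i \<le> d"
  shows "a i (i - 1) * poly (node_poly s_rev (Suc d - i)) (s (i - 1))
    = \<psi> (Suc d - i) * poly (node_poly s_rev (d - i)) (s i)"
proof -
  interpret rev: tridiagonal_action d "\<lambda>i j. a (d - i) (d - j)" s_rev \<theta> \<psi> by (rule rev_action)
  have "Suc (d - i) = Suc d - i" "d - (Suc d - i) = i - 1" "d - (d - i) = i" using assms by auto
  then show ?thesis using rev.super_entry[of "d - i"] assms by (simp add: s_rev_def)
qed

end

section \<open>Tridiagonality and the recurrence relations\<close>

fun recurrent_seq :: "'a::field \<Rightarrow> 'a \<Rightarrow> 'a \<Rightarrow> 'a \<Rightarrow> nat \<Rightarrow> 'a" where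
  "recurrent_seq \<beta> \<gamma> a b 0 = a"
| "recurrent_seq \<beta> \<gamma> a b (Suc 0) = b"
| "recurrent_seq \<beta> \<gamma> a b (Suc (Suc n)) = \<beta> * recurrent_seq \<beta> \<gamma> a b (Suc n) + \<gamma> - recurrent_seq \<beta> \<gamma> a b n"

lemma recurrent_extension:
  fixes s :: "nat \<Rightarrow> 'a::field"
  assumes "\<And>i. i + 2 \<le> d \<Longrightarrow> s i + s (i + 2) = \<beta> * s (i + 1) + \<gamma>"
  shows "\<exists>S. recurrent \<beta> \<gamma> S \<and> (\<forall>i\<le>d. S (int i) = s i)"
proof -
  \<comment> \<open>The recurrence reads the same in both directions. Negative indices therefore run
    the recursion backwards from \<open>s 1\<close>, \<open>s 0\<close>; the offset in 1 - i places
    \<open>s 0\<close> at position 1.\<close>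
  define S where "S i = (if i \<ge> 0 then recurrent_seq \<beta> \<gamma> (s 0) (s 1) (nat i)
    else recurrent_seq \<beta> \<gamma> (s 1) (s 0) (nat (1 - i)))" for i
  have "recurrent \<beta> \<gamma> S"
  proof
    fix i :: int
    consider n where "i = int (Suc n)" | "i = 0" | n where "i = - int (Suc n)"
    proof (cases i)
      case (nonneg n)
      then show ?thesis using that(1,2) by (cases n) auto
    next
      case (neg n)
      then show ?thesis using that(3) by blast
    qed
    then show "S (i - 1) + S (i + 1) = \<beta> * S i + \<gamma>"
    proof cases
      case 1
      then have "nat (i - 1) = n" "nat i = Suc n" "nat (i + 1) = Suc (Suc n)" by simp_all
      then show ?thesis using 1 by (simp add: S_def)
    next
      case 2
      show ?thesis unfolding 2 by (simp add: S_def numeral_2_eq_2)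
    next
      case 3
      have e: "S (- int (Suc m)) = recurrent_seq \<beta> \<gamma> (s 1) (s 0) (Suc (Suc m))" for m
      proof -
        have "nat (1 - (- int (Suc m))) = Suc (Suc m)" by simp
        moreover have "\<not> (0::int) \<le> - int (Suc m)" by simp
        ultimately show ?thesis unfolding S_def by (simp only: if_False)
      qed
      have "S (i + 1) = recurrent_seq \<beta> \<gamma> (s 1) (s 0) (Suc n)"
      proof (cases n)
        case 0
        then have "i + 1 = 0" using 3 by simp
        then show ?thesis using 0 by (simp add: S_def)
      next
        case (Suc m)
        then have "i + 1 = - int (Suc m)" using 3 by simp
        then show ?thesis using e[of m] Suc by (simp only:)
      qed
      moreover have "i - 1 = - int (Suc (Suc n))" using 3 by simp
      then have "S (i - 1) = recurrent_seq \<beta> \<gamma> (s 1) (s 0) (Suc (Suc (Suc n)))"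
        using e[of "Suc n"] by (simp only:)
      moreover have "S i = recurrent_seq \<beta> \<gamma> (s 1) (s 0) (Suc (Suc n))"
        using e[of n] 3 by (simp only:)
      ultimately show ?thesis by (simp only: recurrent_seq.simps) simp
    qed
  qed
  moreover have "S (int i) = s i" if "i \<le> d" for i
  proof -
    have "recurrent_seq \<beta> \<gamma> (s 0) (s 1) i = s i" using that
    proof (induction i rule: induct_nat_012)
      case (ge2 n)
      then show ?case using assms[of n] by (simp add: algebra_simps eq_diff_eq)
    qed simp_all
    then show ?thesis by (simp add: S_def)
  qed
  ultimately show ?thesis by blast
qed

text \<open>The four-term relation says that \<open>s i + s (i + 2) - \<beta> * s (i + 1)\<close>
  does not change with i; \<gamma> is its value at i = 0.\<close>

lemma recurrent_of_four_term:
  fixes s :: "nat \<Rightarrow> 'a::field"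
  assumes "\<And>i. i + 3 \<le> d \<Longrightarrow> s i - s (i + 3) = (\<beta> + 1) * (s (i + 1) - s (i + 2))"
  shows "\<exists>\<gamma> S. recurrent \<beta> \<gamma> S \<and> (\<forall>i\<le>d. S (int i) = s i)"
proof -
  define \<gamma> where "\<gamma> = s 0 + s 2 - \<beta> * s 1"
  have "s i + s (i + 2) = \<beta> * s (i + 1) + \<gamma>" if "i + 2 \<le> d" for i
    using that
  proof (induction i)
    case 0
    then show ?case by (simp add: \<gamma>_def numeral_2_eq_2)
  next
    case (Suc i)
    have "s i - s (i + 3) = (\<beta> + 1) * (s (i + 1) - s (i + 2))" using assms[of i] Suc by simp
    moreover have "s i + s (i + 2) = \<beta> * s (i + 1) + \<gamma>" using Suc by simp
    ultimately have "s (i + 1) + s (i + 3) = \<beta> * s (i + 2) + \<gamma>" by Groebner_Basis.algebra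
    then show ?case by (simp add: numeral_3_eq_3 numeral_2_eq_2)
  qed
  then show ?thesis using recurrent_extension[of d s \<beta> \<gamma>] by blast
qed

context split_action begin

lemma split_action_cong:
  assumes "\<And>i. i \<le> d \<Longrightarrow> s' i = s i" "\<And>i. i \<le> d \<Longrightarrow> \<theta>' i = \<theta> i" "\<And>i. i \<le> d \<Longrightarrow> \<phi>' i = \<phi> i"
  shows "split_action d a s' \<theta>' \<phi>'"
proof
  show "inj_on s' {..d}" using s_inj assms(1) by (auto simp: inj_on_def)
  show "\<phi>' 0 = 0" using assms(3)[of 0] \<phi>_0 by simp
  have t: "node_poly s' n = node_poly s n" if "n \<le> d" for n
    unfolding node_poly_def by (rule prod.cong) (use that assms(1) in auto)
  show "(\<Sum>j\<le>d. a i j * poly (node_poly s' n) (s' j))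
      = \<theta>' n * poly (node_poly s' n) (s' i) + \<phi>' n * poly (node_poly s' (n - 1)) (s' i)"
    if "n \<le> d" "i \<le> d" for n i
    using act[OF that] that by (simp add: t assms)
qed

text \<open>The quadratic vanishing at the last two nodes is expanded in the Newton basis, to which
  \<open>act\<close> applies. Its zeros remove the columns d - 1 and d of row d, which isolates the
  corner entry once the other entries are known to vanish.\<close>

lemma corner_row_sum:
  assumes "d \<ge> 2"
  shows "(\<Sum>j\<le>d. a d j * ((s j - s d) * (s j - s (d - 1))))
    = \<theta> 2 * ((s d - s 0) * (s d - s 1)) + \<phi> 2 * (s d - s 0)
      + (s 0 - s d + s 1 - s (d - 1)) * (\<theta> 1 * (s d - s 0) + \<phi> 1)
      + (s 0 - s d) * (s 0 - s (d - 1)) * \<theta> 0"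
proof -
  have t: "poly (node_poly s 2) x = (x - s 0) * (x - s 1)" "poly (node_poly s 1) x = x - s 0" for x
    by (simp_all add: poly_node_poly numeral_2_eq_2)
  have "(\<Sum>j\<le>d. a d j * ((s j - s d) * (s j - s (d - 1))))
    = (\<Sum>j\<le>d. a d j * poly (node_poly s 2) (s j))
      + (s 0 - s d + s 1 - s (d - 1)) * (\<Sum>j\<le>d. a d j * poly (node_poly s 1) (s j))
      + (s 0 - s d) * (s 0 - s (d - 1)) * (\<Sum>j\<le>d. a d j * poly (node_poly s 0) (s j))"
    unfolding sum_distrib_left sum.distrib[symmetric] t
    by (rule sum.cong[OF refl], simp) Groebner_Basis.algebra
  also have "(\<Sum>j\<le>d. a d j * poly (node_poly s 2) (s j))
    = \<theta> 2 * poly (node_poly s 2) (s d) + \<phi> 2 * poly (node_poly s 1) (s d)"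
    using act[of 2 d] assms by simp
  also have "(\<Sum>j\<le>d. a d j * poly (node_poly s 1) (s j)) = \<theta> 1 * poly (node_poly s 1) (s d) + \<phi> 1"
    using act[of 1 d] assms by simp
  also have "(\<Sum>j\<le>d. a d j * poly (node_poly s 0) (s j)) = \<theta> 0"
    using act[of 0 d] by (simp add: \<phi>_0)
  finally show ?thesis unfolding t .
qed

end

section \<open>The Askey-Wilson relation for a matrix acting on Newton polynomials\<close>

locale extended_split_action = pair: recurrent_pair \<beta> \<gamma> \<delta> S T d
    + split_action d a "\<lambda>k. S (int k)" "\<lambda>k. T (int k)" \<phi>
  for \<beta> \<gamma> \<delta> :: "'a::field" and S T :: "int \<Rightarrow> 'a" and d a \<phi>
begin

abbreviation "s \<equiv> \<lambda>k. S (int k)"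

lemma S_neq: "0 \<le> i \<Longrightarrow> i \<le> int d \<Longrightarrow> 0 \<le> j \<Longrightarrow> j \<le> int d \<Longrightarrow> i \<noteq> j \<Longrightarrow> S i \<noteq> S j"
  using s_neq[of "nat i" "nat j"] by (auto simp: nat_le_iff)

text \<open>In x the conic is a monic quadratic; this is its Newton expansion at the nodes n and n +
  1, multiplied by the n-th Newton polynomial.\<close>

lemma conic_node:
  "pair.s.conic y x * poly (node_poly s n) x
   = poly (node_poly s (Suc (Suc n))) x
     + (S (int n) + S (int n + 1) - \<beta> * y - \<gamma>) * poly (node_poly s (Suc n)) x
     + pair.s.conic y (S (int n)) * poly (node_poly s n) x"
proof -
  have i: "int (Suc n) = int n + 1" by simp
  show ?thesis unfolding poly_node_poly_Suc pair.s.conic_def i by Groebner_Basis.algebra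
qed

text \<open>Row i of the Askey-Wilson relation, applied to the m-th Newton polynomial. Only the
  terms of \<phi> up to m + 2 enter, so the case m = 0 is available while the later terms are still
  being determined.\<close>

lemma conic_act:
  assumes \<phi>: "\<And>n. n \<le> d \<Longrightarrow> n \<le> m + 2 \<Longrightarrow> \<phi> n = pair.\<phi> r n" and m: "m \<le> d" and i: "i \<le> d"
  shows "(\<Sum>j\<le>d. a i j * (pair.s.conic (s i) (s j) * poly (node_poly s m) (s j)))
    = pair.quad r 0 (s i) * poly (node_poly s m) (s i)"
proof -
  define y where "y = s i"
  define t where "t n = poly (node_poly s n)" for n
  have act': "(\<Sum>j\<le>d. a i j * t n (s j)) = T (int n) * t n y + pair.\<phi> r n * t (n - 1) y"
    if n: "n \<le> m + 2" for n
  \<comment> \<open>Beyond d the Newton polynomials vanish at all nodes. The formula survives at n =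
    d + 1 because \<open>pair.\<phi> r (Suc d)\<close> is zero, and at n = d + 2 because the
    polynomial of degree d + 1 vanishes as well.\<close>
  proof (cases "n \<le> d")
    case True
    then show ?thesis using act[OF True i] \<phi>[OF True n] by (simp add: t_def y_def)
  next
    case False
    then have 0: "t n (s j) = 0" if "j \<le> d" for j
      using that unfolding t_def by (intro poly_node_poly_zero) simp
    have "pair.\<phi> r n * t (n - 1) y = 0"
    proof (cases "n = Suc d")
      case True
      then show ?thesis by (simp only: pair.\<phi>_Suc_d) simp
    next
      case F: False
      have "t (n - 1) y = 0" unfolding t_def y_def
        by (rule poly_node_poly_zero[of i "n - 1" s]) (use False F i in simp)
      then show ?thesis by simp
    qed
    moreover have "(\<Sum>j\<le>d. a i j * t n (s j)) = 0" by (rule sum.neutral) (simp add: 0)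
    ultimately show ?thesis using 0[OF i] by (simp add: y_def)
  qed
  let ?u = "S (int m) + S (int m + 1) - \<beta> * y - \<gamma>" and ?w = "pair.s.conic y (S (int m))"
  have "(\<Sum>j\<le>d. a i j * (pair.s.conic y (s j) * t m (s j)))
    = (\<Sum>j\<le>d. a i j * t (Suc (Suc m)) (s j)) + ?u * (\<Sum>j\<le>d. a i j * t (Suc m) (s j))
      + ?w * (\<Sum>j\<le>d. a i j * t m (s j))"
    unfolding sum_distrib_left sum.distrib[symmetric] t_def conic_node
    by (rule sum.cong[OF refl]) Groebner_Basis.algebra
  also have "\<dots> = T (int m + 2) * t (Suc (Suc m)) y + pair.\<phi> r (Suc (Suc m)) * t (Suc m) y
      + ?u * (T (int m + 1) * t (Suc m) y + pair.\<phi> r (Suc m) * t m y)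
      + ?w * (T (int m) * t m y + pair.\<phi> r m * t (m - 1) y)"
    using act'[of "Suc (Suc m)"] act'[of "Suc m"] act'[of m] by (simp add: add.commute)
  also have "\<dots> = pair.quad r m y * t m y"
  proof -
    have t: "t (Suc m) y = t m y * (y - S (int m))"
      "t (Suc (Suc m)) y = t m y * (y - S (int m)) * (y - S (int m + 1))"
      by (simp_all add: t_def poly_node_poly_Suc add.commute)
    \<comment> \<open>The conic at node m contains exactly the linear factor that is missing from
      the polynomial of degree m - 1; for m = 0 the coefficient is zero.\<close>
    have "pair.\<phi> r m * (?w * t (m - 1) y) = pair.\<phi> r m * ((y - S (int m + 1)) * t m y)"
    proof (cases m)
      case (Suc k)
      then have "t m y = t (m - 1) y * (y - S (int m - 1))" by (simp add: t_def poly_node_poly_Suc)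
      moreover have "?w = (y - S (int m - 1)) * (y - S (int m + 1))"
        by (metis pair.s.conic_commute pair.s.conic_eq)
      ultimately show ?thesis by simp
    qed simp
    then show ?thesis unfolding t pair.quad_def by Groebner_Basis.algebra
  qed
  finally show ?thesis unfolding pair.quad_const[of r m] y_def t_def .
qed

text \<open>The conic is factored around an index whose two neighbours lie in 0..d: around i if i <
  d, and otherwise around j, which is then positive.\<close>

lemma conic_nonzero:
  assumes "i \<le> d" "j + 1 < i" "\<not> (i = d \<and> j = 0)"
  shows "pair.s.conic (s i) (s j) \<noteq> 0"
proof (cases "i = d")
  case True
  have "pair.s.conic (s i) (s j) = (S (int i) - S (int j - 1)) * (S (int i) - S (int j + 1))"
    by (metis pair.s.conic_commute pair.s.conic_eq)
  moreover have "S (int i) \<noteq> S (int j - 1)" "S (int i) \<noteq> S (int j + 1)"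
    using assms True by (intro S_neq; simp)+
  ultimately show ?thesis by simp
next
  case False
  have "pair.s.conic (s i) (s j) = (S (int j) - S (int i - 1)) * (S (int j) - S (int i + 1))"
    by (rule pair.s.conic_eq)
  moreover have "S (int j) \<noteq> S (int i - 1)" "S (int j) \<noteq> S (int i + 1)"
    using assms False by (intro S_neq; simp)+
  ultimately show ?thesis by simp
qed

text \<open>By \<open>conic_act\<close>, row i weighted with the conic, minus a multiple of the i-th
  unit row, annihilates the Newton basis and hence is zero. Entries with nonzero weight vanish; then
  the quadratic test on row d leaves only the corner, where \<open>corner_\<phi>\<close> gives
  zero.\<close>

lemma lower_zero_of_parameters:
  assumes \<phi>: "\<And>n. n \<le> d \<Longrightarrow> \<phi> n = pair.\<phi> r n" and ij: "i \<le> d" "j + 1 < i"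
  shows "a i j = 0"
proof -
  have noncorner: "a i j = 0" if i: "i \<le> d" and j: "j + 1 < i" and nc: "\<not> (i = d \<and> j = 0)" for i j
  proof -
    define f where "f k = a i k * pair.s.conic (s i) (s k)
      - (if k = i then pair.quad r 0 (s i) else 0)" for k
    have "f j = 0"
    proof (rule node_functional_zero[OF s_inj, where m = 0])
      fix n assume n: "n \<le> d"
      have "(\<Sum>k\<le>d. f k * poly (node_poly s n) (s k))
        = (\<Sum>k\<le>d. a i k * (pair.s.conic (s i) (s k) * poly (node_poly s n) (s k)))
          - (\<Sum>k\<le>d. if k = i then pair.quad r 0 (s i) * poly (node_poly s n) (s k) else 0)"
        unfolding sum_subtractf[symmetric] by (rule sum.cong) (auto simp: f_def algebra_simps)
      then show "(\<Sum>k\<le>d. f k * poly (node_poly s n) (s k)) = 0"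
        using conic_act[of n r i] \<phi> n i by simp
    qed (use i j in auto)
    then show ?thesis using conic_nonzero[OF i j nc] j by (simp add: f_def)
  qed
  show ?thesis
  proof (cases "i = d \<and> j = 0")
    case False
    then show ?thesis using noncorner ij by blast
  next
    case True
    then have d: "d \<ge> 2" and ij': "i = d" "j = 0" using ij by auto
    have d1: "int (d - 1) = int d - 1" "int (d - Suc 0) = int d - 1" using d by simp_all
    have "(\<Sum>k\<le>d. a d k * ((s k - s d) * (s k - s (d - 1))))
      = (\<Sum>k\<in>{0}. a d k * ((s k - s d) * (s k - s (d - 1))))"
    proof (rule sum.mono_neutral_right)
      show "\<forall>k\<in>{..d} - {0}. a d k * ((s k - s d) * (s k - s (d - 1))) = 0"
      proof
        fix k assume k: "k \<in> {..d} - {0}"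
        consider "k = d" | "k = d - 1" | "k + 1 < d" using k by fastforce
        then show "a d k * ((s k - s d) * (s k - s (d - 1))) = 0"
          using noncorner[of d k] k by cases auto
      qed
    qed auto
    then have "a d 0 * ((s 0 - s d) * (s 0 - s (d - 1)))
      = T 2 * ((S d - S 0) * (S d - S 1)) + pair.\<phi> r 2 * (S d - S 0)
      + (S 0 - S d + S 1 - S (int d - 1)) * (T 1 * (S d - S 0) + pair.\<phi> r 1)
      + (S 0 - S d) * (S 0 - S (int d - 1)) * T 0"
      using corner_row_sum[OF d] \<phi>[of 2] \<phi>[of 1] d by (simp add: d1)
    also have "\<dots> = 0"
    proof -
      have g: "pair.gap_s 0 = S 0 - S d" by (simp add: pair.gap_s_def)
      have s2: "pair.sum_s 2 = S 0 - S d + S 1 - S (int d - 1)"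
        by (simp add: numeral_2_eq_2 pair.gap_s_def)
      have "d \<ge> 1" using d by simp
      from pair.corner_\<phi>[OF this, of r] show ?thesis unfolding g s2 by Groebner_Basis.algebra
    qed
    finally have "a d 0 * ((s 0 - s d) * (s 0 - s (d - 1))) = 0" .
    moreover have "s 0 \<noteq> s d" "s 0 \<noteq> s (d - 1)" using s_neq[of 0 d] s_neq[of 0 "d - 1"] d by auto
    ultimately show ?thesis using ij' by simp
  qed
qed

text \<open>The relation \<open>conic_act\<close> for \<open>m = 0\<close>, read on the diagonal, is a recursion that determines
  \<open>\<phi>\<close> from its first two terms; the corner entry below the subdiagonal links these two.\<close>

lemma parameters_of_lower_zero:
  assumes lower: "\<And>i j. i \<le> d \<Longrightarrow> j + 1 < i \<Longrightarrow> a i j = 0" and d: "d \<ge> 1" and T: "T 0 \<noteq> T (int d)"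
  shows "\<exists>r. \<forall>n\<le>d. \<phi> n = pair.\<phi> r n"
proof -
  define r where "r = \<phi> 1 / (T 0 - T (int d)) - (S 1 - S 0)"
  have p1: "\<phi> 1 = pair.\<phi> r 1"
    using T by (simp add: pair.\<phi>_def r_def pair.gap_t_def field_simps)
  have p2: "\<phi> 2 = pair.\<phi> r 2" if d2: "d \<ge> 2"
  proof -
    have d1: "int (d - 1) = int d - 1" "int (d - Suc 0) = int d - 1" using d by simp_all
    have "(\<Sum>k\<le>d. a d k * ((s k - s d) * (s k - s (d - 1)))) = 0"
    proof (rule sum.neutral, rule ballI)
      fix k assume k: "k \<in> {..d}"
      consider "k = d" | "k = d - 1" | "k + 1 < d" using k by fastforce
      then show "a d k * ((s k - s d) * (s k - s (d - 1))) = 0"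
        using lower[of d k] by cases auto
    qed
    then have e: "T 2 * ((S d - S 0) * (S d - S 1)) + \<phi> 2 * (S d - S 0)
      + (S 0 - S d + S 1 - S (int d - 1)) * (T 1 * (S d - S 0) + pair.\<phi> r 1)
      + (S 0 - S d) * (S 0 - S (int d - 1)) * T 0 = 0"
      using corner_row_sum[OF d2] p1 by (simp add: d1)
    have g: "pair.gap_s 0 = S 0 - S d" by (simp add: pair.gap_s_def)
    have s2: "pair.sum_s 2 = S 0 - S d + S 1 - S (int d - 1)"
      by (simp add: numeral_2_eq_2 pair.gap_s_def)
    have "(S d - S 0) * (\<phi> 2 - pair.\<phi> r 2) = 0"
      using pair.corner_\<phi>[OF d, of r] e unfolding g s2 by Groebner_Basis.algebra
    moreover have "S d \<noteq> S 0" using s_neq[of d 0] d by simp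
    ultimately show ?thesis by simp
  qed
  have step: "\<phi> (Suc i) = pair.\<phi> r (Suc i)" if i: "1 \<le> i" "i < d" and \<phi>i: "\<phi> i = pair.\<phi> r i" for i
  proof -
    have i': "int (i - 1) = int i - 1" "int (Suc i) = int i + 1" using i by simp_all
    let ?c = "pair.s.conic (s i)"
    have c0: "?c (s (i - 1)) = 0" "?c (s (Suc i)) = 0"
      unfolding pair.s.conic_eq i' by simp_all
    have c1: "?c (s i) = (S i - S (int i - 1)) * (S i - S (int i + 1))"
      by (rule pair.s.conic_eq)
    \<comment> \<open>The two neighbours of node i are zeros of the conic, and tridiagonality
      removes the remaining columns off the diagonal.\<close>
    have "(\<Sum>j\<le>d. a i j * ?c (s j)) = (\<Sum>j\<in>{i}. a i j * ?c (s j))"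
    proof (rule sum.mono_neutral_right)
      show "\<forall>j\<in>{..d} - {i}. a i j * ?c (s j) = 0"
      proof
        fix j assume j: "j \<in> {..d} - {i}"
        consider "j + 1 < i" | "j = i - 1" | "j = Suc i" | "i + 1 < j" using j by fastforce
        then show "a i j * ?c (s j) = 0"
          using lower[of i j] upper_zero[of i j] c0 i j by cases auto
      qed
    qed (use i in auto)
    moreover have "(\<Sum>j\<le>d. a i j * (?c (s j) * poly (node_poly s 0) (s j)))
      = pair.quad r 0 (s i) * poly (node_poly s 0) (s i)"
    proof (rule conic_act)
      fix n assume "n \<le> d" "n \<le> 0 + 2"
      then consider "n = 0" | "n = 1" | "n = 2" "d \<ge> 2" by linarith
      then show "\<phi> n = pair.\<phi> r n" using p1 p2 \<phi>_0 by cases simp_all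
    qed (use i in auto)
    ultimately have "a i i * ?c (s i) = pair.quad r i (s i)"
      by (simp add: pair.quad_const[of r i])
    \<comment> \<open>Since \<open>quad\<close> is independent of its base, the base may be taken at
      i. There most terms drop out at the node itself, and the term with index i + 1 keeps a nonzero
      coefficient.\<close>
    moreover have "pair.quad r i (s i) = ?c (s i) * T i + pair.\<phi> r (Suc i) * (S i - S (int i - 1))
      + pair.\<phi> r i * (S i - S (int i + 1))"
      using pair.s.down[of i] unfolding pair.quad_def by Groebner_Basis.algebra
    moreover have "a i i * ?c (s i) = ?c (s i) * T i + \<phi> (Suc i) * (S i - S (int i - 1))
      + \<phi> i * (S i - S (int i + 1))"
    proof -
      have "S i - S (int i - 1) \<noteq> 0" "S i - S (int i + 1) \<noteq> 0"
        using S_neq[of "int i" "int i - 1"] S_neq[of "int i" "int i + 1"] i by auto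
      moreover have "a i i = T i + \<phi> i / (S i - S (int i - 1)) + \<phi> (Suc i) / (S i - S (int i + 1))"
        using diag_entry[of i] i by (simp add: i' add.commute)
      moreover have "(x + p / u + q / v) * (u * v) = u * v * x + q * u + p * v"
        if "u \<noteq> 0" "v \<noteq> 0" for x p q u v :: 'a
        using that by (simp add: field_simps)
      ultimately show ?thesis unfolding c1 by simp
    qed
    ultimately have "\<phi> (Suc i) * (S i - S (int i - 1)) = pair.\<phi> r (Suc i) * (S i - S (int i - 1))"
      using \<phi>i by simp
    moreover have "S i \<noteq> S (int i - 1)" using S_neq[of "int i" "int i - 1"] i by auto
    ultimately show ?thesis by simp
  qed
  have "\<phi> n = pair.\<phi> r n" if "n \<le> d" for n
    using that
  proof (induction n)
    case (Suc n)
    then show ?case using p1 step[of n] by (cases n) simp_all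
  qed (simp add: \<phi>_0)
  then show ?thesis by blast
qed

end

section \<open>The common recurrence forced by tridiagonality\<close>

context tridiagonal_action begin

text \<open>A function \<open>z\<close> with \<open>z\<^sub>i - z\<^sub>i\<^sub>+\<^sub>1 = s\<^sub>i s\<^sub>i\<^sub>+\<^sub>1 (s\<^sub>i - s\<^sub>i\<^sub>+\<^sub>1)\<close> on the nodes turns the operator
  \<open>X\<^sup>2 A X - X A X\<^sup>2\<close> into the commutator of \<open>z\<close> and \<open>A\<close>. As \<open>A\<close> preserves degrees, \<open>z\<close> must be a cubic
  polynomial, and comparing leading coefficients gives the recurrence of \<open>\<theta>\<close>.\<close>

lemma four_term_recurrence:
  assumes \<theta>: "inj_on \<theta> {..d}"
  shows "\<exists>\<beta>. \<forall>i. i + 3 \<le> d \<longrightarrow> s i - s (i + 3) = (\<beta> + 1) * (s (i + 1) - s (i + 2))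
    \<and> \<theta> i - \<theta> (i + 3) = (\<beta> + 1) * (\<theta> (i + 1) - \<theta> (i + 2))"
proof (cases "d \<ge> 3")
  case d: True
  \<comment> \<open>The differences of z are prescribed, so z is a partial sum interpolated at the
    nodes. Interpolation only gives degree at most d; the cubic bound comes later from the
    distinctness of \<theta>.\<close>
  obtain z where z: "degree z \<le> d"
    "\<And>i. i \<le> d \<Longrightarrow> poly z (s i) = - (\<Sum>k<i. s k * s (Suc k) * (s k - s (Suc k)))"
    using interpolation_ex[OF s_inj, of "\<lambda>i. - (\<Sum>k<i. s k * s (Suc k) * (s k - s (Suc k)))"] by blast
  have zstep: "poly z (s i) - poly z (s (Suc i)) = s i * s (Suc i) * (s i - s (Suc i))" if "Suc i \<le> d" for i
    using that by (simp add: z(2))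
  have comm: "a i j * (s i * s j * (s i - s j)) = a i j * (poly z (s i) - poly z (s j))"
    if "i \<le> d" "j \<le> d" for i j
  proof -
    consider "j + 1 < i" | "i = Suc j" | "j = i" | "j = Suc i" | "i + 1 < j" by linarith
    then show ?thesis
    proof cases
      case 2
      then have "poly z (s i) - poly z (s j) = s i * s j * (s i - s j)"
        using zstep[of j] that by (simp add: algebra_simps)
      then show ?thesis by simp
    next
      case 4
      then have "poly z (s i) - poly z (s j) = s i * s j * (s i - s j)"
        using zstep[of i] that by simp
      then show ?thesis by simp
    qed (use that in \<open>auto simp: lower_zero upper_zero\<close>)
  qed
  have key: "s i * s i * (\<Sum>j\<le>d. a i j * poly (monom 1 (Suc n)) (s j))
      - s i * (\<Sum>j\<le>d. a i j * poly (monom 1 (n + 2)) (s j))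
    = poly z (s i) * (\<Sum>j\<le>d. a i j * poly (monom 1 n) (s j))
      - (\<Sum>j\<le>d. a i j * poly (z * monom 1 n) (s j))" if "i \<le> d" for i n
  proof -
    have "a i j * (s i * s j * (s i - s j)) * s j ^ n = a i j * (poly z (s i) - poly z (s j)) * s j ^ n"
      if "j \<le> d" for j using comm[OF \<open>i \<le> d\<close> that] by simp
    then have "(\<Sum>j\<le>d. a i j * (s i * s j * (s i - s j)) * s j ^ n)
      = (\<Sum>j\<le>d. a i j * (poly z (s i) - poly z (s j)) * s j ^ n)" by (intro sum.cong) auto
    then show ?thesis
      by (simp add: poly_monom sum_distrib_left sum_subtractf algebra_simps power2_eq_square)
  qed
  have image: "\<exists>q. degree q \<le> n \<and> coeff q n = \<theta> n
    \<and> (\<forall>i\<le>d. (\<Sum>j\<le>d. a i j * poly (monom 1 n) (s j)) = poly q (s i))" if "n \<le> d" for n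
    using preserves_degree_flag[OF that, of "monom 1 n"] by (simp add: degree_monom_eq)
  \<comment> \<open>Here the commutator identity is applied to the n-th power of x and coefficients
    of degree n + k are compared. As all degrees are at most d, equality at the nodes is equality of
    polynomials. The side without z has degree at most n + 3, so it contributes only for k =
    3.\<close>
  have image_z: "\<theta> n * coeff z k - \<theta> (n + k) * coeff z k
      = (if k = 3 then \<theta> (n + 1) - \<theta> (n + 2) else 0)"
    if k: "k \<ge> 3" "degree z \<le> k" "n + k \<le> d" for n k
  proof -
    obtain q0 where q0: "degree q0 \<le> n" "coeff q0 n = \<theta> n"
      "\<And>i. i \<le> d \<Longrightarrow> (\<Sum>j\<le>d. a i j * poly (monom 1 n) (s j)) = poly q0 (s i)"
      using image[of n] k by auto
    obtain q1 where q1: "degree q1 \<le> Suc n" "coeff q1 (Suc n) = \<theta> (Suc n)"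
      "\<And>i. i \<le> d \<Longrightarrow> (\<Sum>j\<le>d. a i j * poly (monom 1 (Suc n)) (s j)) = poly q1 (s i)"
      using image[of "Suc n"] k by auto
    obtain q2 where q2: "degree q2 \<le> n + 2" "coeff q2 (n + 2) = \<theta> (n + 2)"
      "\<And>i. i \<le> d \<Longrightarrow> (\<Sum>j\<le>d. a i j * poly (monom 1 (n + 2)) (s j)) = poly q2 (s i)"
      using image[of "n + 2"] k by auto
    have "degree (z * monom 1 n) \<le> n + k"
      using k(2) degree_mult_le[of z "monom 1 n"] by (simp add: degree_monom_eq)
    then obtain q3 where q3: "degree q3 \<le> n + k" "coeff q3 (n + k) = \<theta> (n + k) * coeff (z * monom 1 n) (n + k)"
      "\<And>i. i \<le> d \<Longrightarrow> (\<Sum>j\<le>d. a i j * poly (z * monom 1 n) (s j)) = poly q3 (s i)"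
      using preserves_degree_flag[OF k(3), of "z * monom 1 n"] by auto
    have eq: "monom 1 2 * q1 - monom 1 1 * q2 = z * q0 - q3"
    proof (rule poly_eq_of_nodes[OF s_inj])
      fix i assume "i \<le> d"
      note i = this
      from key[OF i, of n] show "poly (monom 1 2 * q1 - monom 1 1 * q2) (s i) = poly (z * q0 - q3) (s i)"
        unfolding q0(3)[OF i] q1(3)[OF i] q2(3)[OF i] q3(3)[OF i] by (simp add: poly_monom power2_eq_square)
    next
      have "degree (monom 1 2 * q1) \<le> d" "degree (monom 1 1 * q2) \<le> d"
        using degree_mult_le[of "monom (1::'a) 2" q1] degree_mult_le[of "monom (1::'a) 1" q2] q1 q2 k
        by (simp_all add: degree_monom_eq)
      then show "degree (monom 1 2 * q1 - monom 1 1 * q2) \<le> d" by (rule degree_diff_le)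
      have "degree (z * q0) \<le> d" using degree_mult_le[of z q0] q0 k by simp
      then show "degree (z * q0 - q3) \<le> d" using q3 k by (intro degree_diff_le) auto
    qed
    have c1: "coeff (z * q0) (n + k) = \<theta> n * coeff z k"
      using coeff_mult_degree_bounds[OF k(2) q0(1)] q0(2) by (simp add: add.commute mult.commute)
    have c2: "coeff (z * monom 1 n) (n + k) = coeff z k"
      by (simp add: coeff_monom_mult mult.commute[of z])
    have c3: "coeff (monom 1 2 * q1) (n + k) = (if k = 3 then \<theta> (n + 1) else 0)"
      using q1 k by (auto simp: coeff_monom_mult coeff_eq_0)
    have c4: "coeff (monom 1 1 * q2) (n + k) = (if k = 3 then \<theta> (n + 2) else 0)"
      using q2 k by (auto simp: coeff_monom_mult coeff_eq_0)
    have "coeff (monom 1 2 * q1) (n + k) - coeff (monom 1 1 * q2) (n + k)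
      = coeff (z * q0) (n + k) - coeff q3 (n + k)"
      using arg_cong[OF eq, of "\<lambda>p. coeff p (n + k)"] by (simp only: coeff_diff)
    then have "\<theta> n * coeff z k - \<theta> (n + k) * coeff z k
      = (if k = 3 then \<theta> (n + 1) else 0) - (if k = 3 then \<theta> (n + 2) else 0)"
      unfolding c1 c3 c4 q3(2) c2 by (rule sym)
    then show ?thesis by (cases "k = 3") (simp_all only: simp_thms if_True if_False diff_self)
  qed
  have \<theta>_neq: "\<theta> i \<noteq> \<theta> j" if "i \<le> d" "j \<le> d" "i \<noteq> j" for i j
    using \<theta> that by (auto simp: inj_on_def)
  \<comment> \<open>With n = 0 and k the degree of z, a degree above 3 would make
    \<open>\<theta> 0\<close> equal to \<open>\<theta> k\<close>.\<close>
  have z3: "degree z \<le> 3"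
  proof (rule ccontr)
    assume "\<not> degree z \<le> 3"
    then have "(\<theta> 0 - \<theta> (degree z)) * coeff z (degree z) = 0"
      using image_z[of "degree z" 0] z(1) by (simp add: algebra_simps)
    then show False using \<theta>_neq[of 0 "degree z"] z(1) \<open>\<not> degree z \<le> 3\<close> by auto
  qed
  define c where "c = coeff z 3"
  have c: "c * (\<theta> n - \<theta> (n + 3)) = \<theta> (n + 1) - \<theta> (n + 2)" if "n + 3 \<le> d" for n
    using image_z[of 3 n] z3 that by (simp add: c_def algebra_simps)
  have c0: "c \<noteq> 0" using c[of 0] \<theta>_neq[of 1 2] d by (auto simp: numeral_2_eq_2)
  have zp: "poly z x = coeff z 0 + coeff z 1 * x + coeff z 2 * x\<^sup>2 + c * x ^ 3" for x
  proof -
    have "poly z x = (\<Sum>i\<le>3. coeff z i * x ^ i)"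
      unfolding poly_altdef by (rule sum.mono_neutral_left) (use z3 in \<open>auto simp: coeff_eq_0\<close>)
    also have "\<dots> = coeff z 0 + coeff z 1 * x + coeff z 2 * x\<^sup>2 + c * x ^ 3"
      by (simp add: c_def eval_nat_numeral)
    finally show ?thesis .
  qed
  \<comment> \<open>The difference of z at two neighbouring nodes is divisible by the difference of
    the nodes; what remains is symmetric in the two nodes.\<close>
  have q: "s i * s (Suc i) = c * ((s i)\<^sup>2 + s i * s (Suc i) + (s (Suc i))\<^sup>2) + coeff z 2 * (s i + s (Suc i)) + coeff z 1"
    if "Suc i \<le> d" for i
  proof -
    have "(s i - s (Suc i)) * (s i * s (Suc i)) = (s i - s (Suc i)) *
      (c * ((s i)\<^sup>2 + s i * s (Suc i) + (s (Suc i))\<^sup>2) + coeff z 2 * (s i + s (Suc i)) + coeff z 1)"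
      using zstep[OF that] unfolding zp by Groebner_Basis.algebra
    then show ?thesis using s_neq[of i "Suc i"] that by simp
  qed
  \<comment> \<open>Subtracting two consecutive symmetric relations and cancelling
    \<open>s i - s (i + 2)\<close> leaves a linear relation between three nodes.\<close>
  have m: "s (i + 1) = c * (s i + s (i + 1) + s (i + 2)) + coeff z 2" if "i + 2 \<le> d" for i
  proof -
    have "(s i - s (i + 2)) * s (i + 1) = (s i - s (i + 2)) * (c * (s i + s (i + 1) + s (i + 2)) + coeff z 2)"
      using q[of i] q[of "Suc i"] that by (simp add: numeral_2_eq_2) Groebner_Basis.algebra
    then show ?thesis using s_neq[of i "i + 2"] that by simp
  qed
  have s: "c * (s i - s (i + 3)) = s (i + 1) - s (i + 2)" if "i + 3 \<le> d" for i
    using m[of i] m[of "i + 1"] that by (simp add: numeral_3_eq_3 numeral_2_eq_2) Groebner_Basis.algebra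
  show ?thesis
  \<comment> \<open>The cubic coefficient of z is the inverse of \<open>\<beta> + 1\<close>, for
    both sequences at once.\<close>
  proof (intro exI[of _ "1 / c - 1"] allI impI conjI)
    fix i assume i: "i + 3 \<le> d"
    show "s i - s (i + 3) = (1 / c - 1 + 1) * (s (i + 1) - s (i + 2))"
      unfolding s[OF i, symmetric] using c0 by simp
    show "\<theta> i - \<theta> (i + 3) = (1 / c - 1 + 1) * (\<theta> (i + 1) - \<theta> (i + 2))"
      unfolding c[OF i, symmetric] using c0 by simp
  qed
qed auto

end

section \<open>Eigenbases and primitive idempotents\<close>

lemma mult_vec_index:
  assumes "N \<in> carrier_mat (Suc d) (Suc d)" "w \<in> carrier_vec (Suc d)" "i \<le> d"
  shows "(N *\<^sub>v w) $ i = (\<Sum>j\<le>d. N $$ (i,j) * w $ j)"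
proof -
  have "{0..<Suc d} = {..d}" by auto
  then show ?thesis using assms by (auto simp: scalar_prod_def intro!: sum.cong)
qed

lemma carrier_vec_eqI:
  assumes "u \<in> carrier_vec (Suc d)" "w \<in> carrier_vec (Suc d)" "\<And>i. i \<le> d \<Longrightarrow> u $ i = w $ i"
  shows "u = w"
  using assms by (intro eq_vecI) auto

lemma mat_eq_of_vec:
  assumes "N \<in> carrier_mat (Suc d) (Suc d)" "N' \<in> carrier_mat (Suc d) (Suc d)"
    and "\<And>w. w \<in> carrier_vec (Suc d) \<Longrightarrow> N *\<^sub>v w = N' *\<^sub>v w"
  shows "N = (N' :: 'a::field mat)"
proof (rule eq_matI)
  fix i j assume "i < dim_row N'" "j < dim_col N'"
  then have ij: "i \<le> d" "j \<le> d" using assms(2) by auto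
  have "(L *\<^sub>v unit_vec (Suc d) j) $ i = L $$ (i,j)" if "L \<in> carrier_mat (Suc d) (Suc d)" for L :: "'a mat"
  proof -
    have "(L *\<^sub>v unit_vec (Suc d) j) $ i = (\<Sum>k\<le>d. L $$ (i,k) * unit_vec (Suc d) j $ k)"
      using that ij by (intro mult_vec_index) auto
    also have "\<dots> = (\<Sum>k\<le>d. if k = j then L $$ (i,j) else 0)"
      by (rule sum.cong) (use ij in auto)
    finally show ?thesis using ij by simp
  qed
  from this[OF assms(1)] this[OF assms(2)] show "N $$ (i,j) = N' $$ (i,j)"
    using assms(3)[of "unit_vec (Suc d) j"] by simp
qed (use assms(1,2) in auto)

lemma primitive_idempotent_carrier:
  assumes "A \<in> carrier_mat (Suc d) (Suc d)"
  shows "primitive_idempotent d A \<theta> i \<in> carrier_mat (Suc d) (Suc d)"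
proof -
  have "foldr (\<lambda>j M. ((1 / (\<theta> i - \<theta> j)) \<cdot>\<^sub>m (A - \<theta> j \<cdot>\<^sub>m 1\<^sub>m (Suc d))) * M) xs (1\<^sub>m (Suc d))
    \<in> carrier_mat (Suc d) (Suc d)" for xs
    by (induction xs) (use assms in \<open>auto intro!: mult_carrier_mat\<close>)
  then show ?thesis unfolding primitive_idempotent_def Suc_eq_plus1[symmetric] by blast
qed

lemma primitive_idempotent_cong:
  assumes "i \<le> d" "\<And>j. j \<le> d \<Longrightarrow> \<theta> j = \<theta>' j"
  shows "primitive_idempotent d A \<theta> i = primitive_idempotent d A \<theta>' i"
  unfolding primitive_idempotent_def by (rule foldr_cong) (use assms in \<open>auto simp del: upt_Suc\<close>)

section \<open>Coordinates with respect to an eigenbasis\<close>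

locale eigenbasis =
  fixes d :: nat and M :: "'a::field mat" and \<theta> :: "nat \<Rightarrow> 'a" and v :: "nat \<Rightarrow> 'a vec"
  assumes M_carrier: "M \<in> carrier_mat (Suc d) (Suc d)"
    and \<theta>_inj: "inj_on \<theta> {..d}"
    and v_carrier: "j \<le> d \<Longrightarrow> v j \<in> carrier_vec (Suc d)"
    and v_nonzero: "j \<le> d \<Longrightarrow> v j \<noteq> 0\<^sub>v (Suc d)"
    and v_eigen: "j \<le> d \<Longrightarrow> M *\<^sub>v v j = \<theta> j \<cdot>\<^sub>v v j"
begin

abbreviation E :: "nat \<Rightarrow> 'a mat" where "E \<equiv> primitive_idempotent d M \<theta>"

definition comb :: "(nat \<Rightarrow> 'a) \<Rightarrow> 'a vec" where
  "comb c = vec (Suc d) (\<lambda>i. \<Sum>k\<le>d. c k * v k $ i)"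

lemma comb_carrier [simp]: "comb c \<in> carrier_vec (Suc d)"
  by (simp add: comb_def)

lemma comb_index: "i \<le> d \<Longrightarrow> comb c $ i = (\<Sum>k\<le>d. c k * v k $ i)"
  by (simp add: comb_def)

lemma \<theta>_neq: "i \<le> d \<Longrightarrow> j \<le> d \<Longrightarrow> i \<noteq> j \<Longrightarrow> \<theta> i \<noteq> \<theta> j"
  using \<theta>_inj by (auto simp: inj_on_def)

lemmas E_carrier = primitive_idempotent_carrier[OF M_carrier, of \<theta>]

text \<open>Each factor of the product acts on \<open>v k\<close> as a scalar. For k = i all these
  scalars are 1; otherwise the factor with j = k is zero.\<close>

lemma E_v: assumes "i \<le> d" "k \<le> d" shows "E i *\<^sub>v v k = (if k = i then v k else 0\<^sub>v (Suc d))"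
proof -
  let ?F = "\<lambda>j N. ((1 / (\<theta> i - \<theta> j)) \<cdot>\<^sub>m (M - \<theta> j \<cdot>\<^sub>m 1\<^sub>m (Suc d))) * N"
  have v: "v k \<in> carrier_vec (Suc d)" using v_carrier assms by blast
  have factor: "((1 / (\<theta> i - \<theta> j)) \<cdot>\<^sub>m (M - \<theta> j \<cdot>\<^sub>m 1\<^sub>m (Suc d))) *\<^sub>v (c \<cdot>\<^sub>v v k)
    = ((\<theta> k - \<theta> j) / (\<theta> i - \<theta> j) * c) \<cdot>\<^sub>v v k" for j c
  proof (rule carrier_vec_eqI)
    fix l assume l: "l \<le> d"
    have "(((1 / (\<theta> i - \<theta> j)) \<cdot>\<^sub>m (M - \<theta> j \<cdot>\<^sub>m 1\<^sub>m (Suc d))) *\<^sub>v (c \<cdot>\<^sub>v v k)) $ l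
      = (\<Sum>m\<le>d. ((1 / (\<theta> i - \<theta> j)) \<cdot>\<^sub>m (M - \<theta> j \<cdot>\<^sub>m 1\<^sub>m (Suc d))) $$ (l,m) * (c \<cdot>\<^sub>v v k) $ m)"
      using M_carrier v l by (intro mult_vec_index) auto
    also have "\<dots> = (\<Sum>m\<le>d. c / (\<theta> i - \<theta> j) * (M $$ (l,m) * v k $ m)
        - (if m = l then c / (\<theta> i - \<theta> j) * \<theta> j * v k $ l else 0))"
      by (rule sum.cong) (use M_carrier v l in \<open>auto simp: algebra_simps diff_divide_distrib\<close>)
    also have "\<dots> = c / (\<theta> i - \<theta> j) * (M *\<^sub>v v k) $ l - c / (\<theta> i - \<theta> j) * \<theta> j * v k $ l"
      using l by (simp add: sum_subtractf sum_distrib_left mult_vec_index[OF M_carrier v l] del: index_mult_mat_vec)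
    also have "\<dots> = (((\<theta> k - \<theta> j) / (\<theta> i - \<theta> j) * c) \<cdot>\<^sub>v v k) $ l"
      unfolding v_eigen[OF assms(2)] using v l by (simp add: algebra_simps diff_divide_distrib)
    finally show "(((1 / (\<theta> i - \<theta> j)) \<cdot>\<^sub>m (M - \<theta> j \<cdot>\<^sub>m 1\<^sub>m (Suc d))) *\<^sub>v (c \<cdot>\<^sub>v v k)) $ l
      = (((\<theta> k - \<theta> j) / (\<theta> i - \<theta> j) * c) \<cdot>\<^sub>v v k) $ l" .
  next
    have c: "(1 / (\<theta> i - \<theta> j)) \<cdot>\<^sub>m (M - \<theta> j \<cdot>\<^sub>m 1\<^sub>m (Suc d)) \<in> carrier_mat (Suc d) (Suc d)"
      using M_carrier by auto
    show "((1 / (\<theta> i - \<theta> j)) \<cdot>\<^sub>m (M - \<theta> j \<cdot>\<^sub>m 1\<^sub>m (Suc d))) *\<^sub>v (c \<cdot>\<^sub>v v k) \<in> carrier_vec (Suc d)"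
      using mult_mat_vec_carrier[OF c] v by auto
  qed (use v in auto)
  have "foldr ?F xs (1\<^sub>m (Suc d)) *\<^sub>v v k = (\<Prod>j\<leftarrow>xs. (\<theta> k - \<theta> j) / (\<theta> i - \<theta> j)) \<cdot>\<^sub>v v k" for xs
  proof (induction xs)
    case Nil
    then show ?case using v by simp
  next
    case (Cons x xs)
    have "foldr ?F xs (1\<^sub>m (Suc d)) \<in> carrier_mat (Suc d) (Suc d)"
      by (induction xs) (use M_carrier in \<open>auto intro!: mult_carrier_mat\<close>)
    then have "foldr ?F (x # xs) (1\<^sub>m (Suc d)) *\<^sub>v v k
      = ((1 / (\<theta> i - \<theta> x)) \<cdot>\<^sub>m (M - \<theta> x \<cdot>\<^sub>m 1\<^sub>m (Suc d))) *\<^sub>v (foldr ?F xs (1\<^sub>m (Suc d)) *\<^sub>v v k)"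
      unfolding foldr.simps o_def using M_carrier v
      by (intro assoc_mult_mat_vec[of _ "Suc d" "Suc d" _ "Suc d"]) auto
    then show ?case unfolding Cons.IH factor by simp
  qed
  then have *: "E i *\<^sub>v v k
    = (\<Prod>j\<leftarrow>filter (\<lambda>j. j \<noteq> i) [0..<Suc d]. (\<theta> k - \<theta> j) / (\<theta> i - \<theta> j)) \<cdot>\<^sub>v v k"
    unfolding primitive_idempotent_def Suc_eq_plus1[symmetric] by blast
  show ?thesis
  proof (cases "k = i")
    case True
    have "map (\<lambda>j. (\<theta> k - \<theta> j) / (\<theta> i - \<theta> j)) (filter (\<lambda>j. j \<noteq> i) [0..<Suc d])
      = map (\<lambda>j. 1) (filter (\<lambda>j. j \<noteq> i) [0..<Suc d])"
      by (rule map_cong) (use True \<theta>_neq[of i] assms in \<open>auto simp del: upt_Suc\<close>)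
    moreover have "prod_list (map (\<lambda>j. 1::'a) xs) = 1" for xs :: "nat list" by (induction xs) auto
    ultimately have "(\<Prod>j\<leftarrow>filter (\<lambda>j. j \<noteq> i) [0..<Suc d]. (\<theta> k - \<theta> j) / (\<theta> i - \<theta> j)) = 1"
      by (simp only:)
    then show ?thesis unfolding * using True by simp
  next
    case False
    then have "0 \<in> set (map (\<lambda>j. (\<theta> k - \<theta> j) / (\<theta> i - \<theta> j)) (filter (\<lambda>j. j \<noteq> i) [0..<Suc d]))"
      using assms by (auto intro!: image_eqI[of _ _ k] simp del: upt_Suc)
    then have z: "(\<Prod>j\<leftarrow>filter (\<lambda>j. j \<noteq> i) [0..<Suc d]. (\<theta> k - \<theta> j) / (\<theta> i - \<theta> j)) = 0"
      by (simp only: prod_list_zero_iff)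
    show ?thesis unfolding * z using False v by auto
  qed
qed

lemma mult_comb_index:
  assumes "N \<in> carrier_mat (Suc d) (Suc d)" "i \<le> d"
  shows "(N *\<^sub>v comb c) $ i = (\<Sum>k\<le>d. c k * (N *\<^sub>v v k) $ i)"
proof -
  have "(N *\<^sub>v comb c) $ i = (\<Sum>j\<le>d. \<Sum>k\<le>d. N $$ (i,j) * (c k * v k $ j))"
    using assms by (simp add: mult_vec_index comb_index sum_distrib_left del: index_mult_mat_vec)
  also have "\<dots> = (\<Sum>k\<le>d. \<Sum>j\<le>d. N $$ (i,j) * (c k * v k $ j))"
    by (rule sum.swap)
  also have "\<dots> = (\<Sum>k\<le>d. c k * (N *\<^sub>v v k) $ i)"
    by (rule sum.cong[OF refl])
      (use assms v_carrier in \<open>simp add: mult_vec_index sum_distrib_left algebra_simps del: index_mult_mat_vec\<close>)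
  finally show ?thesis .
qed

lemma E_comb:
  assumes "i \<le> d" shows "E i *\<^sub>v comb c = c i \<cdot>\<^sub>v v i"
proof (rule carrier_vec_eqI)
  fix l assume l: "l \<le> d"
  have "(E i *\<^sub>v comb c) $ l = (\<Sum>k\<le>d. c k * (E i *\<^sub>v v k) $ l)"
    by (rule mult_comb_index[OF E_carrier l])
  also have "\<dots> = (\<Sum>k\<le>d. if k = i then c i * v i $ l else 0)"
    by (rule sum.cong[OF refl]) (use assms l in \<open>simp add: E_v del: index_mult_mat_vec\<close>)
  also have "\<dots> = (c i \<cdot>\<^sub>v v i) $ l" using assms l v_carrier[OF assms] by auto
  finally show "(E i *\<^sub>v comb c) $ l = (c i \<cdot>\<^sub>v v i) $ l" .
qed (use assms v_carrier mult_mat_vec_carrier[OF E_carrier] in auto)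

lemma M_comb: "M *\<^sub>v comb c = comb (\<lambda>k. \<theta> k * c k)"
proof (rule carrier_vec_eqI)
  fix l assume l: "l \<le> d"
  have "(M *\<^sub>v comb c) $ l = (\<Sum>k\<le>d. c k * (M *\<^sub>v v k) $ l)"
    by (rule mult_comb_index[OF M_carrier l])
  also have "\<dots> = comb (\<lambda>k. \<theta> k * c k) $ l"
    unfolding comb_index[OF l]
  proof (rule sum.cong[OF refl])
    fix k assume "k \<in> {..d}"
    then show "c k * (M *\<^sub>v v k) $ l = \<theta> k * c k * v k $ l"
      using v_carrier[of k] l by (simp add: v_eigen del: index_mult_mat_vec)
  qed
  finally show "(M *\<^sub>v comb c) $ l = comb (\<lambda>k. \<theta> k * c k) $ l" .
qed (use mult_mat_vec_carrier[OF M_carrier] in auto)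

lemma v_smult_zero: "k \<le> d \<Longrightarrow> c \<cdot>\<^sub>v v k = 0\<^sub>v (Suc d) \<Longrightarrow> c = 0"
proof (rule ccontr)
  assume k: "k \<le> d" and c: "c \<cdot>\<^sub>v v k = 0\<^sub>v (Suc d)" "c \<noteq> 0"
  have "v k = 0\<^sub>v (Suc d)"
  proof (rule carrier_vec_eqI)
    fix i assume i: "i \<le> d"
    have "(c \<cdot>\<^sub>v v k) $ i = 0" using i unfolding c by simp
    moreover have "(c \<cdot>\<^sub>v v k) $ i = c * v k $ i" using i v_carrier[OF k] by auto
    ultimately show "v k $ i = 0\<^sub>v (Suc d) $ i" using i c(2) by simp
  qed (use v_carrier k in auto)
  then show False using v_nonzero k by blast
qed

lemma comb_zero:
  assumes "comb c = 0\<^sub>v (Suc d)" "k \<le> d" shows "c k = 0"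
proof -
  have "E k *\<^sub>v comb c = 0\<^sub>v (Suc d)" unfolding assms(1) using E_carrier[of k] by auto
  then show ?thesis using E_comb[OF assms(2)] v_smult_zero[OF assms(2)] by simp
qed

text \<open>Independence of the eigenvectors, from \<open>comb_zero\<close>, makes the matrix with
  these columns invertible, and this gives spanning.\<close>

lemma comb_ex:
  assumes w: "w \<in> carrier_vec (Suc d)" shows "\<exists>c. w = comb c"
proof -
  define P where "P = mat (Suc d) (Suc d) (\<lambda>(i,k). v k $ i)"
  have P: "P \<in> carrier_mat (Suc d) (Suc d)" by (simp add: P_def)
  have P_comb: "P *\<^sub>v x = comb (\<lambda>k. x $ k)" if x: "x \<in> carrier_vec (Suc d)" for x
  proof (rule carrier_vec_eqI)
    fix i assume i: "i \<le> d"
    show "(P *\<^sub>v x) $ i = comb (\<lambda>k. x $ k) $ i"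
      unfolding mult_vec_index[OF P x i] comb_index[OF i]
      by (rule sum.cong) (use i in \<open>auto simp: P_def mult.commute\<close>)
  qed (use mult_mat_vec_carrier[OF P x] in auto)
  have "det P \<noteq> 0"
  proof
    assume "det P = 0"
    then obtain x where x: "x \<in> carrier_vec (Suc d)" "x \<noteq> 0\<^sub>v (Suc d)" "P *\<^sub>v x = 0\<^sub>v (Suc d)"
      using det_0_iff_vec_prod_zero_field[OF P] by blast
    then have "x $ k = 0" if "k \<le> d" for k using comb_zero[OF _ that] P_comb[of x] by metis
    then have "x = 0\<^sub>v (Suc d)" using x(1) by (intro carrier_vec_eqI[of _ d]) auto
    then show False using x(2) by simp
  qed
  from det_non_zero_imp_unit[OF P this, of "()"]
  obtain Q where Q: "Q \<in> carrier_mat (Suc d) (Suc d)" "P * Q = 1\<^sub>m (Suc d)"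
    by (auto simp: Units_def ring_mat_simps)
  have Qw: "Q *\<^sub>v w \<in> carrier_vec (Suc d)" using Q w by auto
  have "P *\<^sub>v (Q *\<^sub>v w) = w" using assoc_mult_mat_vec[OF P Q(1) w] Q(2) w by simp
  then show ?thesis using P_comb[OF Qw] by metis
qed

lemma eigenvalue_iff: "eigenvalue M t \<longleftrightarrow> t \<in> \<theta> ` {..d}"
proof
  assume "eigenvalue M t"
  then obtain w where w: "w \<in> carrier_vec (Suc d)" "w \<noteq> 0\<^sub>v (Suc d)" "M *\<^sub>v w = t \<cdot>\<^sub>v w"
    using M_carrier by (auto simp: eigenvalue_def eigenvector_def)
  obtain c where c: "w = comb c" using comb_ex[OF w(1)] by blast
  have "comb (\<lambda>k. (\<theta> k - t) * c k) = 0\<^sub>v (Suc d)"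
  proof (rule carrier_vec_eqI)
    fix i assume i: "i \<le> d"
    have "(t \<cdot>\<^sub>v comb c) $ i = t * comb c $ i"
      using i comb_carrier[of c] by (auto simp del: comb_carrier)
    then have "comb (\<lambda>k. \<theta> k * c k) $ i = t * comb c $ i"
      using w(3) unfolding c M_comb by simp
    then show "comb (\<lambda>k. (\<theta> k - t) * c k) $ i = 0\<^sub>v (Suc d) $ i"
      using i by (simp add: comb_index algebra_simps sum_subtractf sum_distrib_left)
  qed auto
  then have z: "(\<theta> k - t) * c k = 0" if "k \<le> d" for k using comb_zero that by blast
  have "\<exists>k\<le>d. c k \<noteq> 0"
  proof (rule ccontr)
    assume "\<not> (\<exists>k\<le>d. c k \<noteq> 0)"
    then have "w = 0\<^sub>v (Suc d)" unfolding c by (intro carrier_vec_eqI[of _ d]) (auto simp: comb_index)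
    then show False using w(2) by simp
  qed
  then show "t \<in> \<theta> ` {..d}" using z by auto
next
  assume "t \<in> \<theta> ` {..d}"
  then obtain k where "k \<le> d" "t = \<theta> k" by auto
  then show "eigenvalue M t"
    unfolding eigenvalue_def eigenvector_def
    using v_carrier v_nonzero v_eigen M_carrier by auto
qed

lemma bij_eigenvalues: "bij_betw \<theta> {0..d} {t. eigenvalue M t}"
  unfolding eigenvalue_iff using \<theta>_inj by (simp add: bij_betw_def atLeast0AtMost)

lemma multiplicity_free: "multiplicity_free d M"
  using bij_betw_same_card[OF bij_eigenvalues] M_carrier by (simp add: multiplicity_free_def)

lemma associated: "associated_eigenvalues d M E \<theta>"
  using bij_eigenvalues by (simp add: associated_eigenvalues_def)

text \<open>The product sends a vector with coordinates c to \<open>(c j * b i)\<close> times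
  \<open>v i\<close>. This translates the conditions on an idempotent sequence into conditions on
  the entries of N in the eigenbasis.\<close>

lemma idempotent_product_zero_iff:
  assumes N: "N \<in> carrier_mat (Suc d) (Suc d)" and ij: "i \<le> d" "j \<le> d" and B: "N *\<^sub>v v j = comb b"
  shows "E i * N * E j = 0\<^sub>m (Suc d) (Suc d) \<longleftrightarrow> b i = 0"
proof -
  have EN: "E i * N \<in> carrier_mat (Suc d) (Suc d)" using E_carrier N by (rule mult_carrier_mat)
  have ENE: "E i * N * E j \<in> carrier_mat (Suc d) (Suc d)" using EN E_carrier by (rule mult_carrier_mat)
  have act: "(E i * N * E j) *\<^sub>v comb c = (c j * b i) \<cdot>\<^sub>v v i" for c
  proof -
    have "(E i * N * E j) *\<^sub>v comb c = (E i * N) *\<^sub>v (E j *\<^sub>v comb c)"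
      by (rule assoc_mult_mat_vec[OF EN E_carrier]) simp
    also have "\<dots> = c j \<cdot>\<^sub>v ((E i * N) *\<^sub>v v j)"
      unfolding E_comb[OF ij(2)] by (rule mult_mat_vec[OF EN v_carrier[OF ij(2)]])
    also have "(E i * N) *\<^sub>v v j = b i \<cdot>\<^sub>v v i"
      using assoc_mult_mat_vec[OF E_carrier N v_carrier[OF ij(2)]] B E_comb[OF ij(1)] by simp
    finally show ?thesis by (simp add: smult_smult_assoc)
  qed
  have zero: "0\<^sub>m (Suc d) (Suc d) *\<^sub>v comb c = 0\<^sub>v (Suc d)" for c
    by (rule eq_vecI) (auto simp: scalar_prod_def comb_def)
  show ?thesis
  proof
    assume z: "E i * N * E j = 0\<^sub>m (Suc d) (Suc d)"
    have "(1 * b i) \<cdot>\<^sub>v v i = 0\<^sub>v (Suc d)"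
      using act[of "\<lambda>_. 1"] unfolding z zero by simp
    then show "b i = 0" using v_smult_zero[OF ij(1)] by simp
  next
    assume z: "b i = 0"
    show "E i * N * E j = 0\<^sub>m (Suc d) (Suc d)"
    proof (rule mat_eq_of_vec[OF ENE])
      fix w :: "'a vec" assume "w \<in> carrier_vec (Suc d)"
      then obtain c where c: "w = comb c" using comb_ex by blast
      show "(E i * N * E j) *\<^sub>v w = 0\<^sub>m (Suc d) (Suc d) *\<^sub>v w"
        unfolding c act z zero using v_carrier[OF ij(1)] by auto
    qed simp
  qed
qed

lemma image_E:
  assumes "i \<le> d"
  shows "image_space d (E i) = {c \<cdot>\<^sub>v v i | c. True}"
proof
  show "image_space d (E i) \<subseteq> {c \<cdot>\<^sub>v v i | c. True}"
  proof
    fix x assume "x \<in> image_space d (E i)"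
    then obtain w where w: "w \<in> carrier_vec (Suc d)" "x = E i *\<^sub>v w"
      unfolding image_space_def Suc_eq_plus1[symmetric] by blast
    then obtain c where "w = comb c" using comb_ex by blast
    then show "x \<in> {c \<cdot>\<^sub>v v i | c. True}" using w(2) E_comb[OF assms] by blast
  qed
  show "{c \<cdot>\<^sub>v v i | c. True} \<subseteq> image_space d (E i)"
  proof
    fix x assume "x \<in> {c \<cdot>\<^sub>v v i | c. True}"
    then obtain c where "x = c \<cdot>\<^sub>v v i" by blast
    then have "x = E i *\<^sub>v comb (\<lambda>_. c)" using E_comb[OF assms, of "\<lambda>_. c"] by simp
    then show "x \<in> image_space d (E i)"
      unfolding image_space_def Suc_eq_plus1[symmetric] using comb_carrier by blast
  qed
qed

text \<open>A sum of eigenlines is cut out by the vanishing of the complementary coordinates. In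
  this form split spaces become systems of linear equations.\<close>

lemma sum_of_images:
  assumes S: "S \<subseteq> {..d}"
  shows "sum_of_subspaces d (\<lambda>h. image_space d (E h)) S
    = {w \<in> carrier_vec (Suc d). \<forall>k\<le>d. k \<notin> S \<longrightarrow> E k *\<^sub>v w = 0\<^sub>v (Suc d)}"
proof -
  have fin: "finite S" using S finite_subset by blast
  have sum: "finsum_vec TYPE('a) (Suc d) (\<lambda>h. c h \<cdot>\<^sub>v v h) S = comb (\<lambda>k. if k \<in> S then c k else 0)" for c
  proof (rule carrier_vec_eqI)
    fix i assume i: "i \<le> d"
    have "finsum_vec TYPE('a) (Suc d) (\<lambda>h. c h \<cdot>\<^sub>v v h) S $ i = (\<Sum>h\<in>S. (c h \<cdot>\<^sub>v v h) $ i)"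
      by (rule index_finsum_vec[OF fin]) (use i S v_carrier in auto)
    also have "\<dots> = (\<Sum>h\<in>S. (if h \<in> S then c h else 0) * v h $ i)"
    proof (rule sum.cong[OF refl])
      fix h assume "h \<in> S"
      then have "v h \<in> carrier_vec (Suc d)" using S v_carrier by auto
      then show "(c h \<cdot>\<^sub>v v h) $ i = (if h \<in> S then c h else 0) * v h $ i" using \<open>h \<in> S\<close> i by auto
    qed
    also have "\<dots> = comb (\<lambda>k. if k \<in> S then c k else 0) $ i"
      unfolding comb_index[OF i] by (rule sum.mono_neutral_left) (use S in auto)
    finally show "finsum_vec TYPE('a) (Suc d) (\<lambda>h. c h \<cdot>\<^sub>v v h) S $ i
      = comb (\<lambda>k. if k \<in> S then c k else 0) $ i" .
  qed (use S v_carrier in \<open>auto intro!: finsum_vec_closed\<close>)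
  show ?thesis
  proof (intro equalityI subsetI)
    fix x assume "x \<in> sum_of_subspaces d (\<lambda>h. image_space d (E h)) S"
    then obtain w where w: "x = finsum_vec TYPE('a) (Suc d) w S" "\<forall>h\<in>S. w h \<in> image_space d (E h)"
      unfolding sum_of_subspaces_def Suc_eq_plus1[symmetric] by blast
    have "\<forall>h\<in>S. \<exists>c. w h = c \<cdot>\<^sub>v v h" using w(2) image_E S by blast
    then obtain c where c: "\<forall>h\<in>S. w h = c h \<cdot>\<^sub>v v h" by metis
    have "finsum_vec TYPE('a) (Suc d) w S = finsum_vec TYPE('a) (Suc d) (\<lambda>h. c h \<cdot>\<^sub>v v h) S"
    proof (rule carrier_vec_eqI)
      fix i assume i: "i \<le> d"
      show "finsum_vec TYPE('a) (Suc d) w S $ i = finsum_vec TYPE('a) (Suc d) (\<lambda>h. c h \<cdot>\<^sub>v v h) S $ i"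
        using i S v_carrier c by (subst (1 2) index_finsum_vec[OF fin]) (auto intro!: sum.cong)
    qed (use S v_carrier c in \<open>auto intro!: finsum_vec_closed\<close>)
    then have x: "x = comb (\<lambda>k. if k \<in> S then c k else 0)" unfolding w(1) sum .
    have "E k *\<^sub>v x = 0\<^sub>v (Suc d)" if "k \<le> d" "k \<notin> S" for k
      unfolding x E_comb[OF that(1)] using that v_carrier[of k] by auto
    then show "x \<in> {w \<in> carrier_vec (Suc d). \<forall>k\<le>d. k \<notin> S \<longrightarrow> E k *\<^sub>v w = 0\<^sub>v (Suc d)}"
      unfolding x by simp
  next
    fix x assume x: "x \<in> {w \<in> carrier_vec (Suc d). \<forall>k\<le>d. k \<notin> S \<longrightarrow> E k *\<^sub>v w = 0\<^sub>v (Suc d)}"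
    then obtain c where c: "x = comb c" using comb_ex by blast
    have "c k = 0" if "k \<le> d" "k \<notin> S" for k
    proof -
      have "E k *\<^sub>v x = 0\<^sub>v (Suc d)" using x that by blast
      then show ?thesis unfolding c E_comb[OF that(1)] using v_smult_zero[OF that(1)] by simp
    qed
    then have "comb c = comb (\<lambda>k. if k \<in> S then c k else 0)"
      by (intro carrier_vec_eqI[of _ d]) (auto simp: comb_index intro!: sum.cong)
    then have "x = finsum_vec TYPE('a) (Suc d) (\<lambda>h. c h \<cdot>\<^sub>v v h) S" unfolding sum c .
    moreover have "\<forall>h\<in>S. c h \<cdot>\<^sub>v v h \<in> image_space d (E h)" using image_E S by blast
    ultimately show "x \<in> sum_of_subspaces d (\<lambda>h. image_space d (E h)) S"
      unfolding sum_of_subspaces_def Suc_eq_plus1[symmetric] by blast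
  qed
qed

text \<open>Both matrices are the projection onto the line of \<open>v (\<sigma> i)\<close> along
  the other eigenvectors, so they agree on every combination of eigenvectors.\<close>

lemma primitive_idempotent_permute:
  assumes \<sigma>: "bij_betw \<sigma> {..d} {..d}" and i: "i \<le> d"
  shows "primitive_idempotent d M (\<lambda>k. \<theta> (\<sigma> k)) i = E (\<sigma> i)"
proof -
  have \<sigma>d: "\<sigma> k \<le> d" if "k \<le> d" for k using bij_betwE[OF \<sigma>] that by auto
  interpret p: eigenbasis d M "\<lambda>k. \<theta> (\<sigma> k)" "\<lambda>k. v (\<sigma> k)"
  proof
    show "inj_on (\<lambda>k. \<theta> (\<sigma> k)) {..d}"
      using \<theta>_inj \<sigma> comp_inj_on[of \<sigma> "{..d}" \<theta>] by (auto simp: bij_betw_def o_def)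
  qed (use M_carrier v_carrier v_nonzero v_eigen \<sigma>d in auto)
  have comb: "p.comb (\<lambda>k. c (\<sigma> k)) = comb c" for c
  proof (rule carrier_vec_eqI)
    fix l assume l: "l \<le> d"
    show "p.comb (\<lambda>k. c (\<sigma> k)) $ l = comb c $ l"
      unfolding p.comb_index[OF l] comb_index[OF l]
      by (rule sum.reindex_bij_betw[OF \<sigma>, of "\<lambda>k. c k * v k $ l"])
  qed auto
  show ?thesis
  proof (rule mat_eq_of_vec[OF p.E_carrier E_carrier])
    fix w :: "'a vec" assume "w \<in> carrier_vec (Suc d)"
    then obtain c where w: "w = comb c" using comb_ex by blast
    show "p.E i *\<^sub>v w = E (\<sigma> i) *\<^sub>v w"
      using p.E_comb[OF i, of "\<lambda>k. c (\<sigma> k)"] unfolding w E_comb[OF \<sigma>d[OF i]] comb[of c] .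
  qed
qed

end

lemma eigenbasis_of_associated:
  assumes A: "A \<in> carrier_mat (Suc d) (Suc d)" and \<theta>: "bij_betw \<theta> {0..d} {t. eigenvalue A t}"
  shows "\<exists>v. eigenbasis d A \<theta> v"
proof -
  have "\<forall>j\<in>{..d}. \<exists>v. eigenvector A v (\<theta> j)"
    using bij_betwE[OF \<theta>] by (auto simp: eigenvalue_def)
  then obtain v where v: "\<forall>j\<in>{..d}. eigenvector A (v j) (\<theta> j)" by metis
  have "eigenbasis d A \<theta> v"
    by unfold_locales (use A \<theta> v in \<open>auto simp: eigenvector_def bij_betw_def atLeast0AtMost\<close>)
  then show ?thesis by blast
qed

text \<open>The idempotent \<open>E i\<close> fixes an eigenvector for \<open>\<theta> i\<close>,
  while its image consists of vectors on which A acts as \<open>\<theta>' i\<close>.\<close>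

lemma associated_eigenvalues_unique:
  assumes A: "A \<in> carrier_mat (Suc d) (Suc d)"
    and 1: "associated_eigenvalues d A E \<theta>" and 2: "associated_eigenvalues d A E \<theta>'" and i: "i \<le> d"
  shows "\<theta> i = \<theta>' i"
proof -
  obtain v where "eigenbasis d A \<theta> v"
    using eigenbasis_of_associated[OF A] 1 unfolding associated_eigenvalues_def by blast
  then interpret a: eigenbasis d A \<theta> v .
  obtain v' where "eigenbasis d A \<theta>' v'"
    using eigenbasis_of_associated[OF A] 2 unfolding associated_eigenvalues_def by blast
  then interpret b: eigenbasis d A \<theta>' v' .
  have "E i = a.E i" "E i = b.E i" using 1 2 i unfolding associated_eigenvalues_def by blast+
  then have "a.E i = b.E i" by simp
  then have bv: "b.E i *\<^sub>v v i = v i" using a.E_v[OF i i] by simp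
  obtain c where c: "v i = b.comb c" using b.comb_ex a.v_carrier[OF i] by blast
  have vi: "v i = c i \<cdot>\<^sub>v v' i" using bv unfolding c b.E_comb[OF i] by simp
  have "\<theta> i \<cdot>\<^sub>v v i = \<theta>' i \<cdot>\<^sub>v v i"
  proof -
    have "A *\<^sub>v v i = c i \<cdot>\<^sub>v (\<theta>' i \<cdot>\<^sub>v v' i)"
      unfolding vi b.v_eigen[OF i, symmetric] by (rule mult_mat_vec[OF A b.v_carrier[OF i]])
    then show ?thesis
      unfolding a.v_eigen[OF i, symmetric] by (simp add: vi smult_smult_assoc mult.commute)
  qed
  then have "(\<theta> i - \<theta>' i) \<cdot>\<^sub>v v i = 0\<^sub>v (Suc d)"
  proof (intro carrier_vec_eqI[of _ d])
    fix l assume eq: "\<theta> i \<cdot>\<^sub>v v i = \<theta>' i \<cdot>\<^sub>v v i" and l: "l \<le> d"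
    from arg_cong[OF eq, of "\<lambda>w. w $ l"] show "((\<theta> i - \<theta>' i) \<cdot>\<^sub>v v i) $ l = 0\<^sub>v (Suc d) $ l"
      using a.v_carrier[OF i] l by (auto simp: algebra_simps)
  qed (use a.v_carrier[OF i] in auto)
  from a.v_smult_zero[OF i this] show ?thesis by simp
qed

lemma associated_eigenvalues_cong:
  assumes "\<And>i. i \<le> d \<Longrightarrow> \<theta> i = \<theta>' i" "associated_eigenvalues d A E \<theta>"
  shows "associated_eigenvalues d A E \<theta>'"
proof -
  have "bij_betw \<theta>' {0..d} {t. eigenvalue A t}"
    using assms bij_betw_cong[of "{0..d}" \<theta> \<theta>'] by (auto simp: associated_eigenvalues_def)
  then show ?thesis
    using assms primitive_idempotent_cong[of _ d \<theta> \<theta>' A] by (auto simp: associated_eigenvalues_def)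
qed

lemma sum_of_subspaces_cong:
  assumes "\<And>h. h \<in> S \<Longrightarrow> W h = W' h"
  shows "sum_of_subspaces d W S = sum_of_subspaces d W' S"
proof -
  have "(\<forall>h\<in>S. w h \<in> W h) = (\<forall>h\<in>S. w h \<in> W' h)" for w using assms by auto
  then show ?thesis by (simp only: sum_of_subspaces_def)
qed

lemma split_space_cong:
  assumes "\<And>h. h \<le> d \<Longrightarrow> E h = E' h" "\<And>h. h \<le> d \<Longrightarrow> Es h = Es' h" "i \<le> d"
  shows "split_space d E Es i = split_space d E' Es' i"
proof -
  have "sum_of_subspaces d (\<lambda>h. image_space d (Es h)) {0..i} = sum_of_subspaces d (\<lambda>h. image_space d (Es' h)) {0..i}"
    by (rule sum_of_subspaces_cong) (use assms in auto)
  moreover have "sum_of_subspaces d (\<lambda>h. image_space d (E h)) {i..d} = sum_of_subspaces d (\<lambda>h. image_space d (E' h)) {i..d}"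
    by (rule sum_of_subspaces_cong) (use assms in auto)
  ultimately show ?thesis by (simp only: split_space_def)
qed

text \<open>The eigenvalue sequences are existentially quantified in the definition, but the
  idempotents determine them. Both scalars then describe the same operator on one nonzero vector of
  the split space.\<close>

lemma first_split_sequence_unique:
  assumes A: "A \<in> carrier_mat (Suc d) (Suc d)" and As: "As \<in> carrier_mat (Suc d) (Suc d)"
    and 1: "first_split_sequence d A As E Es \<phi>" and 2: "first_split_sequence d A As E Es \<phi>'"
    and i: "i \<in> {1..d}"
  shows "\<phi> i = \<phi>' i"
proof -
  obtain \<theta> \<theta>s where a: "associated_eigenvalues d A E \<theta>" "associated_eigenvalues d As Es \<theta>s"
    and a': "\<forall>i\<in>{1..d}. (\<exists>u\<in>split_space d E Es i. u \<noteq> 0\<^sub>v (d+1)) \<and> (\<forall>u\<in>split_space d E Es i.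
       ((A - \<theta> (i-1) \<cdot>\<^sub>m 1\<^sub>m (d+1)) * (As - \<theta>s i \<cdot>\<^sub>m 1\<^sub>m (d+1))) *\<^sub>v u = \<phi> i \<cdot>\<^sub>v u)"
    using 1 unfolding first_split_sequence_def by (elim exE conjE) (rule that)
  obtain \<theta>' \<theta>s' where b: "associated_eigenvalues d A E \<theta>'" "associated_eigenvalues d As Es \<theta>s'"
    and b': "\<forall>i\<in>{1..d}. (\<exists>u\<in>split_space d E Es i. u \<noteq> 0\<^sub>v (d+1)) \<and> (\<forall>u\<in>split_space d E Es i.
       ((A - \<theta>' (i-1) \<cdot>\<^sub>m 1\<^sub>m (d+1)) * (As - \<theta>s' i \<cdot>\<^sub>m 1\<^sub>m (d+1))) *\<^sub>v u = \<phi>' i \<cdot>\<^sub>v u)"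
    using 2 unfolding first_split_sequence_def by (elim exE conjE) (rule that)
  have \<theta>: "\<theta> (i-1) = \<theta>' (i-1)"
    using associated_eigenvalues_unique[OF A a(1) b(1), of "i - 1"] i by auto
  have \<theta>s: "\<theta>s i = \<theta>s' i" using associated_eigenvalues_unique[OF As a(2) b(2), of i] i by auto
  obtain u where u: "u \<in> split_space d E Es i" "u \<noteq> 0\<^sub>v (Suc d)"
    using bspec[OF a' i] by auto
  have eq: "\<phi> i \<cdot>\<^sub>v u = \<phi>' i \<cdot>\<^sub>v u"
    using bspec[OF conjunct2[OF bspec[OF a' i]] u(1)] bspec[OF conjunct2[OF bspec[OF b' i]] u(1)]
    unfolding \<theta> \<theta>s by (rule trans[OF sym])
  obtain v where "eigenbasis d A \<theta> v"
    using eigenbasis_of_associated[OF A] a(1) unfolding associated_eigenvalues_def by blast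
  then interpret e: eigenbasis d A \<theta> v .
  have E: "E h = e.E h" if "h \<le> d" for h using that a(1) by (simp add: associated_eigenvalues_def)
  have "u \<in> split_space d e.E Es i"
    using u(1) split_space_cong[of d E e.E Es Es i] E i by auto
  then have uc: "u \<in> carrier_vec (Suc d)"
    using e.sum_of_images[of "{i..d}"] by (auto simp: split_space_def)
  have "\<exists>l\<le>d. u $ l \<noteq> 0"
  proof (rule ccontr)
    assume "\<not> (\<exists>l\<le>d. u $ l \<noteq> 0)"
    then have "u = 0\<^sub>v (Suc d)" using uc by (intro carrier_vec_eqI[of _ d]) auto
    then show False using u(2) by simp
  qed
  then obtain l where l: "l \<le> d" "u $ l \<noteq> 0" by blast
  have "\<phi> i * u $ l = \<phi>' i * u $ l" using arg_cong[OF eq, of "\<lambda>w. w $ l"] uc l by auto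
  then show ?thesis using l by simp
qed

lemma bij_betw_flip: "bij_betw (\<lambda>k. d - k) {..d} {..d::nat}"
  by (rule bij_betwI[of _ _ _ "\<lambda>k. d - k"]) auto

lemma associated_eigenvalues_rev:
  assumes A: "A \<in> carrier_mat (Suc d) (Suc d)" and E: "associated_eigenvalues d A E \<theta>"
  shows "associated_eigenvalues d A (\<lambda>i. E (d - i)) (\<lambda>i. \<theta> (d - i))"
proof -
  obtain v where "eigenbasis d A \<theta> v"
    using eigenbasis_of_associated[OF A] E unfolding associated_eigenvalues_def by blast
  then interpret e: eigenbasis d A \<theta> v .
  have "bij_betw (\<lambda>i. \<theta> (d - i)) {0..d} {t. eigenvalue A t}"
    using bij_betw_trans[OF bij_betw_flip, of \<theta>] E
    by (simp add: associated_eigenvalues_def atLeast0AtMost o_def)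
  moreover have "E (d - i) = primitive_idempotent d A (\<lambda>i. \<theta> (d - i)) i" if "i \<le> d" for i
    using E e.primitive_idempotent_permute[OF bij_betw_flip that] by (simp add: associated_eigenvalues_def)
  ultimately show ?thesis by (simp add: associated_eigenvalues_def)
qed

section \<open>The Leonard system of a split matrix\<close>

lemma eigenbasis_unit_vec:
  fixes As :: "'a::field mat"
  assumes As_carrier: "As \<in> carrier_mat (Suc d) (Suc d)"
    and As_entry: "\<And>i j. i \<le> d \<Longrightarrow> j \<le> d \<Longrightarrow> As $$ (i,j) = (if i = j then s i else 0)"
    and s_inj: "inj_on s {..d}"
  shows "eigenbasis d As s (unit_vec (Suc d))"
proof
  show "As \<in> carrier_mat (Suc d) (Suc d)" using As_carrier by simp
  show "inj_on s {..d}" by (rule s_inj)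
  fix j assume j: "j \<le> d"
  show "unit_vec (Suc d) j \<in> carrier_vec (Suc d)" by simp
  show "unit_vec (Suc d) j \<noteq> (0\<^sub>v (Suc d) :: 'a vec)"
    using j by (metis index_unit_vec(1) index_zero_vec(1) Suc_eq_plus1 le_imp_less_Suc zero_neq_one)
  show "As *\<^sub>v unit_vec (Suc d) j = s j \<cdot>\<^sub>v unit_vec (Suc d) j"
  proof (rule carrier_vec_eqI)
    fix i assume i: "i \<le> d"
    have "(As *\<^sub>v unit_vec (Suc d) j) $ i = (\<Sum>k\<le>d. As $$ (i,k) * unit_vec (Suc d) j $ k)"
      by (rule mult_vec_index[OF As_carrier _ i]) simp
    also have "\<dots> = (\<Sum>k\<le>d. if k = j then (if i = j then s i else 0) else 0)"
      by (rule sum.cong) (use i j in \<open>auto simp: As_entry\<close>)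
    also have "\<dots> = (s j \<cdot>\<^sub>v unit_vec (Suc d) j) $ i" using i j by auto
    finally show "(As *\<^sub>v unit_vec (Suc d) j) $ i = (s j \<cdot>\<^sub>v unit_vec (Suc d) j) $ i" .
  qed (use mult_mat_vec_carrier[OF As_carrier] in auto)
qed

lemma diagonal_idempotent_product_zero_iff:
  fixes As N :: "'a::field mat"
  assumes "eigenbasis d As s (unit_vec (Suc d))" and N_carrier: "N \<in> carrier_mat (Suc d) (Suc d)"
    and ij: "i \<le> d" "j \<le> d"
  shows "primitive_idempotent d As s i * N * primitive_idempotent d As s j = 0\<^sub>m (Suc d) (Suc d)
    \<longleftrightarrow> N $$ (i,j) = 0"
proof -
  interpret eigenbasis d As s "unit_vec (Suc d)" by fact
  have "N *\<^sub>v unit_vec (Suc d) j = comb (\<lambda>i. N $$ (i,j))"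
  proof (rule carrier_vec_eqI)
    fix i assume i: "i \<le> d"
    have "(N *\<^sub>v unit_vec (Suc d) j) $ i = (\<Sum>k\<le>d. N $$ (i,k) * unit_vec (Suc d) j $ k)"
      by (rule mult_vec_index[OF N_carrier _ i]) simp
    also have "\<dots> = (\<Sum>k\<le>d. if k = j then N $$ (i,j) else 0)"
      by (rule sum.cong) (use i ij in auto)
    also have "\<dots> = (\<Sum>k\<le>d. if k = i then N $$ (i,j) else 0)" using i ij by simp
    also have "\<dots> = comb (\<lambda>i. N $$ (i,j)) $ i"
      unfolding comb_index[OF i] by (rule sum.cong) (use i in auto)
    finally show "(N *\<^sub>v unit_vec (Suc d) j) $ i = comb (\<lambda>i. N $$ (i,j)) $ i" .
  qed (use mult_mat_vec_carrier[OF N_carrier] in auto)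
  then show ?thesis by (rule idempotent_product_zero_iff[OF N_carrier ij])
qed

section \<open>Eigenvectors as orthogonal polynomials on the nodes\<close>

locale split_matrix = tridiagonal_action d "\<lambda>i j. A $$ (i,j)" s \<theta> \<phi>
  for d and A :: "'a::field mat" and s \<theta> \<phi> +
  fixes As :: "'a mat"
  assumes A_carrier: "A \<in> carrier_mat (Suc d) (Suc d)"
    and As_carrier: "As \<in> carrier_mat (Suc d) (Suc d)"
    and As_entry: "i \<le> d \<Longrightarrow> j \<le> d \<Longrightarrow> As $$ (i,j) = (if i = j then s i else 0)"
    and \<theta>_inj: "inj_on \<theta> {..d}"
    and super_nonzero: "i < d \<Longrightarrow> A $$ (i, Suc i) \<noteq> 0"
    and sub_nonzero: "i < d \<Longrightarrow> A $$ (Suc i, i) \<noteq> 0"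
begin

lemma \<theta>_neq: "i \<le> d \<Longrightarrow> j \<le> d \<Longrightarrow> i \<noteq> j \<Longrightarrow> \<theta> i \<noteq> \<theta> j"
  using \<theta>_inj by (auto simp: inj_on_def)

lemma \<phi>_nonzero: "n < d \<Longrightarrow> \<phi> (Suc n) \<noteq> 0"
  using super_entry[of n] super_nonzero[of n] node_nonzero[of "Suc n" "Suc n"] by auto

lemma \<psi>_nonzero: assumes "n < d" shows "\<psi> (Suc n) \<noteq> 0"
proof -
  interpret rev: tridiagonal_action d "\<lambda>i j. A $$ (d - i, d - j)" s_rev \<theta> \<psi> by (rule rev_action)
  have "A $$ (Suc (d - Suc n), d - Suc n) \<noteq> 0" using assms by (intro sub_nonzero) simp
  moreover have "Suc (d - Suc n) = d - n" using assms by simp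
  ultimately show ?thesis
    using rev.super_entry[of n] rev.node_nonzero[of "Suc n" "Suc n"] assms by auto
qed

text \<open>In Newton coordinates the eigenvalue equation becomes \<open>eigencoeff j (n + 1) *
  \<phi> (n + 1) = eigencoeff j n * (\<theta> j - \<theta> n)\<close>; this is the solution with
  first coefficient 1. The factor with k = j ends the expansion at degree j.\<close>

definition eigencoeff :: "nat \<Rightarrow> nat \<Rightarrow> 'a" where
  "eigencoeff j n = (\<Prod>k<n. (\<theta> j - \<theta> k) / \<phi> (Suc k))"

definition eigenpoly :: "nat \<Rightarrow> 'a poly" where
  "eigenpoly j = (\<Sum>n\<le>j. smult (eigencoeff j n) (node_poly s n))"

definition eigenvec :: "nat \<Rightarrow> 'a vec" where
  "eigenvec j = vec (Suc d) (\<lambda>i. poly (eigenpoly j) (s i))"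

lemma eigencoeff_nonzero: assumes "j \<le> d" shows "eigencoeff j j \<noteq> 0"
  unfolding eigencoeff_def using assms \<theta>_neq[of j] \<phi>_nonzero by auto

lemma degree_eigenpoly: "degree (eigenpoly j) \<le> j"
  unfolding eigenpoly_def by (intro degree_sum_le) (auto intro!: order.trans[OF degree_smult_le])

lemma coeff_eigenpoly: "coeff (eigenpoly j) j = eigencoeff j j"
proof -
  have "coeff (eigenpoly j) j = (\<Sum>n\<le>j. if n = j then eigencoeff j j else 0)"
    unfolding eigenpoly_def coeff_sum
    by (rule sum.cong) (auto simp: coeff_eq_0)
  then show ?thesis by simp
qed

lemma eigenpoly_at_0: "poly (eigenpoly j) (s 0) = 1"
proof -
  have "poly (eigenpoly j) (s 0) = (\<Sum>n\<le>j. if n = 0 then 1 else 0)"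
    unfolding eigenpoly_def poly_sum
    by (rule sum.cong) (auto simp: poly_node_poly_zero eigencoeff_def)
  then show ?thesis by simp
qed

lemma act_eigenpoly:
  assumes "j \<le> d" "i \<le> d"
  shows "(\<Sum>k\<le>d. A $$ (i,k) * poly (eigenpoly j) (s k)) = \<theta> j * poly (eigenpoly j) (s i)"
proof -
  define t where "t n = poly (node_poly s n)" for n
  \<comment> \<open>Each partial sum is an eigenvector up to a single boundary term, which vanishes
    at m = j.\<close>
  have "(\<Sum>k\<le>d. A $$ (i,k) * (\<Sum>n\<le>m. eigencoeff j n * t n (s k)))
    = \<theta> j * (\<Sum>n\<le>m. eigencoeff j n * t n (s i)) - eigencoeff j m * (\<theta> j - \<theta> m) * t m (s i)"
    if "m \<le> d" for m
    using that
  proof (induction m)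
    case 0
    then show ?case using act[of 0 i] assms
      by (simp add: eigencoeff_def t_def \<phi>_0)
  next
    case (Suc m)
    have c: "eigencoeff j (Suc m) * \<phi> (Suc m) = eigencoeff j m * (\<theta> j - \<theta> m)"
      using \<phi>_nonzero[of m] Suc.prems by (simp add: eigencoeff_def)
    have "(\<Sum>k\<le>d. A $$ (i,k) * (\<Sum>n\<le>Suc m. eigencoeff j n * t n (s k)))
      = (\<Sum>k\<le>d. A $$ (i,k) * (\<Sum>n\<le>m. eigencoeff j n * t n (s k)))
        + eigencoeff j (Suc m) * (\<Sum>k\<le>d. A $$ (i,k) * t (Suc m) (s k))"
      by (simp add: sum.distrib sum_distrib_left algebra_simps)
    also have "(\<Sum>k\<le>d. A $$ (i,k) * t (Suc m) (s k)) = \<theta> (Suc m) * t (Suc m) (s i) + \<phi> (Suc m) * t m (s i)"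
      using act[OF Suc.prems assms(2)] by (simp add: t_def)
    also have "(\<Sum>k\<le>d. A $$ (i,k) * (\<Sum>n\<le>m. eigencoeff j n * t n (s k)))
      = \<theta> j * (\<Sum>n\<le>m. eigencoeff j n * t n (s i)) - eigencoeff j m * (\<theta> j - \<theta> m) * t m (s i)"
      using Suc by simp
    finally show ?case unfolding c[symmetric] by (simp add: algebra_simps)
  qed
  from this[OF assms(1)] show ?thesis by (simp add: eigenpoly_def poly_sum t_def)
qed

sublocale eig: eigenbasis d A \<theta> eigenvec
proof
  show "A \<in> carrier_mat (Suc d) (Suc d)" using A_carrier by simp
  show "inj_on \<theta> {..d}" by (rule \<theta>_inj)
  fix j assume j: "j \<le> d"
  show "eigenvec j \<in> carrier_vec (Suc d)" by (simp add: eigenvec_def)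
  then have c: "eigenvec j \<in> carrier_vec (Suc d)" by simp
  have "eigenvec j $ 0 = 1" using eigenpoly_at_0 by (simp add: eigenvec_def)
  then show "eigenvec j \<noteq> 0\<^sub>v (Suc d)" by auto
  show "A *\<^sub>v eigenvec j = \<theta> j \<cdot>\<^sub>v eigenvec j"
  proof (rule carrier_vec_eqI)
    fix i assume i: "i \<le> d"
    have "(A *\<^sub>v eigenvec j) $ i = (\<Sum>k\<le>d. A $$ (i,k) * poly (eigenpoly j) (s k))"
      unfolding mult_vec_index[OF A_carrier c i] by (rule sum.cong) (auto simp: eigenvec_def)
    then show "(A *\<^sub>v eigenvec j) $ i = (\<theta> j \<cdot>\<^sub>v eigenvec j) $ i"
      unfolding act_eigenpoly[OF j i] using i by (simp add: eigenvec_def)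
  qed (use c mult_mat_vec_carrier[OF A_carrier c] in auto)
qed

sublocale dual: eigenbasis d As s "unit_vec (Suc d)"
  by (rule eigenbasis_unit_vec[OF As_carrier As_entry s_inj])

lemma dual_idempotent: "idempotent_sequence d As A dual.E"
  unfolding idempotent_sequence_def
proof (intro conjI exI allI impI)
  show "associated_eigenvalues d As dual.E s" by (rule dual.associated)
  fix i j assume ij: "i \<le> d" "j \<le> d"
  note iff = diagonal_idempotent_product_zero_iff[OF dual.eigenbasis_axioms A_carrier ij]
  show "dual.E i * A * dual.E j = 0\<^sub>m (d+1) (d+1)" if gap: "\<bar>int i - int j\<bar> > 1"
  proof -
    consider "j + 1 < i" | "i + 1 < j" using gap by linarith
    then have "A $$ (i,j) = 0" using ij lower_zero upper_zero by cases auto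
    then show ?thesis using iff by simp
  qed
  show "dual.E i * A * dual.E j \<noteq> 0\<^sub>m (d+1) (d+1)" if gap: "\<bar>int i - int j\<bar> = 1"
  proof -
    consider "i = Suc j" | "j = Suc i" using gap by linarith
    then have "A $$ (i,j) \<noteq> 0" using ij super_nonzero sub_nonzero by cases auto
    then show ?thesis using iff by simp
  qed
qed

text \<open>The weights symmetrize the irreducible tridiagonal matrix, so that \<open>A\<close> is self-adjoint for
  the associated bilinear form.\<close>

definition weight :: "nat \<Rightarrow> 'a" where
  "weight i = (\<Prod>h<i. A $$ (h, Suc h) / A $$ (Suc h, h))"

lemma weight_nonzero: "i \<le> d \<Longrightarrow> weight i \<noteq> 0"
  unfolding weight_def using super_nonzero sub_nonzero by auto

lemma weight_sym: "i \<le> d \<Longrightarrow> j \<le> d \<Longrightarrow> weight i * A $$ (i,j) = weight j * A $$ (j,i)"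
proof -
  have step: "weight i * A $$ (i, Suc i) = weight (Suc i) * A $$ (Suc i, i)" if "i < d" for i
    using sub_nonzero[OF that] by (simp add: weight_def)
  assume ij: "i \<le> d" "j \<le> d"
  consider "j + 1 < i" | "i = Suc j" | "i = j" | "j = Suc i" | "i + 1 < j" by linarith
  then show ?thesis
    using ij step[of i] step[of j] lower_zero[of i j] lower_zero[of j i] upper_zero[of i j] upper_zero[of j i]
    by cases auto
qed

definition form :: "(nat \<Rightarrow> 'a) \<Rightarrow> (nat \<Rightarrow> 'a) \<Rightarrow> 'a" where
  "form f g = (\<Sum>i\<le>d. weight i * f i * g i)"

lemma form_commute: "form f g = form g f"
  unfolding form_def by (rule sum.cong) auto

lemma form_self_adjoint:
  "form f (\<lambda>i. \<Sum>j\<le>d. A $$ (i,j) * g j) = form (\<lambda>i. \<Sum>j\<le>d. A $$ (i,j) * f j) g"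
proof -
  have "form f (\<lambda>i. \<Sum>j\<le>d. A $$ (i,j) * g j) = (\<Sum>i\<le>d. \<Sum>j\<le>d. (weight i * A $$ (i,j)) * f i * g j)"
    unfolding form_def by (simp add: sum_distrib_left algebra_simps)
  also have "\<dots> = (\<Sum>i\<le>d. \<Sum>j\<le>d. (weight j * A $$ (j,i)) * f i * g j)"
    by (intro sum.cong refl) (simp add: weight_sym)
  also have "\<dots> = (\<Sum>j\<le>d. \<Sum>i\<le>d. (weight j * A $$ (j,i)) * f i * g j)"
    by (rule sum.swap)
  also have "\<dots> = form (\<lambda>i. \<Sum>j\<le>d. A $$ (i,j) * f j) g"
    unfolding form_def by (simp add: sum_distrib_left sum_distrib_right algebra_simps)
  finally show ?thesis .
qed

lemma form_cong: "(\<And>i. i \<le> d \<Longrightarrow> f i = f' i) \<Longrightarrow> (\<And>i. i \<le> d \<Longrightarrow> g i = g' i) \<Longrightarrow> form f g = form f' g'"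
  unfolding form_def by (rule sum.cong) auto

lemma form_smult: "form f (\<lambda>i. c * g i) = c * form f g" "form (\<lambda>i. c * f i) g = c * form f g"
  unfolding form_def sum_distrib_left by (auto intro!: sum.cong)

lemma form_sum: "form f (\<lambda>i. \<Sum>k\<in>K. g k i) = (\<Sum>k\<in>K. form f (g k))"
proof -
  have "form f (\<lambda>i. \<Sum>k\<in>K. g k i) = (\<Sum>i\<le>d. \<Sum>k\<in>K. weight i * f i * g k i)"
    by (simp add: form_def sum_distrib_left)
  also have "\<dots> = (\<Sum>k\<in>K. form f (g k))" unfolding form_def by (rule sum.swap)
  finally show ?thesis .
qed

text \<open>Nondegeneracy of the form: the pairings with the Newton basis determine
  \<open>weight i * g i\<close>, and the weights are nonzero.\<close>

lemma form_zero_imp: "(\<And>n. n \<le> d \<Longrightarrow> form (\<lambda>i. poly (node_poly s n) (s i)) g = 0) \<Longrightarrow> i \<le> d \<Longrightarrow> g i = 0"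
proof -
  assume z: "\<And>n. n \<le> d \<Longrightarrow> form (\<lambda>i. poly (node_poly s n) (s i)) g = 0" and i: "i \<le> d"
  have "weight i * g i = 0"
  proof (rule node_functional_zero[OF s_inj, where m = 0 and f = "\<lambda>i. weight i * g i"])
    fix n assume "n \<le> d"
    then show "(\<Sum>j\<le>d. weight j * g j * poly (node_poly s n) (s j)) = 0"
      using z[of n] by (simp add: form_def algebra_simps)
  qed (use i in auto)
  then show ?thesis using weight_nonzero[OF i] by simp
qed

abbreviation ev :: "nat \<Rightarrow> nat \<Rightarrow> 'a" where "ev j \<equiv> \<lambda>i. poly (eigenpoly j) (s i)"

lemma form_ev_neq: assumes "i \<le> d" "j \<le> d" "i \<noteq> j" shows "form (ev i) (ev j) = 0"
proof -
  have "\<theta> j * form (ev i) (ev j) = form (ev i) (\<lambda>l. \<Sum>k\<le>d. A $$ (l,k) * ev j k)"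
    unfolding form_smult(1)[symmetric] by (rule form_cong) (use act_eigenpoly[OF assms(2)] in auto)
  also have "\<dots> = form (\<lambda>l. \<Sum>k\<le>d. A $$ (l,k) * ev i k) (ev j)" by (rule form_self_adjoint)
  also have "\<dots> = \<theta> i * form (ev i) (ev j)"
    unfolding form_smult(2)[symmetric] by (rule form_cong) (use act_eigenpoly[OF assms(1)] in auto)
  finally show ?thesis using \<theta>_neq[OF assms] by simp
qed

lemma poly_expand:
  assumes "degree p \<le> n" "n \<le> d"
  shows "\<exists>c. p = (\<Sum>k\<le>n. smult (c k) (eigenpoly k))"
  using assms by (intro poly_basis_expand) (auto simp: degree_eigenpoly coeff_eigenpoly eigencoeff_nonzero)

lemma form_ev_expand:
  assumes "i \<le> d" "n \<le> d" "p = (\<Sum>k\<le>n. smult (c k) (eigenpoly k))"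
  shows "form (ev i) (\<lambda>l. poly p (s l)) = (if i \<le> n then c i * form (ev i) (ev i) else 0)"
proof -
  have "form (ev i) (\<lambda>l. poly p (s l)) = (\<Sum>k\<le>n. c k * form (ev i) (ev k))"
    unfolding assms(3) poly_sum form_sum poly_smult form_smult ..
  also have "\<dots> = (\<Sum>k\<le>n. if k = i then c i * form (ev i) (ev i) else 0)"
    by (rule sum.cong) (use assms form_ev_neq[of i] in auto)
  finally show ?thesis by auto
qed

lemma form_ev_low_degree:
  assumes "i \<le> d" "degree p < i" shows "form (ev i) (\<lambda>l. poly p (s l)) = 0"
proof -
  obtain c where "p = (\<Sum>k\<le>degree p. smult (c k) (eigenpoly k))"
    using poly_expand[of p "degree p"] assms by auto
  from form_ev_expand[OF assms(1) _ this] show ?thesis using assms by simp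
qed

text \<open>An isotropic eigenvector would be orthogonal to itself and to all the others, hence to
  every Newton polynomial. Nondegeneracy would make it zero, but its value at node 0 is 1.\<close>

lemma form_ev_self: assumes "j \<le> d" shows "form (ev j) (ev j) \<noteq> 0"
proof
  assume 0: "form (ev j) (ev j) = 0"
  have "ev j 0 = 0"
  proof (rule form_zero_imp)
    fix n assume n: "n \<le> d"
    then obtain c where c: "node_poly s n = (\<Sum>k\<le>n. smult (c k) (eigenpoly k))"
      using poly_expand[of "node_poly s n" n] by auto
    show "form (\<lambda>i. poly (node_poly s n) (s i)) (ev j) = 0"
      using form_ev_expand[OF assms n c] 0 by (simp add: form_commute)
  qed simp
  then show False using eigenpoly_at_0 by simp
qed

text \<open>Multiplication by x raises the degree by at most one, and \<open>ev i\<close> is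
  orthogonal to all polynomials of lower degree.\<close>

lemma form_shift_low: "i \<le> d \<Longrightarrow> j + 1 < i \<Longrightarrow> form (ev i) (\<lambda>l. s l * ev j l) = 0"
proof -
  assume i: "i \<le> d" "j + 1 < i"
  have "degree ([:0, 1:] * eigenpoly j) \<le> j + 1"
    using degree_mult_le[of "[:0, 1:]" "eigenpoly j"] degree_eigenpoly[of j] by simp
  then have "degree ([:0, 1:] * eigenpoly j) < i" using i by linarith
  from form_ev_low_degree[OF i(1) this] show ?thesis by (simp only: poly_mult) simp
qed

text \<open>Multiplication by x preserves the leading coefficient, so the expansion of x times the
  j-th eigenpolynomial has a nonzero component of index j + 1.\<close>

lemma form_shift_Suc: assumes "Suc j \<le> d" shows "form (ev (Suc j)) (\<lambda>l. s l * ev j l) \<noteq> 0"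
proof -
  let ?p = "[:0, 1:] * eigenpoly j"
  have "degree ?p \<le> Suc j"
    using degree_mult_le[of "[:0, 1:]" "eigenpoly j"] degree_eigenpoly[of j] by simp
  then obtain c where c: "?p = (\<Sum>k\<le>Suc j. smult (c k) (eigenpoly k))"
    using poly_expand[of ?p "Suc j"] assms by auto
  have "eigencoeff j j = coeff ?p (Suc j)" by (simp add: coeff_eigenpoly)
  also have "\<dots> = (\<Sum>k\<le>Suc j. c k * coeff (eigenpoly k) (Suc j))"
    unfolding c coeff_sum by simp
  also have "\<dots> = (\<Sum>k\<le>Suc j. if k = Suc j then c k * eigencoeff k k else 0)"
  proof (rule sum.cong[OF refl])
    fix k assume k: "k \<in> {..Suc j}"
    show "c k * coeff (eigenpoly k) (Suc j) = (if k = Suc j then c k * eigencoeff k k else 0)"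
    proof (cases "k = Suc j")
      case True
      then show ?thesis by (simp add: coeff_eigenpoly)
    next
      case False
      then have "degree (eigenpoly k) < Suc j" using degree_eigenpoly[of k] k by auto
      then show ?thesis using False by (simp add: coeff_eq_0)
    qed
  qed
  finally have "c (Suc j) \<noteq> 0" using eigencoeff_nonzero[of j] assms by auto
  moreover have "form (ev (Suc j)) (\<lambda>l. poly ?p (s l)) = c (Suc j) * form (ev (Suc j)) (ev (Suc j))"
    using form_ev_expand[OF assms assms c] by simp
  ultimately show ?thesis using form_ev_self[OF assms] by (simp only: poly_mult) simp
qed

lemma form_shift_commute: "form f (\<lambda>l. s l * g l) = form g (\<lambda>l. s l * f l)"
  unfolding form_def by (rule sum.cong) auto

text \<open>By \<open>idempotent_product_zero_iff\<close> the claim concerns the entries of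
  \<open>As\<close> in the eigenbasis, which the form reads off. Multiplication by the nodes is
  symmetric for the form, so the pattern proved on one side of the diagonal holds on the
  other.\<close>

lemma idempotent: "idempotent_sequence d A As eig.E"
  unfolding idempotent_sequence_def
proof (intro conjI exI allI impI)
  show "associated_eigenvalues d A eig.E \<theta>" by (rule eig.associated)
  fix i j assume ij: "i \<le> d" "j \<le> d"
  have Asv: "As *\<^sub>v eigenvec j \<in> carrier_vec (Suc d)"
    using mult_mat_vec_carrier[OF As_carrier] by (simp add: eigenvec_def)
  then obtain b where b: "As *\<^sub>v eigenvec j = eig.comb b" using eig.comb_ex by blast
  have "(\<Sum>k\<le>d. b k * ev k l) = s l * ev j l" if l: "l \<le> d" for l
  proof -
    have "(As *\<^sub>v eigenvec j) $ l = (\<Sum>k\<le>d. As $$ (l,k) * eigenvec j $ k)"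
      by (rule mult_vec_index[OF As_carrier _ l]) (simp add: eigenvec_def)
    also have "\<dots> = (\<Sum>k\<le>d. if k = l then s l * ev j l else 0)"
      by (rule sum.cong) (use l in \<open>auto simp: As_entry eigenvec_def\<close>)
    finally have "(As *\<^sub>v eigenvec j) $ l = s l * ev j l" using l by simp
    moreover have "eig.comb b $ l = (\<Sum>k\<le>d. b k * ev k l)"
      unfolding eig.comb_index[OF l] by (rule sum.cong) (use l in \<open>auto simp: eigenvec_def\<close>)
    ultimately show ?thesis using b by simp
  qed
  then have "form (ev i) (\<lambda>l. s l * ev j l) = form (ev i) (\<lambda>l. \<Sum>k\<le>d. b k * ev k l)"
    by (intro form_cong) auto
  also have "\<dots> = (\<Sum>k\<le>d. b k * form (ev i) (ev k))"
    unfolding form_sum form_smult ..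
  also have "\<dots> = (\<Sum>k\<le>d. if k = i then b i * form (ev i) (ev i) else 0)"
    by (rule sum.cong) (use ij form_ev_neq[of i] in auto)
  finally have bi: "form (ev i) (\<lambda>l. s l * ev j l) = b i * form (ev i) (ev i)" using ij by simp
  have iff: "eig.E i * As * eig.E j = 0\<^sub>m (Suc d) (Suc d) \<longleftrightarrow> form (ev i) (\<lambda>l. s l * ev j l) = 0"
    unfolding bi using eig.idempotent_product_zero_iff[OF As_carrier ij b] form_ev_self[OF ij(1)] by simp
  show "eig.E i * As * eig.E j = 0\<^sub>m (d+1) (d+1)" if gap: "\<bar>int i - int j\<bar> > 1"
  proof -
    consider "j + 1 < i" | "i + 1 < j" using gap by linarith
    then have "form (ev i) (\<lambda>l. s l * ev j l) = 0"
      using ij form_shift_low[of i j] form_shift_low[of j i] form_shift_commute[of "ev i"]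
      by cases auto
    then show ?thesis using iff by simp
  qed
  show "eig.E i * As * eig.E j \<noteq> 0\<^sub>m (d+1) (d+1)" if gap: "\<bar>int i - int j\<bar> = 1"
  proof -
    consider "i = Suc j" | "j = Suc i" using gap by linarith
    then have "form (ev i) (\<lambda>l. s l * ev j l) \<noteq> 0"
      using ij form_shift_Suc[of i] form_shift_Suc[of j] form_shift_commute[of "ev i"]
      by cases auto
    then show ?thesis using iff by simp
  qed
qed

end

section \<open>Split sequences\<close>

definition scalar_array_of :: "nat \<Rightarrow> (nat \<Rightarrow> 'a) \<Rightarrow> (nat \<Rightarrow> 'a) \<Rightarrow> (nat \<Rightarrow> 'a) \<Rightarrow> (nat \<Rightarrow> 'a) \<Rightarrow> 'a scalar_array" where
  "scalar_array_of d \<theta> \<theta>s \<phi>1 \<phi>2 = \<lparr>eig = restrict \<theta> {0..d}, dual_eig = restrict \<theta>s {0..d},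
    split1 = restrict \<phi>1 {1..d}, split2 = restrict \<phi>2 {1..d}\<rparr>"

context split_matrix begin

lemma dual_E_zero_iff:
  assumes u: "u \<in> carrier_vec (Suc d)" and k: "k \<le> d"
  shows "dual.E k *\<^sub>v u = 0\<^sub>v (Suc d) \<longleftrightarrow> u $ k = 0"
proof -
  have "u = dual.comb (\<lambda>k. u $ k)"
  proof (rule carrier_vec_eqI[OF u])
    fix i assume i: "i \<le> d"
    have "dual.comb (\<lambda>k. u $ k) $ i = (\<Sum>k\<le>d. if k = i then u $ i else 0)"
      unfolding dual.comb_index[OF i] by (rule sum.cong) (use i in auto)
    then show "u $ i = dual.comb (\<lambda>k. u $ k) $ i" using i by simp
  qed simp
  then have "dual.E k *\<^sub>v u = u $ k \<cdot>\<^sub>v unit_vec (Suc d) k"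
    using dual.E_comb[OF k, of "\<lambda>k. u $ k"] by simp
  then show ?thesis using dual.v_smult_zero[OF k] by auto
qed

text \<open>Eigenvectors are orthogonal with nonzero norms, so the form against \<open>ev k\<close>
  reads off the k-th coordinate.\<close>

lemma eig_E_zero_iff:
  assumes u: "u \<in> carrier_vec (Suc d)" and k: "k \<le> d"
  shows "eig.E k *\<^sub>v u = 0\<^sub>v (Suc d) \<longleftrightarrow> form (ev k) (\<lambda>l. u $ l) = 0"
proof -
  obtain c where c: "u = eig.comb c" using eig.comb_ex[OF u] by blast
  have "form (ev k) (\<lambda>l. u $ l) = form (ev k) (\<lambda>l. \<Sum>i\<le>d. c i * ev i l)"
  proof (rule form_cong[OF refl])
    fix l assume l: "l \<le> d"
    show "u $ l = (\<Sum>i\<le>d. c i * ev i l)"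
      unfolding c eig.comb_index[OF l] by (rule sum.cong) (use l in \<open>auto simp: eigenvec_def\<close>)
  qed
  also have "\<dots> = (\<Sum>i\<le>d. c i * form (ev k) (ev i))" unfolding form_sum form_smult ..
  also have "\<dots> = (\<Sum>i\<le>d. if i = k then c k * form (ev k) (ev k) else 0)"
    by (rule sum.cong) (use k form_ev_neq[of k] in auto)
  finally have "form (ev k) (\<lambda>l. u $ l) = c k * form (ev k) (ev k)" using k by simp
  moreover have "eig.E k *\<^sub>v u = c k \<cdot>\<^sub>v eigenvec k" unfolding c by (rule eig.E_comb[OF k])
  moreover have "0 \<cdot>\<^sub>v eigenvec k = 0\<^sub>v (Suc d)" using eig.v_carrier[OF k] by auto
  ultimately show ?thesis using eig.v_smult_zero[OF k] form_ev_self[OF k] by auto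
qed

lemma shifted_product_index:
  assumes u: "u \<in> carrier_vec (Suc d)" and l: "l \<le> d"
  shows "(((A - x \<cdot>\<^sub>m 1\<^sub>m (Suc d)) * (As - y \<cdot>\<^sub>m 1\<^sub>m (Suc d))) *\<^sub>v u) $ l
    = (\<Sum>k\<le>d. A $$ (l,k) * ((s k - y) * u $ k)) - x * ((s l - y) * u $ l)"
proof -
  have shift: "((N - z \<cdot>\<^sub>m 1\<^sub>m (Suc d)) *\<^sub>v w) $ k = (\<Sum>m\<le>d. N $$ (k,m) * w $ m) - z * w $ k"
    if N: "N \<in> carrier_mat (Suc d) (Suc d)" and w: "w \<in> carrier_vec (Suc d)" and k: "k \<le> d"
    for N :: "'a mat" and z w k
  proof -
    have "((N - z \<cdot>\<^sub>m 1\<^sub>m (Suc d)) *\<^sub>v w) $ k = (\<Sum>m\<le>d. (N - z \<cdot>\<^sub>m 1\<^sub>m (Suc d)) $$ (k,m) * w $ m)"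
      using N by (intro mult_vec_index[OF _ w k]) auto
    also have "\<dots> = (\<Sum>m\<le>d. N $$ (k,m) * w $ m - (if m = k then z * w $ k else 0))"
      by (rule sum.cong) (use N k in \<open>auto simp: algebra_simps\<close>)
    finally show ?thesis using k by (simp add: sum_subtractf)
  qed
  define w where "w = (As - y \<cdot>\<^sub>m 1\<^sub>m (Suc d)) *\<^sub>v u"
  have C: "A - x \<cdot>\<^sub>m 1\<^sub>m (Suc d) \<in> carrier_mat (Suc d) (Suc d)"
    "As - y \<cdot>\<^sub>m 1\<^sub>m (Suc d) \<in> carrier_mat (Suc d) (Suc d)"
    using A_carrier As_carrier by auto
  have w: "w \<in> carrier_vec (Suc d)" unfolding w_def using C(2) u by (rule mult_mat_vec_carrier)
  have wk: "w $ k = (s k - y) * u $ k" if k: "k \<le> d" for k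
  proof -
    have "(\<Sum>m\<le>d. As $$ (k,m) * u $ m) = (\<Sum>m\<le>d. if m = k then s k * u $ k else 0)"
      by (rule sum.cong) (use k in \<open>auto simp: As_entry\<close>)
    then show ?thesis
      unfolding w_def shift[OF As_carrier u k] using k by (simp add: algebra_simps)
  qed
  have prod: "(A - x \<cdot>\<^sub>m 1\<^sub>m (Suc d)) * (As - y \<cdot>\<^sub>m 1\<^sub>m (Suc d)) *\<^sub>v u = (A - x \<cdot>\<^sub>m 1\<^sub>m (Suc d)) *\<^sub>v w"
    unfolding w_def by (rule assoc_mult_mat_vec[OF C u])
  show ?thesis unfolding prod shift[OF A_carrier w l] using wk l by simp
qed

lemma split_space_first_iff:
  assumes i: "i \<le> d"
  shows "u \<in> split_space d eig.E dual.E i \<longleftrightarrow> u \<in> carrier_vec (Suc d)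
    \<and> (\<forall>k\<le>d. i < k \<longrightarrow> u $ k = 0) \<and> (\<forall>k<i. form (ev k) (\<lambda>l. u $ l) = 0)"
proof -
  have S: "{0..i} \<subseteq> {..d}" "{i..d} \<subseteq> {..d}" using i by auto
  have "k \<notin> {0..i} \<longleftrightarrow> i < k" "k \<le> d \<and> k \<notin> {i..d} \<longleftrightarrow> k < i" for k using i by auto
  then show ?thesis
    unfolding split_space_def eig.sum_of_images[OF S(2)] dual.sum_of_images[OF S(1)]
    using dual_E_zero_iff[of u] eig_E_zero_iff[of u] i
    by (auto simp: not_le)
qed

text \<open>For n < i the n-th Newton polynomial is a combination of eigenvectors orthogonal to u;
  for n > i it vanishes wherever u may be nonzero. So the split space is dual to the i-th Newton
  polynomial.\<close>

lemma split_space_first_orthogonal: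
  assumes i: "i \<le> d" and u: "u \<in> split_space d eig.E dual.E i" and n: "n \<noteq> i"
  shows "form (\<lambda>l. poly (node_poly s n) (s l)) (\<lambda>l. u $ l) = 0"
proof (cases "n < i")
  case True
  then obtain c where c: "node_poly s n = (\<Sum>k\<le>n. smult (c k) (eigenpoly k))"
    using poly_expand[of "node_poly s n" n] i by auto
  have "form (\<lambda>l. u $ l) (\<lambda>l. poly (node_poly s n) (s l)) = (\<Sum>k\<le>n. c k * form (\<lambda>l. u $ l) (ev k))"
    unfolding c poly_sum form_sum poly_smult form_smult ..
  also have "\<dots> = 0"
    by (rule sum.neutral)
      (use u True in \<open>auto simp: split_space_first_iff[OF i] form_commute[of "\<lambda>l. u $ l"]\<close>)
  finally show ?thesis by (simp add: form_commute)
next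
  case False
  then have "i < n" using n by simp
  have "weight l * poly (node_poly s n) (s l) * u $ l = 0" if "l \<le> d" for l
  proof (cases "l < n")
    case True
    then show ?thesis by (simp add: poly_node_poly_zero)
  next
    case False
    then show ?thesis using u that \<open>i < n\<close> by (simp add: split_space_first_iff[OF i])
  qed
  then show ?thesis unfolding form_def by (intro sum.neutral) auto
qed


text \<open>Vectors are compared through their pairings with the Newton basis. Self-adjointness
  moves A onto the Newton polynomial, where \<open>act\<close> applies, and the shift by
  \<open>s i\<close> raises its degree. Only n = i survives: at n = i - 1 the factor
  \<open>\<theta> n - \<theta> (i - 1)\<close> is zero, and at n = i + 1 the factor
  \<open>s (n - 1) - s i\<close> is.\<close>

lemma split_space_first_action:
  assumes i: "1 \<le> i" "i \<le> d" and u: "u \<in> split_space d eig.E dual.E i"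
  shows "((A - \<theta> (i - 1) \<cdot>\<^sub>m 1\<^sub>m (Suc d)) * (As - s i \<cdot>\<^sub>m 1\<^sub>m (Suc d))) *\<^sub>v u = \<phi> i \<cdot>\<^sub>v u"
proof -
  let ?M = "(A - \<theta> (i - 1) \<cdot>\<^sub>m 1\<^sub>m (Suc d)) * (As - s i \<cdot>\<^sub>m 1\<^sub>m (Suc d))"
  define t where "t n = (\<lambda>l. poly (node_poly s n) (s l))" for n
  define f where "f = (\<lambda>l. u $ l)"
  have uc: "u \<in> carrier_vec (Suc d)" using u i by (simp add: split_space_first_iff)
  have orth: "form (t n) f = 0" if "n \<noteq> i" for n
    unfolding t_def f_def using split_space_first_orthogonal[OF i(2) u that] .
  have shift: "form (t n) (\<lambda>l. (s l - s i) * f l) = form (t (Suc n)) f + (s n - s i) * form (t n) f" for n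
  proof -
    have "form (t n) (\<lambda>l. (s l - s i) * f l) = (\<Sum>l\<le>d. weight l * t (Suc n) l * f l + (s n - s i) * (weight l * t n l * f l))"
      unfolding form_def by (rule sum.cong) (auto simp: t_def poly_node_poly_Suc algebra_simps)
    then show ?thesis unfolding form_def sum.distrib sum_distrib_left .
  qed
  have key: "form (t n) (\<lambda>l. (?M *\<^sub>v u) $ l) = \<phi> i * form (t n) f" if n: "n \<le> d" for n
  proof -
    define g where "g = (\<lambda>l. (s l - s i) * f l)"
    have "form (t n) (\<lambda>l. (?M *\<^sub>v u) $ l) = form (t n) (\<lambda>l. (\<Sum>k\<le>d. A $$ (l,k) * g k) - \<theta> (i - 1) * g l)"
      by (rule form_cong[OF refl]) (unfold g_def f_def, rule shifted_product_index[OF uc])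
    also have "\<dots> = form (t n) (\<lambda>l. \<Sum>k\<le>d. A $$ (l,k) * g k) - \<theta> (i - 1) * form (t n) g"
      unfolding form_def sum_distrib_left[of "\<theta> (i - 1)"] sum_subtractf[symmetric]
      by (rule sum.cong) (auto simp: algebra_simps)
    also have "form (t n) (\<lambda>l. \<Sum>k\<le>d. A $$ (l,k) * g k) = form (\<lambda>l. \<Sum>k\<le>d. A $$ (l,k) * t n k) g"
      by (rule form_self_adjoint)
    also have "\<dots> = form (\<lambda>l. \<theta> n * t n l + \<phi> n * t (n - 1) l) g"
      by (rule form_cong) (use act[OF n] in \<open>auto simp: t_def\<close>)
    also have "\<dots> = \<theta> n * form (t n) g + \<phi> n * form (t (n - 1)) g"
      unfolding form_def sum_distrib_left sum.distrib[symmetric]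
      by (rule sum.cong) (auto simp: algebra_simps)
    finally have e: "form (t n) (\<lambda>l. (?M *\<^sub>v u) $ l)
      = (\<theta> n - \<theta> (i - 1)) * form (t n) g + \<phi> n * form (t (n - 1)) g"
      by (simp add: algebra_simps)
    have g: "form (t m) g = form (t (Suc m)) f + (s m - s i) * form (t m) f" for m
      unfolding g_def by (rule shift)
    consider "n = i" | "Suc n = i" | "n = Suc i" | "n \<noteq> i" "Suc n \<noteq> i" "n \<noteq> Suc i" by blast
    then show ?thesis
    proof cases
      case 1
      then have "Suc (n - 1) = i" "n - 1 \<noteq> i" using i by auto
      then show ?thesis unfolding e g using 1 orth by simp
    next
      case 2
      then have "n = i - 1" "n \<noteq> i" by auto
      moreover have "\<phi> n * form (t (n - 1)) g = 0"
        using orth[of "Suc (n - 1)"] orth[of "n - 1"] 2 \<phi>_0 unfolding g by (cases n) auto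
      ultimately show ?thesis unfolding e using orth by simp
    next
      case 3
      then show ?thesis unfolding e g using orth by simp
    next
      case 4
      have "\<phi> n * form (t (n - 1)) g = 0"
        using orth[of "Suc (n - 1)"] orth[of "n - 1"] 4 \<phi>_0 unfolding g by (cases n) auto
      then show ?thesis unfolding e g using orth 4 by simp
    qed
  qed
  have Mu: "?M *\<^sub>v u \<in> carrier_vec (Suc d)"
    using A_carrier As_carrier uc by (intro mult_mat_vec_carrier[of _ "Suc d" "Suc d"] mult_carrier_mat[of _ "Suc d" "Suc d"]) auto
  show ?thesis
  proof (rule carrier_vec_eqI[OF Mu])
    fix l assume l: "l \<le> d"
    have "(?M *\<^sub>v u) $ l - \<phi> i * u $ l = 0"
    proof (rule form_zero_imp[OF _ l])
      fix n assume n: "n \<le> d"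
      have "form (t n) (\<lambda>l. (?M *\<^sub>v u) $ l - \<phi> i * u $ l) = form (t n) (\<lambda>l. (?M *\<^sub>v u) $ l) - \<phi> i * form (t n) f"
        unfolding form_def f_def sum_distrib_left sum_subtractf[symmetric]
        by (rule sum.cong) (auto simp: algebra_simps)
      then show "form (\<lambda>i. poly (node_poly s n) (s i)) (\<lambda>l. (?M *\<^sub>v u) $ l - \<phi> i * u $ l) = 0"
        using key[OF n] by (simp add: t_def)
    qed
    then show "(?M *\<^sub>v u) $ l = (\<phi> i \<cdot>\<^sub>v u) $ l" using uc l by auto
  qed (use uc in auto)
qed

text \<open>A functional dual to the i-th Newton polynomial exists by the triangular system;
  dividing it by the weights turns it into a vector of the split space.\<close>

lemma split_space_first_nonzero:
  assumes i: "i \<le> d" shows "\<exists>u\<in>split_space d eig.E dual.E i. u \<noteq> 0\<^sub>v (Suc d)"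
proof -
  obtain f where f: "\<And>n. n \<le> d \<Longrightarrow> (\<Sum>j\<le>d. f j * poly (node_poly s n) (s j)) = (if n = i then 1 else 0)"
    using node_functional_ex[OF s_inj, of "\<lambda>n. if n = i then 1 else 0"] by blast
  have f0: "f j = 0" if "i < j" "j \<le> d" for j
    by (rule node_functional_zero[OF s_inj, where m = "Suc i"]) (use f that in auto)
  define u where "u = vec (Suc d) (\<lambda>j. f j / weight j)"
  have form: "form (\<lambda>l. poly (node_poly s n) (s l)) (\<lambda>l. u $ l) = (if n = i then 1 else 0)" if "n \<le> d" for n
  proof -
    have "form (\<lambda>l. poly (node_poly s n) (s l)) (\<lambda>l. u $ l) = (\<Sum>j\<le>d. f j * poly (node_poly s n) (s j))"
      unfolding form_def by (rule sum.cong) (auto simp: u_def weight_nonzero)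
    then show ?thesis using f[OF that] by simp
  qed
  have "form (ev k) (\<lambda>l. u $ l) = 0" if "k < i" for k
  proof -
    have "form (\<lambda>l. u $ l) (ev k) = (\<Sum>n\<le>k. eigencoeff k n * form (\<lambda>l. u $ l) (\<lambda>l. poly (node_poly s n) (s l)))"
      unfolding eigenpoly_def poly_sum form_sum poly_smult form_smult ..
    also have "\<dots> = 0"
      by (rule sum.neutral) (use form that i in \<open>auto simp: form_commute[of "\<lambda>l. u $ l"]\<close>)
    finally show ?thesis by (simp add: form_commute)
  qed
  then have "u \<in> split_space d eig.E dual.E i"
    unfolding split_space_first_iff[OF i] using f0 by (auto simp: u_def)
  moreover have "u \<noteq> 0\<^sub>v (Suc d)"
  proof
    assume "u = 0\<^sub>v (Suc d)"
    then have "form (\<lambda>l. poly (node_poly s i) (s l)) (\<lambda>l. u $ l) = 0"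
      unfolding form_def by (intro sum.neutral) auto
    then show False using form[OF i] by simp
  qed
  ultimately show ?thesis by blast
qed

text \<open>With the eigenvectors reversed, the condition on the side of A means degree at most d -
  i, and the one on the side of \<open>As\<close> prescribes zeros at the last d - i nodes. Only
  multiples of a reversed Newton polynomial meet both.\<close>

lemma split_space_second_iff:
  assumes i: "i \<le> d"
  shows "u \<in> split_space d (\<lambda>h. eig.E (d - h)) dual.E i \<longleftrightarrow>
    (\<exists>c. u = vec (Suc d) (\<lambda>l. c * poly (node_poly s_rev (d - i)) (s l)))"
proof -
  define \<theta>' where "\<theta>' k = \<theta> (d - k)" for k
  interpret r: eigenbasis d A \<theta>' "\<lambda>k. eigenvec (d - k)"
  proof
    show "inj_on \<theta>' {..d}"
      using \<theta>_inj unfolding inj_on_def \<theta>'_def by (metis atMost_iff diff_diff_cancel diff_le_self)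
  qed (use A_carrier eig.v_carrier eig.v_nonzero eig.v_eigen in \<open>auto simp: \<theta>'_def\<close>)
  have rE: "r.E k = eig.E (d - k)" if "k \<le> d" for k
    unfolding \<theta>'_def by (rule eig.primitive_idempotent_permute[OF bij_betw_flip that])
  have S: "{0..i} \<subseteq> {..d}" "{i..d} \<subseteq> {..d}" using i by auto
  have "split_space d (\<lambda>h. eig.E (d - h)) dual.E i = split_space d r.E dual.E i"
    by (rule split_space_cong) (use rE i in auto)
  then have mem: "u \<in> split_space d (\<lambda>h. eig.E (d - h)) dual.E i \<longleftrightarrow> u \<in> carrier_vec (Suc d)
    \<and> (\<forall>k\<le>d. i < k \<longrightarrow> u $ k = 0) \<and> (\<forall>k<i. eig.E (d - k) *\<^sub>v u = 0\<^sub>v (Suc d))"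
    unfolding split_space_def r.sum_of_images[OF S(2)] dual.sum_of_images[OF S(1)]
    using dual_E_zero_iff[of u] rE i by (auto simp: not_le)
  show ?thesis
  proof
    assume "u \<in> split_space d (\<lambda>h. eig.E (d - h)) dual.E i"
    then have u: "u \<in> carrier_vec (Suc d)" "\<And>k. k \<le> d \<Longrightarrow> i < k \<Longrightarrow> u $ k = 0"
      "\<And>k. k < i \<Longrightarrow> eig.E (d - k) *\<^sub>v u = 0\<^sub>v (Suc d)" unfolding mem by blast+
    obtain c where c: "u = eig.comb c" using eig.comb_ex[OF u(1)] by blast
    have c0: "c k = 0" if k: "k \<le> d" "d - i < k" for k
    proof -
      have "eig.E k *\<^sub>v u = 0\<^sub>v (Suc d)" using u(3)[of "d - k"] k i by simp
      then show ?thesis unfolding c eig.E_comb[OF k(1)] using eig.v_smult_zero[OF k(1)] by simp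
    qed
    define q where "q = (\<Sum>k\<le>d - i. smult (c k) (eigenpoly k))"
    have uq: "u $ l = poly q (s l)" if l: "l \<le> d" for l
    proof -
      have "u $ l = (\<Sum>k\<le>d. c k * ev k l)"
        unfolding c eig.comb_index[OF l] by (rule sum.cong) (use l in \<open>auto simp: eigenvec_def\<close>)
      also have "\<dots> = (\<Sum>k\<le>d - i. c k * ev k l)"
        by (rule sum.mono_neutral_right) (auto simp: c0)
      finally show ?thesis by (simp add: q_def poly_sum)
    qed
    have "degree q \<le> d - i" unfolding q_def
      by (intro degree_sum_le) (auto intro!: order.trans[OF degree_smult_le] order.trans[OF degree_eigenpoly])
    moreover have "poly q (s_rev k) = 0" if "k < d - i" for k
      using uq[of "d - k"] u(2)[of "d - k"] that by (simp add: s_rev_def)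
    moreover have "inj_on s_rev {..<d - i}" by (rule inj_on_subset[OF s_rev_inj]) auto
    ultimately have "q = smult (coeff q (d - i)) (node_poly s_rev (d - i))"
      by (intro poly_eq_smult_node_poly)
    then have "poly q x = coeff q (d - i) * poly (node_poly s_rev (d - i)) x" for x by (metis poly_smult)
    then have "u = vec (Suc d) (\<lambda>l. coeff q (d - i) * poly (node_poly s_rev (d - i)) (s l))"
      by (intro carrier_vec_eqI[OF u(1)]) (auto simp: uq)
    then show "\<exists>c. u = vec (Suc d) (\<lambda>l. c * poly (node_poly s_rev (d - i)) (s l))" by blast
  next
    assume "\<exists>c. u = vec (Suc d) (\<lambda>l. c * poly (node_poly s_rev (d - i)) (s l))"
    then obtain c where u: "u = vec (Suc d) (\<lambda>l. c * poly (node_poly s_rev (d - i)) (s l))" by blast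
    have "u $ k = 0" if "k \<le> d" "i < k" for k
      using that poly_node_poly_zero[of "d - k" "d - i" s_rev] by (simp add: u s_rev_def)
    moreover have "eig.E (d - k) *\<^sub>v u = 0\<^sub>v (Suc d)" if k: "k < i" for k
    proof -
      have "degree (smult c (node_poly s_rev (d - i))) \<le> d - i"
        by (intro order.trans[OF degree_smult_le]) simp
      then have "degree (smult c (node_poly s_rev (d - i))) < d - k" using k i by linarith
      then have "form (ev (d - k)) (\<lambda>l. poly (smult c (node_poly s_rev (d - i))) (s l)) = 0"
        by (intro form_ev_low_degree) auto
      then have "form (ev (d - k)) (\<lambda>l. u $ l) = 0"
        by (subst form_cong[OF refl]) (auto simp: u)
      then show ?thesis by (subst eig_E_zero_iff) (auto simp: u)
    qed
    ultimately show "u \<in> split_space d (\<lambda>h. eig.E (d - h)) dual.E i"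
      unfolding mem by (auto simp: u)
  qed
qed

text \<open>Multiplication by x - s i raises the reversed Newton polynomial of degree d - i, since s
  i is its next node, and \<open>act_rev\<close> brings it down again. This is the origin of the
  index d + 1 - i.\<close>

lemma split_space_second_action:
  assumes i: "1 \<le> i" "i \<le> d" and u: "u \<in> split_space d (\<lambda>h. eig.E (d - h)) dual.E i"
  shows "((A - \<theta> (Suc d - i) \<cdot>\<^sub>m 1\<^sub>m (Suc d)) * (As - s i \<cdot>\<^sub>m 1\<^sub>m (Suc d))) *\<^sub>v u = \<psi> (Suc d - i) \<cdot>\<^sub>v u"
proof -
  let ?M = "(A - \<theta> (Suc d - i) \<cdot>\<^sub>m 1\<^sub>m (Suc d)) * (As - s i \<cdot>\<^sub>m 1\<^sub>m (Suc d))"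
  obtain c where u: "u = vec (Suc d) (\<lambda>l. c * poly (node_poly s_rev (d - i)) (s l))"
    using u split_space_second_iff[OF i(2)] by blast
  then have uc: "u \<in> carrier_vec (Suc d)" by simp
  have n: "Suc d - i = Suc (d - i)" "Suc d - i \<le> d" "Suc d - i - 1 = d - i" using i by auto
  have step: "(s k - s i) * u $ k = c * poly (node_poly s_rev (Suc d - i)) (s k)" if "k \<le> d" for k
    using that i unfolding n(1) poly_node_poly_Suc by (simp add: u s_rev_def)
  have Mu: "?M *\<^sub>v u \<in> carrier_vec (Suc d)"
    using A_carrier As_carrier uc by (intro mult_mat_vec_carrier[of _ "Suc d" "Suc d"] mult_carrier_mat[of _ "Suc d" "Suc d"]) auto
  show ?thesis
  proof (rule carrier_vec_eqI[OF Mu])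
    fix l assume l: "l \<le> d"
    have "(?M *\<^sub>v u) $ l = (\<Sum>k\<le>d. A $$ (l,k) * ((s k - s i) * u $ k)) - \<theta> (Suc d - i) * ((s l - s i) * u $ l)"
      by (rule shifted_product_index[OF uc l])
    also have "(\<Sum>k\<le>d. A $$ (l,k) * ((s k - s i) * u $ k))
      = c * (\<Sum>k\<le>d. A $$ (l,k) * poly (node_poly s_rev (Suc d - i)) (s k))"
      unfolding sum_distrib_left by (rule sum.cong) (simp_all add: step)
    also have "(\<Sum>k\<le>d. A $$ (l,k) * poly (node_poly s_rev (Suc d - i)) (s k))
      = \<theta> (Suc d - i) * poly (node_poly s_rev (Suc d - i)) (s l)
        + \<psi> (Suc d - i) * poly (node_poly s_rev (d - i)) (s l)"
      using act_rev[OF n(2) l] unfolding n(3) .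
    finally show "(?M *\<^sub>v u) $ l = (\<psi> (Suc d - i) \<cdot>\<^sub>v u) $ l"
      unfolding step[OF l] using l by (simp add: u algebra_simps)
  qed (use uc in auto)
qed

lemma split_space_second_nonzero:
  assumes i: "i \<le> d" shows "\<exists>u\<in>split_space d (\<lambda>h. eig.E (d - h)) dual.E i. u \<noteq> 0\<^sub>v (Suc d)"
proof -
  let ?u = "vec (Suc d) (\<lambda>l. 1 * poly (node_poly s_rev (d - i)) (s l))"
  have "?u \<in> split_space d (\<lambda>h. eig.E (d - h)) dual.E i"
    unfolding split_space_second_iff[OF i] by blast
  moreover have "?u $ i \<noteq> 0"
    using poly_node_poly_nonzero[OF s_rev_inj, of "d - i" "d - i"] i by (simp add: s_rev_def)
  then have "?u \<noteq> 0\<^sub>v (Suc d)" using i by (metis index_zero_vec(1) le_imp_less_Suc)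
  ultimately show ?thesis by blast
qed

definition system_array :: "'a scalar_array" where
  "system_array = scalar_array_of d \<theta> s \<phi> (\<lambda>i. \<psi> (Suc d - i))"

lemma first_split_sequence:
  assumes E: "associated_eigenvalues d A E \<theta>" and Es: "associated_eigenvalues d As Es s"
  shows "first_split_sequence d A As E Es (split1 system_array)"
  unfolding first_split_sequence_def
proof (intro exI conjI ballI)
  show "associated_eigenvalues d A E \<theta>" by (rule E)
  show "associated_eigenvalues d As Es s" by (rule Es)
  fix i assume i: "i \<in> {1..d}"
  have sp: "split_space d E Es i = split_space d eig.E dual.E i"
    using E Es i by (intro split_space_cong) (auto simp: associated_eigenvalues_def)
  show "\<exists>u\<in>split_space d E Es i. u \<noteq> 0\<^sub>v (d+1)"
    unfolding sp using split_space_first_nonzero[of i] i by simp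
  fix u assume "u \<in> split_space d E Es i"
  then show "((A - \<theta> (i-1) \<cdot>\<^sub>m 1\<^sub>m (d+1)) * (As - s i \<cdot>\<^sub>m 1\<^sub>m (d+1))) *\<^sub>v u = split1 system_array i \<cdot>\<^sub>v u"
    using split_space_first_action[of i u] i unfolding sp by (simp add: system_array_def scalar_array_of_def)
qed

lemma second_split_sequence:
  assumes E: "associated_eigenvalues d A E \<theta>" and Es: "associated_eigenvalues d As Es s"
  shows "second_split_sequence d A As E Es (split2 system_array)"
  unfolding second_split_sequence_def first_split_sequence_def
proof (intro exI conjI ballI)
  show "associated_eigenvalues d A (\<lambda>i. E (d - i)) (\<lambda>i. \<theta> (d - i))"
    by (rule associated_eigenvalues_rev[OF A_carrier E])
  show "associated_eigenvalues d As Es s" by (rule Es)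
  fix i assume i: "i \<in> {1..d}"
  have sp: "split_space d (\<lambda>i. E (d - i)) Es i = split_space d (\<lambda>i. eig.E (d - i)) dual.E i"
    using E Es i by (intro split_space_cong) (auto simp: associated_eigenvalues_def)
  show "\<exists>u\<in>split_space d (\<lambda>i. E (d - i)) Es i. u \<noteq> 0\<^sub>v (d+1)"
    unfolding sp using split_space_second_nonzero[of i] i by simp
  fix u assume u: "u \<in> split_space d (\<lambda>i. E (d - i)) Es i"
  have "d - (i - 1) = Suc d - i" using i by auto
  then show "((A - \<theta> (d - (i-1)) \<cdot>\<^sub>m 1\<^sub>m (d+1)) * (As - s i \<cdot>\<^sub>m 1\<^sub>m (d+1))) *\<^sub>v u = split2 system_array i \<cdot>\<^sub>v u"
    using split_space_second_action[of i u] i u unfolding sp by (simp add: system_array_def scalar_array_of_def)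
qed

lemma parameter_array_of_system:
  assumes "associated_eigenvalues d A E \<theta>" "associated_eigenvalues d As Es s"
  shows "parameter_array_of_system d A As E Es system_array"
proof -
  have "associated_eigenvalues d A E (eig system_array)"
    by (rule associated_eigenvalues_cong[OF _ assms(1)]) (simp add: system_array_def scalar_array_of_def)
  moreover have "associated_eigenvalues d As Es (dual_eig system_array)"
    by (rule associated_eigenvalues_cong[OF _ assms(2)]) (simp add: system_array_def scalar_array_of_def)
  moreover have "array_of_diameter d system_array"
    by (simp add: array_of_diameter_def system_array_def scalar_array_of_def)
  ultimately show ?thesis
    using first_split_sequence[OF assms] second_split_sequence[OF assms]
    by (simp add: parameter_array_of_system_def)
qed

lemma row_sum: "constant_row_sum d A (\<theta> 0)"
  unfolding constant_row_sum_def using act[of 0] by (simp add: \<phi>_0 atLeast0AtMost)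

lemma leonard_system: "leonard_system d A As eig.E dual.E"
  unfolding leonard_system_def
  using eig.multiplicity_free dual.multiplicity_free idempotent dual_idempotent by blast

lemma designated: "designated_leonard_system d A As eig.E dual.E"
proof -
  have "associated_eigenvalues d As dual.E (\<lambda>i. As $$ (i,i))"
    by (rule associated_eigenvalues_cong[OF _ dual.associated]) (simp add: As_entry)
  then show ?thesis
    unfolding designated_leonard_system_def using leonard_system eig.associated row_sum by blast
qed

lemma designated_parameter_array: "designated_parameter_array d A As system_array"
  unfolding designated_parameter_array_def
  using designated parameter_array_of_system[OF eig.associated dual.associated] by blast

end

section \<open>Parameter arrays\<close>

context recurrent_pair begin

text \<open>The left side has the shape of \<psi>, the right side that of the \<open>split2\<close>
  condition. Their difference is \<open>defect\<close>, because the first term of \<phi> equals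
  \<open>(r + (s 1 - s 0)) * (t 0 - t d)\<close>.\<close>

lemma reversed_parameter:
  assumes "d \<ge> 1" "t 0 \<noteq> t (int d)"
  shows "\<phi> r n - (t (int n) - t (int n - 1)) * sum_s n
    = \<phi> r 1 * (sum_t n / (t 0 - t (int d))) + (s (int d - int n + 1) - s 0) * (t (int n) - t 0)"
proof -
  have "\<phi> r 1 = (r + (s 1 - s 0)) * (t 0 - t (int d))"
    by (simp add: \<phi>_def gap_t_def algebra_simps)
  then have "\<phi> r 1 * (sum_t n / (t 0 - t (int d))) = (r + (s 1 - s 0)) * sum_t n"
    using assms(2) by simp
  then show ?thesis
    using defect_zero[OF assms(1), of n] unfolding defect_def \<phi>_def[of r n] by Groebner_Basis.algebra
qed

lemma sum_t_d: "d \<ge> 1 \<Longrightarrow> sum_t d = t 0 - t (int d)"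
  using sum_t_flip[of 1] by (simp add: gap_t_def)

end

context tridiagonal_action begin

lemma poly_s_rev: "n \<le> d \<Longrightarrow> poly (node_poly s_rev (d - n)) x = (\<Prod>h=Suc n..d. x - s h)"
  unfolding poly_node_poly s_rev_def
  by (rule prod.reindex_bij_witness[of _ "\<lambda>h. d - h" "\<lambda>k. d - k"]) auto

lemma super_entry_eq:
  assumes "i \<in> {1..d}"
  shows "a (i - 1) i = \<phi> i * ((\<Prod>h=0..<i-1. s (i-1) - s h) / (\<Prod>h=0..<i. s i - s h))"
proof -
  have i: "Suc (i - 1) = i" using assms by simp
  have "a (i - 1) i * poly (node_poly s i) (s i) = \<phi> i * poly (node_poly s (i - 1)) (s (i - 1))"
    using super_entry[of "i - 1", unfolded i] assms by fastforce
  moreover have "poly (node_poly s i) (s i) \<noteq> 0" using assms by (intro node_nonzero) auto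
  ultimately have "a (i - 1) i = \<phi> i * poly (node_poly s (i - 1)) (s (i - 1)) / poly (node_poly s i) (s i)"
    by (metis nonzero_eq_divide_eq)
  then show ?thesis by (simp add: poly_node_poly atLeast0LessThan)
qed

lemma sub_entry_eq:
  assumes "i \<in> {1..d}"
  shows "a i (i - 1) = \<psi> (Suc d - i) * ((\<Prod>h=i+1..d. s i - s h) / (\<Prod>h=i..d. s (i-1) - s h))"
proof -
  have n: "Suc d - i = d - (i - 1)" "Suc (i - 1) = i" using assms by auto
  have e: "poly (node_poly s_rev (Suc d - i)) x = (\<Prod>h=i..d. x - s h)" for x
    using poly_s_rev[of "i - 1"] assms unfolding n by auto
  have "a i (i - 1) * (\<Prod>h=i..d. s (i - 1) - s h) = \<psi> (Suc d - i) * (\<Prod>h=Suc i..d. s i - s h)"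
    using sub_entry[of i] poly_s_rev[of i] assms by (simp add: e)
  moreover have "s (i - 1) - s h \<noteq> 0" if "h \<in> {i..d}" for h
  proof -
    have "i - 1 \<le> d" "h \<le> d" "i - 1 \<noteq> h" using that assms by auto
    then show ?thesis using s_neq[of "i - 1" h] by simp
  qed
  then have "(\<Prod>h=i..d. s (i - 1) - s h) \<noteq> 0" by simp
  ultimately have "a i (i - 1) = \<psi> (Suc d - i) * (\<Prod>h=Suc i..d. s i - s h) / (\<Prod>h=i..d. s (i - 1) - s h)"
    by (metis nonzero_eq_divide_eq)
  then show ?thesis by simp
qed

end

text \<open>The \<open>split2\<close> condition at index d + 1 - n, except that the sum still has
  length n; \<open>sum_t_flip\<close> exchanges the two lengths.\<close>

lemma (in extended_split_action) \<psi>_eq: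
  assumes "\<And>i j. i \<le> d \<Longrightarrow> j + 1 < i \<Longrightarrow> a i j = 0" and n: "1 \<le> n" "n \<le> d"
    and \<phi>: "\<And>n. n \<le> d \<Longrightarrow> \<phi> n = pair.\<phi> r n" and T: "T 0 \<noteq> T (int d)"
  shows "tridiagonal_action.\<psi> d s (\<lambda>k. T (int k)) \<phi> n
    = \<phi> 1 * (pair.sum_t n / (T 0 - T (int d))) + (S (int (Suc d - n)) - S 0) * (T (int n) - T 0)"
proof -
  interpret tridiagonal_action d a s "\<lambda>k. T (int k)" \<phi> by unfold_locales (rule assms(1))
  have i: "int (n - 1) = int n - 1" "int (Suc d - n) = int d - int n + 1" using n by auto
  have "(\<Sum>k<n. S (int k) - S (int (d - k))) = pair.sum_s n"
    unfolding pair.sum_s_def pair.gap_s_def by (rule sum.cong) (use n in \<open>auto simp: of_nat_diff\<close>)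
  then have "\<psi> n = pair.\<phi> r n - (T (int n) - T (int n - 1)) * pair.sum_s n"
    unfolding \<psi>_def i(1) \<phi>[OF n(2)] by simp
  then show ?thesis using pair.reversed_parameter[of r n] T n \<phi>[of 1] by (simp add: i)
qed

context split_matrix begin

lemma entries: "TD_D_entries d A As system_array"
proof -
  have e1: "A $$ (i,i) = eig system_array i
        + (if i = 0 then 0 else split1 system_array i / (dual_eig system_array i - dual_eig system_array (i-1)))
        + (if i = d then 0 else split1 system_array (i+1) / (dual_eig system_array i - dual_eig system_array (i+1)))"
    if "i \<le> d" for i
    unfolding diag_entry[OF that] using that by (auto simp: system_array_def scalar_array_of_def)
  have e2: "A $$ (i-1,i) = split1 system_array i * ((\<Prod>h=0..<i-1. dual_eig system_array (i-1) - dual_eig system_array h)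
      / (\<Prod>h=0..<i. dual_eig system_array i - dual_eig system_array h))" if "i \<in> {1..d}" for i
    unfolding super_entry_eq[OF that] using that by (auto simp: system_array_def scalar_array_of_def)
  have e3: "A $$ (i,i-1) = split2 system_array i * ((\<Prod>h=i+1..d. dual_eig system_array i - dual_eig system_array h)
      / (\<Prod>h=i..d. dual_eig system_array (i-1) - dual_eig system_array h))" if "i \<in> {1..d}" for i
    unfolding sub_entry_eq[OF that] using that by (auto simp: system_array_def scalar_array_of_def)
  have e4: "As $$ (i,i) = dual_eig system_array i" if "i \<le> d" for i
    using that As_entry by (simp add: system_array_def scalar_array_of_def)
  show ?thesis unfolding TD_D_entries_def Let_def by (intro conjI allI impI ballI e1 e2 e3 e4)
qed


end

context split_matrix begin

lemma parameter_array: "parameter_array d system_array"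
proof -
  have diam: "array_of_diameter d system_array"
    by (simp add: array_of_diameter_def system_array_def scalar_array_of_def)
  have val: "eig system_array i = \<theta> i" "dual_eig system_array i = s i" if "i \<le> d" for i
    using that by (simp_all add: system_array_def scalar_array_of_def)
  have spl: "split1 system_array i = \<phi> i" "split2 system_array i = \<psi> (Suc d - i)" if "i \<in> {1..d}" for i
    using that by (simp_all add: system_array_def scalar_array_of_def)
  obtain \<beta> where \<beta>: "\<And>i. i + 3 \<le> d \<Longrightarrow> s i - s (i + 3) = (\<beta> + 1) * (s (i + 1) - s (i + 2))"
    "\<And>i. i + 3 \<le> d \<Longrightarrow> \<theta> i - \<theta> (i + 3) = (\<beta> + 1) * (\<theta> (i + 1) - \<theta> (i + 2))"
    using four_term_recurrence[OF \<theta>_inj] by blast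
  obtain \<gamma> S where S: "recurrent \<beta> \<gamma> S" "\<And>i. i \<le> d \<Longrightarrow> S (int i) = s i"
    using recurrent_of_four_term[of d s \<beta>] \<beta>(1) by blast
  obtain \<delta> T where T: "recurrent \<beta> \<delta> T" "\<And>i. i \<le> d \<Longrightarrow> T (int i) = \<theta> i"
    using recurrent_of_four_term[of d \<theta> \<beta>] \<beta>(2) by blast
  interpret x: extended_split_action \<beta> \<gamma> \<delta> S T d "\<lambda>i j. A $$ (i,j)" \<phi>
    by (intro extended_split_action.intro recurrent_pair.intro S T split_action_cong refl)
  have T0: "T 0 = \<theta> 0" and S0: "S 0 = s 0" using T(2)[of 0] S(2)[of 0] by simp_all
  have Tr: "T (int d - int h) = \<theta> (d - h)" if "h \<le> d" for h
    using T(2)[of "d - h"] that by (simp add: of_nat_diff)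
  have main: "split1 system_array i = split2 system_array 1 * (\<Sum>h=0..<i. (\<theta> h - \<theta> (d - h)) / (\<theta> 0 - \<theta> d))
          + (s i - s 0) * (\<theta> (i - 1) - \<theta> d) \<and>
      split2 system_array i = split1 system_array 1 * (\<Sum>h=0..<i. (\<theta> h - \<theta> (d - h)) / (\<theta> 0 - \<theta> d))
          + (s i - s 0) * (\<theta> (d - i + 1) - \<theta> 0)" if i: "i \<in> {1..d}" for i
  proof -
    have d1: "d \<ge> 1" using i by simp
    have Td: "T 0 \<noteq> T (int d)" using \<theta>_neq[of 0 d] d1 T(2) T0 by simp
    obtain r where r: "\<And>n. n \<le> d \<Longrightarrow> \<phi> n = x.pair.\<phi> r n"
      using x.parameters_of_lower_zero[OF lower_zero d1 Td] by blast
    have \<psi>: "\<psi> n = \<phi> 1 * (x.pair.sum_t n / (T 0 - T (int d))) + (S (int (Suc d - n)) - S 0) * (T (int n) - T 0)"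
      if n: "1 \<le> n" "n \<le> d" for n
    proof -
      have "\<psi> n = tridiagonal_action.\<psi> d x.s (\<lambda>k. T (int k)) \<phi> n"
      proof -
        interpret y: tridiagonal_action d "\<lambda>i j. A $$ (i,j)" x.s "\<lambda>k. T (int k)" \<phi>
          by unfold_locales (rule lower_zero)
        have "(\<Sum>k<n. s k - s (d - k)) = (\<Sum>k<n. S (int k) - S (int (d - k)))"
          by (rule sum.cong) (use n in \<open>auto simp: S(2)[symmetric]\<close>)
        then show ?thesis unfolding \<psi>_def y.\<psi>_def using n T(2)[of n] T(2)[of "n - 1"] by (simp add: of_nat_diff)
      qed
      then show ?thesis using x.\<psi>_eq[OF lower_zero n r Td] by simp
    qed
    have sum: "(\<Sum>h=0..<n. (\<theta> h - \<theta> (d - h)) / (\<theta> 0 - \<theta> d)) = x.pair.sum_t n / (T 0 - T (int d))"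
      if "n \<le> d" for n
      unfolding x.pair.sum_t_def x.pair.gap_t_def sum_divide_distrib atLeast0LessThan
      by (rule sum.cong) (use that in \<open>auto simp: Tr T(2) T0\<close>)
    have \<phi>1: "\<phi> 1 = (r + (S 1 - S 0)) * (T 0 - T (int d))"
      using r[of 1] d1 by (simp add: x.pair.\<phi>_def x.pair.gap_t_def algebra_simps)
    \<comment> \<open>At n = d the formula for \<psi> identifies r with
      \<open>split2 1 / (\<theta> 0 - \<theta> d)\<close>, and \<open>pair.\<phi>\<close> becomes
      the \<open>split1\<close> condition.\<close>
    have "\<psi> d = \<phi> 1 + (S 1 - S 0) * (T (int d) - T 0)"
      using \<psi>[of d] d1 Td x.pair.sum_t_d[OF d1] by simp
    then have \<psi>d: "\<psi> d = r * (T 0 - T (int d))" unfolding \<phi>1 by (simp add: algebra_simps)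
    have "split1 system_array i = split2 system_array 1 * (x.pair.sum_t i / (T 0 - T (int d)))
          + (s i - s 0) * (\<theta> (i - 1) - \<theta> d)"
    proof -
      have "i - 1 \<le> d" "int (i - 1) = int i - 1" using i by auto
      then have "T (int i - 1) = \<theta> (i - 1)" using T(2)[of "i - 1"] by simp
      then have "\<phi> i = r * x.pair.sum_t i + (s i - s 0) * (\<theta> (i - 1) - \<theta> d)"
        using r[of i] i S(2)[of i] S0 T(2)[of d] by (simp add: x.pair.\<phi>_def)
      then show ?thesis using i d1 Td by (simp add: spl \<psi>d)
    qed
    moreover have "split2 system_array i = split1 system_array 1 * (x.pair.sum_t i / (T 0 - T (int d)))
          + (s i - s 0) * (\<theta> (d - i + 1) - \<theta> 0)"
    proof -
      have e: "Suc d - i = d - i + 1" "Suc d - (Suc d - i) = i" "1 \<le> Suc d - i" "Suc d - i \<le> d" using i by auto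
      have "x.pair.sum_t (Suc d - i) = x.pair.sum_t i" using i by (intro x.pair.sum_t_flip) simp
      then have "\<psi> (Suc d - i) = \<phi> 1 * (x.pair.sum_t i / (T 0 - T (int d)))
          + (S (int i) - S 0) * (T (int (Suc d - i)) - T 0)"
        using \<psi>[OF e(3,4)] unfolding e(2) by simp
      then show ?thesis using i d1 S(2)[of i] T(2)[of "Suc d - i"] e by (simp add: spl S0 T0)
    qed
    ultimately show ?thesis using sum[of i] i by simp
  qed
  have quot: "(\<theta> (i-2) - \<theta> (i+1)) / (\<theta> (i-1) - \<theta> i) = \<beta> + 1 \<and> (s (i-2) - s (i+1)) / (s (i-1) - s i) = \<beta> + 1"
    if i: "i \<in> {2..d-1}" for i
  proof -
    have e: "i - 2 + 3 = i + 1" "i - 2 + 1 = i - 1" "i - 2 + 2 = i" "i - 2 + 3 \<le> d" using i by auto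
    have "i - 1 \<le> d" "i \<le> d" "i - 1 \<noteq> i" using i by auto
    then have "\<theta> (i - 1) \<noteq> \<theta> i" "s (i - 1) \<noteq> s i" by (rule \<theta>_neq s_neq)+
    then show ?thesis using \<beta>(1)[of "i - 2"] \<beta>(2)[of "i - 2"] e by simp
  qed
  show ?thesis
    unfolding parameter_array_def Let_def
  proof (intro conjI)
    show "array_of_diameter d system_array" by (rule diam)
    show "\<forall>i\<in>{1..d}. split1 system_array i \<noteq> 0 \<and> split2 system_array i \<noteq> 0"
    proof
      fix i assume i: "i \<in> {1..d}"
      have "Suc (i - 1) = i" "Suc (d - i) = Suc d - i" using i by auto
      then show "split1 system_array i \<noteq> 0 \<and> split2 system_array i \<noteq> 0"
        using spl[OF i] \<phi>_nonzero[of "i - 1"] \<psi>_nonzero[of "d - i"] i by auto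
    qed
    show "\<forall>i\<le>d. \<forall>j\<le>d. i \<noteq> j \<longrightarrow> eig system_array i \<noteq> eig system_array j
        \<and> dual_eig system_array i \<noteq> dual_eig system_array j"
      using \<theta>_neq s_neq by (simp add: val)
    have le0: "0 \<le> d" and le1: "i \<le> d" and le2: "i - 1 \<le> d" and le3: "d - i + 1 \<le> d"
      if "i \<in> {1..d}" for i using that by auto
    have sums: "(\<Sum>h=0..<i. (eig system_array h - eig system_array (d - h)) / (eig system_array 0 - eig system_array d))
      = (\<Sum>h=0..<i. (\<theta> h - \<theta> (d - h)) / (\<theta> 0 - \<theta> d))" if "i \<in> {1..d}" for i
      by (rule sum.cong) (use that in \<open>auto simp: val\<close>)
    show "\<forall>i\<in>{1..d}. split1 system_array i = split2 system_array 1 *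
        (\<Sum>h=0..<i. (eig system_array h - eig system_array (d - h)) / (eig system_array 0 - eig system_array d))
        + (dual_eig system_array i - dual_eig system_array 0) * (eig system_array (i - 1) - eig system_array d)"
    proof
      fix i assume i: "i \<in> {1..d}"
      show "split1 system_array i = split2 system_array 1 *
        (\<Sum>h=0..<i. (eig system_array h - eig system_array (d - h)) / (eig system_array 0 - eig system_array d))
        + (dual_eig system_array i - dual_eig system_array 0) * (eig system_array (i - 1) - eig system_array d)"
        unfolding sums[OF i] unfolding val[OF le0[OF i]] val[OF le1[OF i]] val[OF le2[OF i]] val[OF order_refl]
        by (rule conjunct1[OF main[OF i]])
    qed
    show "\<forall>i\<in>{1..d}. split2 system_array i = split1 system_array 1 *
        (\<Sum>h=0..<i. (eig system_array h - eig system_array (d - h)) / (eig system_array 0 - eig system_array d))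
        + (dual_eig system_array i - dual_eig system_array 0) * (eig system_array (d - i + 1) - eig system_array 0)"
    proof
      fix i assume i: "i \<in> {1..d}"
      show "split2 system_array i = split1 system_array 1 *
        (\<Sum>h=0..<i. (eig system_array h - eig system_array (d - h)) / (eig system_array 0 - eig system_array d))
        + (dual_eig system_array i - dual_eig system_array 0) * (eig system_array (d - i + 1) - eig system_array 0)"
        unfolding sums[OF i] unfolding val[OF le0[OF i]] val[OF le1[OF i]] val[OF le3[OF i]]
        by (rule conjunct2[OF main[OF i]])
    qed
    show "\<exists>c. \<forall>i\<in>{2..d-1}.
        (eig system_array (i-2) - eig system_array (i+1)) / (eig system_array (i-1) - eig system_array i) = c \<and>
        (dual_eig system_array (i-2) - dual_eig system_array (i+1)) / (dual_eig system_array (i-1) - dual_eig system_array i) = c"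
    proof (intro exI ballI)
      fix i assume i: "i \<in> {2..d-1}"
      then have "i - 2 \<le> d" "i - 1 \<le> d" "i \<le> d" "i + 1 \<le> d" by auto
      then show "(eig system_array (i-2) - eig system_array (i+1)) / (eig system_array (i-1) - eig system_array i) = \<beta> + 1 \<and>
        (dual_eig system_array (i-2) - dual_eig system_array (i+1)) / (dual_eig system_array (i-1) - dual_eig system_array i) = \<beta> + 1"
        using quot[OF i] by (simp only: val)
    qed
  qed
qed

end

lemma tridiagonal_mat_zero:
  assumes "A \<in> carrier_mat (Suc d) (Suc d)" "tridiagonal_mat A" "i \<le> d" "j \<le> d"
    and "i \<noteq> j" "i \<noteq> j + 1" "j \<noteq> i + 1"
  shows "A $$ (i,j) = 0"
proof (rule ccontr)
  have "i < dim_row A" "j < dim_col A" using assms(1,3,4) by auto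
  moreover assume "A $$ (i,j) \<noteq> 0"
  ultimately show False using assms(2,5-7) unfolding tridiagonal_mat_def by blast
qed

text \<open>An auxiliary matrix is defined by the bidiagonal action that the array prescribes. The
  \<open>split1\<close> condition and the recurrences make it tridiagonal, and the
  \<open>split2\<close> condition identifies its second split sequence. Its entries are then the
  prescribed ones, so it coincides with A.\<close>

lemma designated_of_parameter_array:
  fixes A As :: "'a::field mat"
  assumes A: "A \<in> carrier_mat (Suc d) (Suc d)" and As: "As \<in> carrier_mat (Suc d) (Suc d)"
    and tri: "tridiagonal_mat A" and diag: "diagonal_mat As"
    and p: "parameter_array d p" and e: "TD_D_entries d A As p"
  shows "designated_parameter_array d A As p"
proof -
  define \<theta> s where "\<theta> = eig p" and "s = dual_eig p"
  note P = p[unfolded parameter_array_def Let_def, folded \<theta>_def s_def]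
  note P2 = P[THEN conjunct2] note P3 = P2[THEN conjunct2] note P4 = P3[THEN conjunct2]
  note P5 = P4[THEN conjunct2]
  have diam: "array_of_diameter d p" by (rule P[THEN conjunct1])
  have nz: "split1 p i \<noteq> 0" "split2 p i \<noteq> 0" if "i \<in> {1..d}" for i
    using bspec[OF P2[THEN conjunct1] that] by auto
  have dist: "\<theta> i \<noteq> \<theta> j" "s i \<noteq> s j" if "i \<le> d" "j \<le> d" "i \<noteq> j" for i j
    using P3[THEN conjunct1, rule_format, OF that] by auto
  have pa3: "split1 p i = split2 p 1 * (\<Sum>h=0..<i. (\<theta> h - \<theta> (d - h)) / (\<theta> 0 - \<theta> d))
      + (s i - s 0) * (\<theta> (i - 1) - \<theta> d)" if "i \<in> {1..d}" for i
    by (rule bspec[OF P4[THEN conjunct1] that])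
  have pa4: "split2 p i = split1 p 1 * (\<Sum>h=0..<i. (\<theta> h - \<theta> (d - h)) / (\<theta> 0 - \<theta> d))
      + (s i - s 0) * (\<theta> (d - i + 1) - \<theta> 0)" if "i \<in> {1..d}" for i
    by (rule bspec[OF P5[THEN conjunct1] that])
  obtain c where c: "\<forall>i\<in>{2..d-1}. (\<theta> (i-2) - \<theta> (i+1)) / (\<theta> (i-1) - \<theta> i) = c
      \<and> (s (i-2) - s (i+1)) / (s (i-1) - s i) = c" using P5[THEN conjunct2] by (elim exE)
  have four: "s i - s (i + 3) = (c - 1 + 1) * (s (i + 1) - s (i + 2))
      \<and> \<theta> i - \<theta> (i + 3) = (c - 1 + 1) * (\<theta> (i + 1) - \<theta> (i + 2))" if i: "i + 3 \<le> d" for i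
  proof -
    have "i + 2 \<in> {2..d-1}" using i by auto
    from bspec[OF c this] have "(\<theta> i - \<theta> (i + 3)) / (\<theta> (i + 1) - \<theta> (i + 2)) = c"
      "(s i - s (i + 3)) / (s (i + 1) - s (i + 2)) = c" by (simp_all add: numeral_3_eq_3)
    moreover have "\<theta> (i + 1) - \<theta> (i + 2) \<noteq> 0" "s (i + 1) - s (i + 2) \<noteq> 0"
      using dist[of "i + 1" "i + 2"] i by simp_all
    ultimately have "s i - s (i + 3) = c * (s (i + 1) - s (i + 2))"
      "\<theta> i - \<theta> (i + 3) = c * (\<theta> (i + 1) - \<theta> (i + 2))" by (simp_all add: nonzero_divide_eq_eq)
    then show ?thesis by simp
  qed
  obtain \<gamma> S where S: "recurrent (c - 1) \<gamma> S" "\<And>i. i \<le> d \<Longrightarrow> S (int i) = s i"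
    using recurrent_of_four_term[of d s "c - 1"] four by blast
  obtain \<delta> T where T: "recurrent (c - 1) \<delta> T" "\<And>i. i \<le> d \<Longrightarrow> T (int i) = \<theta> i"
    using recurrent_of_four_term[of d \<theta> "c - 1"] four by blast
  interpret pair: recurrent_pair "c - 1" \<gamma> \<delta> S T d by (intro recurrent_pair.intro S T)
  have T0: "T 0 = \<theta> 0" and S0: "S 0 = s 0" using T(2)[of 0] S(2)[of 0] by simp_all
  have Tr: "T (int d - int h) = \<theta> (d - h)" if "h \<le> d" for h
    using T(2)[of "d - h"] that by (simp add: of_nat_diff)
  \<comment> \<open>For d = 0 this divides by zero, but then only index 0 occurs, where \<phi>
    vanishes.\<close>
  define r where "r = split2 p 1 / (T 0 - T (int d))"
  define \<phi> where "\<phi> = pair.\<phi> r"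
  have sum: "(\<Sum>h=0..<n. (\<theta> h - \<theta> (d - h)) / (\<theta> 0 - \<theta> d)) = pair.sum_t n / (T 0 - T (int d))"
    if "n \<le> d" for n
    unfolding pair.sum_t_def pair.gap_t_def sum_divide_distrib atLeast0LessThan
    by (rule sum.cong) (use that in \<open>auto simp: Tr T(2) T0\<close>)
  have \<phi>: "\<phi> i = split1 p i" if i: "i \<in> {1..d}" for i
  proof -
    have "i - 1 \<le> d" "int (i - 1) = int i - 1" using i by auto
    then have "T (int i - 1) = \<theta> (i - 1)" using T(2)[of "i - 1"] by simp
    then show ?thesis
      using pa3[OF i] sum[of i] i S(2)[of i] T(2)[of d] by (simp add: \<phi>_def pair.\<phi>_def r_def S0)
  qed
  have s_inj: "inj_on s {..d}" and \<theta>_inj: "inj_on \<theta> {..d}" using dist by (auto simp: inj_on_def)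
  have "\<forall>i. \<exists>f. \<forall>n\<le>d. (\<Sum>j\<le>d. f j * poly (node_poly s n) (s j))
      = \<theta> n * poly (node_poly s n) (s i) + \<phi> n * poly (node_poly s (n - 1)) (s i)"
    by (intro allI node_functional_ex[OF s_inj])
  from choice[OF this] obtain a where a: "\<And>i n. n \<le> d \<Longrightarrow> (\<Sum>j\<le>d. a i j * poly (node_poly s n) (s j))
      = \<theta> n * poly (node_poly s n) (s i) + \<phi> n * poly (node_poly s (n - 1)) (s i)" by blast
  have sa: "split_action d a s \<theta> \<phi>" using s_inj a by unfold_locales (simp_all add: \<phi>_def)
  interpret x: extended_split_action "c - 1" \<gamma> \<delta> S T d a \<phi>
    by (intro extended_split_action.intro recurrent_pair.intro S T split_action.split_action_cong[OF sa] refl)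
  have lower: "a i j = 0" if "i \<le> d" "j + 1 < i" for i j
    by (rule x.lower_zero_of_parameters[OF _ that, of r]) (simp add: \<phi>_def)
  interpret y: tridiagonal_action d a s \<theta> \<phi>
    by (intro tridiagonal_action.intro tridiagonal_action_axioms.intro sa lower)
  have \<psi>: "y.\<psi> (Suc d - i) = split2 p i" if i: "i \<in> {1..d}" for i
  proof -
    define n where "n = Suc d - i"
    have n: "1 \<le> n" "n \<le> d" "Suc d - n = i" "n = d - i + 1" using i by (auto simp: n_def)
    have d1: "d \<ge> 1" using i by simp
    have Td: "T 0 \<noteq> T (int d)" using dist(1)[of 0 d] d1 T(2) T0 by simp
    interpret z: tridiagonal_action d a x.s "\<lambda>k. T (int k)" \<phi> by unfold_locales (rule lower)
    have "(\<Sum>k<n. s k - s (d - k)) = (\<Sum>k<n. S (int k) - S (int (d - k)))"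
      by (rule sum.cong) (use n in \<open>auto simp: S(2)[symmetric]\<close>)
    then have "y.\<psi> n = z.\<psi> n" unfolding y.\<psi>_def z.\<psi>_def using n T(2)[of n] T(2)[of "n - 1"] by (simp add: of_nat_diff)
    also have "\<dots> = \<phi> 1 * (pair.sum_t n / (T 0 - T (int d))) + (S (int (Suc d - n)) - S 0) * (T (int n) - T 0)"
      by (rule x.\<psi>_eq[OF lower n(1,2) _ Td]) (simp_all add: \<phi>_def)
    also have "pair.sum_t n = pair.sum_t i" unfolding n_def using i by (intro pair.sum_t_flip) simp
    finally show ?thesis
      using pa4[OF i] sum[of i] i n \<phi>[of 1] S(2)[of i] T(2)[of n] by (simp add: n_def[symmetric] S0 T0)
  qed
  note e' = e[unfolded TD_D_entries_def Let_def, folded \<theta>_def s_def]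
  have eq: "A $$ (i,j) = a i j" if ij: "i \<le> d" "j \<le> d" for i j
  proof -
    consider "i = j" | "i = Suc j" | "j = Suc i" | "i + 1 < j" | "j + 1 < i" by linarith
    then show ?thesis
    proof cases
      case 1
      have "A $$ (i,i) = \<theta> i + (if i = 0 then 0 else split1 p i / (s i - s (i-1)))
        + (if i = d then 0 else split1 p (i+1) / (s i - s (i+1)))"
        by (rule e'[THEN conjunct1, rule_format, OF ij(1)])
      then show ?thesis using 1 y.diag_entry[OF ij(1)] \<phi>[of i] \<phi>[of "i + 1"] ij by auto
    next
      case 2
      then have i: "i \<in> {1..d}" using ij by auto
      then have "A $$ (i,i-1) = split2 p i * ((\<Prod>h=i+1..d. s i - s h) / (\<Prod>h=i..d. s (i-1) - s h))"
        by (rule bspec[OF e'[THEN conjunct2, THEN conjunct2, THEN conjunct1]])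
      then show ?thesis using y.sub_entry_eq[OF i] \<psi>[OF i] 2 by simp
    next
      case 3
      then have j: "j \<in> {1..d}" using ij by auto
      then have "A $$ (j-1,j) = split1 p j * ((\<Prod>h=0..<j-1. s (j-1) - s h) / (\<Prod>h=0..<j. s j - s h))"
        by (rule bspec[OF e'[THEN conjunct2, THEN conjunct1]])
      then show ?thesis using y.super_entry_eq[OF j] \<phi>[OF j] 3 by simp
    next
      case 4
      then have "A $$ (i,j) = 0" using tridiagonal_mat_zero[OF A tri ij] by simp
      then show ?thesis using y.upper_zero[OF ij] 4 by simp
    next
      case 5
      then have "A $$ (i,j) = 0" using tridiagonal_mat_zero[OF A tri ij] by simp
      then show ?thesis using lower[OF ij(1)] 5 by simp
    qed
  qed
  interpret sm: split_matrix d A s \<theta> \<phi> As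
  proof
    show "inj_on s {..d}" "inj_on \<theta> {..d}" by (rule s_inj \<theta>_inj)+
    show "\<phi> 0 = 0" by (simp add: \<phi>_def)
    show "(\<Sum>j\<le>d. A $$ (i,j) * poly (node_poly s n) (s j))
      = \<theta> n * poly (node_poly s n) (s i) + \<phi> n * poly (node_poly s (n - 1)) (s i)" if "n \<le> d" "i \<le> d" for n i
      using a[OF that(1), of i] eq[OF that(2)] by simp
    show "A $$ (i,j) = 0" if "i \<le> d" "j + 1 < i" for i j
      using eq[of i j] lower[OF that] that by simp
    show "As $$ (i,j) = (if i = j then s i else 0)" if "i \<le> d" "j \<le> d" for i j
    proof -
      have "As $$ (i,i) = s i"
        by (rule e'[THEN conjunct2, THEN conjunct2, THEN conjunct2, rule_format, OF that(1)])
      then show ?thesis using diag As that unfolding diagonal_mat_def by auto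
    qed
    show "A $$ (i, Suc i) \<noteq> 0" if "i < d" for i
    proof
      assume "A $$ (i, Suc i) = 0"
      then have "\<phi> (Suc i) * poly (node_poly s i) (s i) = 0"
        using y.super_entry[OF that] eq[of i "Suc i"] that by simp
      then show False using y.node_nonzero[of i i] \<phi>[of "Suc i"] nz(1)[of "Suc i"] that by simp
    qed
    show "A $$ (Suc i, i) \<noteq> 0" if "i < d" for i
    proof
      assume "A $$ (Suc i, i) = 0"
      then have "y.\<psi> (Suc d - Suc i) * poly (node_poly y.s_rev (d - Suc i)) (s (Suc i)) = 0"
        using y.sub_entry[of "Suc i"] eq[of "Suc i" i] that by simp
      moreover have "s (Suc i) = y.s_rev (d - Suc i)" using that by (simp add: y.s_rev_def)
      ultimately show False
        using poly_node_poly_nonzero[OF y.s_rev_inj, of "d - Suc i" "d - Suc i"] \<psi>[of "Suc i"] nz(2)[of "Suc i"] that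
        by simp
    qed
  qed (use A As in auto)
  have "sm.system_array = p"
  proof -
    have "restrict \<theta> {0..d} = eig p" "restrict s {0..d} = dual_eig p"
      "restrict \<phi> {1..d} = split1 p" "restrict (\<lambda>i. y.\<psi> (Suc d - i)) {1..d} = split2 p"
      using diam \<phi> \<psi> unfolding array_of_diameter_def \<theta>_def s_def
      by (auto simp: extensional_restrict fun_eq_iff restrict_def extensional_def)
    then show ?thesis by (simp add: sm.system_array_def scalar_array_of_def)
  qed
  then show ?thesis using sm.designated_parameter_array by simp
qed

section \<open>Designated Leonard systems\<close>

text \<open>A dual idempotent sequence orders the standard basis; applied to that ordering, this shows
  that no entry of \<open>A\<close> next to the diagonal vanishes.\<close>

lemma adjacent_step_ex:
  fixes \<sigma> :: "nat \<Rightarrow> nat"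
  assumes \<sigma>: "bij_betw \<sigma> {..d} {..d}" and step: "\<And>i. i < d \<Longrightarrow> \<bar>int (\<sigma> i) - int (\<sigma> (Suc i))\<bar> = 1"
    and m: "m < d"
  shows "\<exists>i<d. {\<sigma> i, \<sigma> (Suc i)} = {m, Suc m}"
proof -
  have "\<exists>i<d. (\<sigma> i \<le> m) \<noteq> (\<sigma> (Suc i) \<le> m)"
  proof (rule ccontr)
    assume "\<not> ?thesis"
    then have c: "(\<sigma> (Suc i) \<le> m) = (\<sigma> i \<le> m)" if "i < d" for i using that by blast
    have same: "i \<le> d \<Longrightarrow> (\<sigma> i \<le> m) = (\<sigma> 0 \<le> m)" for i
    proof (induction i)
      case (Suc i)
      then have "(\<sigma> (Suc i) \<le> m) = (\<sigma> i \<le> m)" by (intro c) simp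
      then show ?case using Suc by simp
    qed simp
    have "m \<in> \<sigma> ` {..d}" "Suc m \<in> \<sigma> ` {..d}" using \<sigma> m by (auto simp: bij_betw_def)
    then obtain a b where "a \<le> d" "\<sigma> a = m" "b \<le> d" "\<sigma> b = Suc m" by auto
    then show False using same[of a] same[of b] by simp
  qed
  then obtain i where i: "i < d" "(\<sigma> i \<le> m) \<noteq> (\<sigma> (Suc i) \<le> m)" by blast
  have adjacent: "\<sigma> i = Suc (\<sigma> (Suc i)) \<or> \<sigma> (Suc i) = Suc (\<sigma> i)"
    using step[OF i(1)] by (simp add: abs_if split: if_splits)
  have "{\<sigma> i, \<sigma> (Suc i)} = {m, Suc m}"
  proof (cases "\<sigma> i \<le> m")
    case True
    then have "\<not> \<sigma> (Suc i) \<le> m" using i(2) by simp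
    then have "\<sigma> i = m" "\<sigma> (Suc i) = Suc m" using adjacent True by linarith+
    then show ?thesis by simp
  next
    case False
    then have "\<sigma> (Suc i) \<le> m" using i(2) by simp
    then have "\<sigma> i = Suc m" "\<sigma> (Suc i) = m" using adjacent False by linarith+
    then show ?thesis by auto
  qed
  then show ?thesis using i(1) by blast
qed

lemma diagonal_mat_entry:
  assumes "As \<in> carrier_mat (Suc d) (Suc d)" "diagonal_mat As" "i \<le> d" "j \<le> d"
  shows "As $$ (i,j) = (if i = j then As $$ (i,i) else 0)"
  using assms unfolding diagonal_mat_def by auto

text \<open>This inclusion holds before the diagonal entries are known to be distinct; counting the
  d + 1 eigenvalues then forces them to be distinct.\<close>

lemma eigenvalue_diagonal_subset:
  fixes As :: "'a::field mat"
  assumes As: "As \<in> carrier_mat (Suc d) (Suc d)" and diag: "diagonal_mat As"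
  shows "{t. eigenvalue As t} \<subseteq> (\<lambda>i. As $$ (i,i)) ` {..d}"
proof
  fix t assume "t \<in> {t. eigenvalue As t}"
  then obtain w where w: "w \<in> carrier_vec (Suc d)" "w \<noteq> 0\<^sub>v (Suc d)" "As *\<^sub>v w = t \<cdot>\<^sub>v w"
    using As by (auto simp: eigenvalue_def eigenvector_def)
  have "\<exists>l\<le>d. w $ l \<noteq> 0"
  proof (rule ccontr)
    assume "\<not> (\<exists>l\<le>d. w $ l \<noteq> 0)"
    then have "w = 0\<^sub>v (Suc d)" using w(1) by (intro carrier_vec_eqI[of _ d]) auto
    then show False using w(2) by simp
  qed
  then obtain l where l: "l \<le> d" "w $ l \<noteq> 0" by blast
  have "(As *\<^sub>v w) $ l = (\<Sum>j\<le>d. As $$ (l,j) * w $ j)" by (rule mult_vec_index[OF As w(1) l(1)])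
  also have "\<dots> = (\<Sum>j\<le>d. if j = l then As $$ (l,l) * w $ l else 0)"
  proof (rule sum.cong[OF refl])
    fix j assume "j \<in> {..d}"
    then show "As $$ (l,j) * w $ j = (if j = l then As $$ (l,l) * w $ l else 0)"
      by (subst diagonal_mat_entry[OF As diag l(1)]) auto
  qed
  finally have "t * w $ l = As $$ (l,l) * w $ l" using w(1,3) l(1) by simp
  then have "t = As $$ (l,l)" using l(2) by simp
  then show "t \<in> (\<lambda>i. As $$ (i,i)) ` {..d}" using l(1) by (intro image_eqI[of _ _ l]) simp_all
qed

text \<open>Two orderings have to be adjusted. If the row sum is the last eigenvalue, the
  idempotents of A are reversed. The given dual sequence permutes the standard basis and is replaced
  by the natural order, which is legitimate once all entries next to the diagonal are
  nonzero.\<close>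

lemma designated_system_ex:
  fixes A As :: "'a::field mat"
  assumes A: "A \<in> carrier_mat (Suc d) (Suc d)" and As: "As \<in> carrier_mat (Suc d) (Suc d)"
    and tri: "tridiagonal_mat A" and diag: "diagonal_mat As" and TD: "TD_D_canonical_form d A As"
  shows "\<exists>E Es. designated_leonard_system d A As E Es"
proof -
  obtain \<theta> E1 Es1 where sys: "leonard_system d A As E1 Es1" and \<theta>: "associated_eigenvalues d A E1 \<theta>"
    and row: "constant_row_sum d A (\<theta> 0) \<or> constant_row_sum d A (\<theta> d)"
    using TD unfolding TD_D_canonical_form_def leonard_pair_eigenvalue_sequence_def by blast
  note sysD = sys[unfolded leonard_system_def]
  have idem: "idempotent_sequence d A As E1" and didem: "idempotent_sequence d As A Es1"
    and mfA: "multiplicity_free d A" and mfAs: "multiplicity_free d As" using sysD by blast+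
  have "\<exists>E \<theta>'. idempotent_sequence d A As E \<and> associated_eigenvalues d A E \<theta>' \<and> constant_row_sum d A (\<theta>' 0)"
  proof (cases "constant_row_sum d A (\<theta> 0)")
    case True
    then show ?thesis using idem \<theta> by blast
  next
    case False
    have rev: "associated_eigenvalues d A (\<lambda>i. E1 (d - i)) (\<lambda>i. \<theta> (d - i))"
      by (rule associated_eigenvalues_rev[OF A \<theta>])
    have "idempotent_sequence d A As (\<lambda>i. E1 (d - i))"
      unfolding idempotent_sequence_def
    proof (intro conjI exI allI impI)
      show "associated_eigenvalues d A (\<lambda>i. E1 (d - i)) (\<lambda>i. \<theta> (d - i))" by (rule rev)
      fix i j assume ij: "i \<le> d" "j \<le> d"
      have e: "\<bar>int (d - i) - int (d - j)\<bar> = \<bar>int i - int j\<bar>" using ij by auto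
      note c = conjunct2[OF idem[unfolded idempotent_sequence_def], THEN spec, THEN mp, OF diff_le_self,
          THEN spec, THEN mp, OF diff_le_self, of i j, unfolded e]
      show "E1 (d - i) * As * E1 (d - j) = 0\<^sub>m (d+1) (d+1)" if "\<bar>int i - int j\<bar> > 1"
        by (rule mp[OF conjunct1[OF c] that])
      show "E1 (d - i) * As * E1 (d - j) \<noteq> 0\<^sub>m (d+1) (d+1)" if "\<bar>int i - int j\<bar> = 1"
        by (rule mp[OF conjunct2[OF c] that])
    qed
    moreover have "constant_row_sum d A (\<theta> (d - 0))" using row False by simp
    ultimately show ?thesis using rev by blast
  qed
  then obtain E \<theta>' where E: "idempotent_sequence d A As E" "associated_eigenvalues d A E \<theta>'"
    "constant_row_sum d A (\<theta>' 0)" by blast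
  define s where "s i = As $$ (i,i)" for i
  have sub: "{t. eigenvalue As t} \<subseteq> s ` {..d}"
    using eigenvalue_diagonal_subset[OF As diag] by (simp add: s_def[abs_def])
  have card: "card {t. eigenvalue As t} = Suc d" using mfAs by (simp add: multiplicity_free_def)
  have "card (s ` {..d}) \<ge> Suc d" using card_mono[OF _ sub] card by simp
  moreover have "card (s ` {..d}) \<le> card {..d}" by (rule card_image_le) simp
  ultimately have "card (s ` {..d}) = card {..d}" by simp
  then have s_inj: "inj_on s {..d}" by (intro eq_card_imp_inj_on) simp_all
  have entry: "As $$ (i,j) = (if i = j then s i else 0)" if "i \<le> d" "j \<le> d" for i j
    unfolding s_def by (rule diagonal_mat_entry[OF As diag that])
  have eb: "eigenbasis d As s (unit_vec (Suc d))" by (rule eigenbasis_unit_vec[OF As entry s_inj])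
  interpret D: eigenbasis d As s "unit_vec (Suc d)" by (rule eb)
  note iff = diagonal_idempotent_product_zero_iff[OF eb A]
  obtain \<theta>s where \<theta>s: "associated_eigenvalues d As Es1 \<theta>s"
    using didem unfolding idempotent_sequence_def by blast
  define \<sigma> where "\<sigma> k = inv_into {..d} s (\<theta>s k)" for k
  have img: "{t. eigenvalue As t} = s ` {..d}" using D.eigenvalue_iff by blast
  have bs: "bij_betw \<theta>s {..d} (s ` {..d})"
    using \<theta>s img by (simp add: associated_eigenvalues_def atLeast0AtMost)
  have \<sigma>: "bij_betw \<sigma> {..d} {..d}"
    using bij_betw_trans[OF bs bij_betw_inv_into[OF inj_on_imp_bij_betw[OF s_inj]]]
    by (simp add: \<sigma>_def[abs_def] o_def)
  have s\<sigma>: "s (\<sigma> k) = \<theta>s k" if "k \<le> d" for k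
    unfolding \<sigma>_def by (rule f_inv_into_f) (use bij_betwE[OF bs] that in auto)
  have \<sigma>d: "\<sigma> k \<le> d" if "k \<le> d" for k using bij_betwE[OF \<sigma>] that by auto
  have Es1: "Es1 i = D.E (\<sigma> i)" if i: "i \<le> d" for i
  proof -
    have "Es1 i = primitive_idempotent d As \<theta>s i" using \<theta>s i by (simp add: associated_eigenvalues_def)
    also have "\<dots> = primitive_idempotent d As (\<lambda>k. s (\<sigma> k)) i"
      by (rule primitive_idempotent_cong[OF i]) (simp add: s\<sigma>)
    also have "\<dots> = D.E (\<sigma> i)" by (rule D.primitive_idempotent_permute[OF \<sigma> i])
    finally show ?thesis .
  qed
  have adj: "A $$ (\<sigma> i, \<sigma> j) \<noteq> 0" if ij: "i \<le> d" "j \<le> d" "\<bar>int i - int j\<bar> = 1" for i j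
  proof -
    have "Es1 i * A * Es1 j \<noteq> 0\<^sub>m (d+1) (d+1)"
      using conjunct2[OF didem[unfolded idempotent_sequence_def], rule_format, OF ij(1,2)] ij(3) by blast
    then show ?thesis using iff[OF \<sigma>d[OF ij(1)] \<sigma>d[OF ij(2)]] Es1 ij by simp
  qed
  \<comment> \<open>Consecutive dual idempotents in the given order are joined by a nonzero entry of
    A, so tridiagonality lets \<sigma> move by one only.\<close>
  have step: "\<bar>int (\<sigma> i) - int (\<sigma> (Suc i))\<bar> = 1" if "i < d" for i
  proof -
    have "\<sigma> i \<noteq> \<sigma> (Suc i)" using \<sigma> that by (auto simp: bij_betw_def dest: inj_onD)
    moreover have "A $$ (\<sigma> i, \<sigma> (Suc i)) \<noteq> 0" using adj[of i "Suc i"] that by simp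
    ultimately have "\<sigma> i = \<sigma> (Suc i) + 1 \<or> \<sigma> (Suc i) = \<sigma> i + 1"
      using tridiagonal_mat_zero[OF A tri \<sigma>d[of i] \<sigma>d[of "Suc i"]] that by auto
    then show ?thesis by auto
  qed
  have nz: "A $$ (m, Suc m) \<noteq> 0 \<and> A $$ (Suc m, m) \<noteq> 0" if m: "m < d" for m
  proof -
    obtain i where i: "i < d" "{\<sigma> i, \<sigma> (Suc i)} = {m, Suc m}"
      using adjacent_step_ex[OF \<sigma> step m] by blast
    have "A $$ (\<sigma> i, \<sigma> (Suc i)) \<noteq> 0" "A $$ (\<sigma> (Suc i), \<sigma> i) \<noteq> 0"
      using adj[of i "Suc i"] adj[of "Suc i" i] i(1) by auto
    then show ?thesis using i(2) by (auto simp: doubleton_eq_iff)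
  qed
  have "idempotent_sequence d As A D.E"
    unfolding idempotent_sequence_def
  proof (intro conjI exI allI impI)
    show "associated_eigenvalues d As D.E s" by (rule D.associated)
    fix i j assume ij: "i \<le> d" "j \<le> d"
    show "D.E i * A * D.E j = 0\<^sub>m (d+1) (d+1)" if gap: "\<bar>int i - int j\<bar> > 1"
    proof -
      have "A $$ (i,j) = 0" by (rule tridiagonal_mat_zero[OF A tri ij]) (use gap in auto)
      then show ?thesis using iff[OF ij] by simp
    qed
    show "D.E i * A * D.E j \<noteq> 0\<^sub>m (d+1) (d+1)" if gap: "\<bar>int i - int j\<bar> = 1"
    proof -
      consider "i = Suc j" | "j = Suc i" using gap by linarith
      then have "A $$ (i,j) \<noteq> 0" using nz ij by cases auto
      then show ?thesis using iff[OF ij] by simp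
    qed
  qed
  then have "leonard_system d A As E D.E"
    using E(1) mfA mfAs by (simp add: leonard_system_def)
  moreover have "associated_eigenvalues d As D.E (\<lambda>i. As $$ (i,i))"
    using D.associated by (simp add: s_def[abs_def])
  ultimately have "designated_leonard_system d A As E D.E"
    unfolding designated_leonard_system_def using E by blast
  then show ?thesis by blast
qed

text \<open>In the eigenbasis of A the matrix \<open>As\<close> is irreducible tridiagonal. Its
  three-term recurrence, started at the constant eigenvector, makes \<open>v j\<close> a polynomial
  of degree exactly j in the nodes. Hence A respects the flag of degrees.\<close>

lemma split_matrix_of_designated:
  fixes A As :: "'a::field mat"
  assumes A: "A \<in> carrier_mat (Suc d) (Suc d)" and As: "As \<in> carrier_mat (Suc d) (Suc d)"
    and tri: "tridiagonal_mat A" and diag: "diagonal_mat As"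
    and des: "designated_leonard_system d A As E Es"
  shows "\<exists>\<theta> \<phi>. split_matrix d A (\<lambda>i. As $$ (i,i)) \<theta> \<phi> As \<and> associated_eigenvalues d A E \<theta>"
proof -
  define s where "s i = As $$ (i,i)" for i
  obtain \<theta> where \<theta>: "associated_eigenvalues d A E \<theta>" and row: "constant_row_sum d A (\<theta> 0)"
    using des unfolding designated_leonard_system_def by blast
  have sys: "leonard_system d A As E Es" and Es: "associated_eigenvalues d As Es s"
    using des unfolding designated_leonard_system_def by (auto simp: s_def[abs_def])
  have idem: "idempotent_sequence d A As E" and didem: "idempotent_sequence d As A Es"
    using sys unfolding leonard_system_def by blast+
  have s_inj: "inj_on s {..d}"
    using Es by (simp add: associated_eigenvalues_def bij_betw_def atLeast0AtMost)
  have entry: "As $$ (i,j) = (if i = j then s i else 0)" if "i \<le> d" "j \<le> d" for i j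
    unfolding s_def by (rule diagonal_mat_entry[OF As diag that])
  have eb: "eigenbasis d As s (unit_vec (Suc d))" by (rule eigenbasis_unit_vec[OF As entry s_inj])
  note iff = diagonal_idempotent_product_zero_iff[OF eb A]
  have adj: "A $$ (i,j) \<noteq> 0" if ij: "i \<le> d" "j \<le> d" "\<bar>int i - int j\<bar> = 1" for i j
  proof -
    have "Es i * A * Es j \<noteq> 0\<^sub>m (d+1) (d+1)"
      using conjunct2[OF didem[unfolded idempotent_sequence_def], rule_format, OF ij(1,2)] ij(3) by blast
    then show ?thesis using iff[OF ij(1,2)] Es ij by (simp add: associated_eigenvalues_def)
  qed
  obtain v0 where v0: "eigenbasis d A \<theta> v0"
    using eigenbasis_of_associated[OF A] \<theta> unfolding associated_eigenvalues_def by blast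
  define v where "v = v0(0 := vec (Suc d) (\<lambda>_. 1))"
  have "eigenbasis d A \<theta> v"
  proof -
    interpret v0: eigenbasis d A \<theta> v0 by (rule v0)
    have ones: "vec (Suc d) (\<lambda>_. 1) \<noteq> (0\<^sub>v (Suc d) :: 'a vec)"
    proof
      assume "vec (Suc d) (\<lambda>_. 1) = (0\<^sub>v (Suc d) :: 'a vec)"
      from arg_cong[OF this, of "\<lambda>w. w $ 0"] show False by simp
    qed
    have eig: "A *\<^sub>v vec (Suc d) (\<lambda>_. 1) = \<theta> 0 \<cdot>\<^sub>v vec (Suc d) (\<lambda>_. 1)"
    proof (rule carrier_vec_eqI)
      show "A *\<^sub>v vec (Suc d) (\<lambda>_. 1) \<in> carrier_vec (Suc d)"
        by (rule mult_mat_vec_carrier[OF A]) simp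
      fix i assume i: "i \<le> d"
      have "(A *\<^sub>v vec (Suc d) (\<lambda>_. 1)) $ i = (\<Sum>j\<le>d. A $$ (i,j) * vec (Suc d) (\<lambda>_. 1) $ j)"
        by (rule mult_vec_index[OF A _ i]) simp
      also have "\<dots> = (\<Sum>j=0..d. A $$ (i,j))" unfolding atLeast0AtMost by (rule sum.cong) auto
      also have "\<dots> = \<theta> 0" using row i by (simp add: constant_row_sum_def)
      finally show "(A *\<^sub>v vec (Suc d) (\<lambda>_. 1)) $ i = (\<theta> 0 \<cdot>\<^sub>v vec (Suc d) (\<lambda>_. 1)) $ i" using i by simp
    qed simp
    show ?thesis
      by unfold_locales
        (use A v0.\<theta>_inj v0.v_carrier v0.v_nonzero v0.v_eigen ones eig in \<open>auto simp: v_def\<close>)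
  qed
  then interpret e: eigenbasis d A \<theta> v .
  have E: "E i = e.E i" if "i \<le> d" for i using \<theta> that by (simp add: associated_eigenvalues_def)
  have "\<forall>j\<in>{..d}. \<exists>b. As *\<^sub>v v j = e.comb b"
    using e.comb_ex mult_mat_vec_carrier[OF As] e.v_carrier by simp
  then obtain B where B: "\<And>j. j \<le> d \<Longrightarrow> As *\<^sub>v v j = e.comb (B j)" by (metis atMost_iff)
  have Bpat: "(\<bar>int i - int j\<bar> > 1 \<longrightarrow> B j i = 0) \<and> (\<bar>int i - int j\<bar> = 1 \<longrightarrow> B j i \<noteq> 0)"
    if ij: "i \<le> d" "j \<le> d" for i j
    using conjunct2[OF idem[unfolded idempotent_sequence_def], rule_format, OF ij]
      e.idempotent_product_zero_iff[OF As ij B[OF ij(2)]] E ij by simp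
  have three: "s l * v j $ l = (\<Sum>k\<le>d. B j k * v k $ l)" if "j \<le> d" "l \<le> d" for j l
  proof -
    have "(As *\<^sub>v v j) $ l = (\<Sum>k\<le>d. As $$ (l,k) * v j $ k)"
      by (rule mult_vec_index[OF As e.v_carrier[OF that(1)] that(2)])
    also have "\<dots> = (\<Sum>k\<le>d. if k = l then s l * v j $ l else 0)"
      by (rule sum.cong) (use that entry in auto)
    finally show ?thesis using B[OF that(1)] e.comb_index[OF that(2), of "B j"] that by simp
  qed
  have "\<exists>q. \<forall>j\<le>m. degree (q j) \<le> j \<and> coeff (q j) j \<noteq> 0 \<and> (\<forall>l\<le>d. v j $ l = poly (q j) (s l))"
    if "m \<le> d" for m
    using that
  proof (induction m)
    case 0
    show ?case by (rule exI[of _ "\<lambda>_. 1"]) (simp add: v_def)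
  next
    case (Suc m)
    then obtain q where q: "\<And>j. j \<le> m \<Longrightarrow> degree (q j) \<le> j" "\<And>j. j \<le> m \<Longrightarrow> coeff (q j) j \<noteq> 0"
      "\<And>j l. j \<le> m \<Longrightarrow> l \<le> d \<Longrightarrow> v j $ l = poly (q j) (s l)" by auto
    have b: "B m (Suc m) \<noteq> 0" using Bpat[of "Suc m" m] Suc.prems by simp
    \<comment> \<open>The three-term recurrence solved for the next eigenvector: p represents
      \<open>B m (Suc m)\<close> times \<open>v (Suc m)\<close>. Only the shifted q m reaches degree
      m + 1, so the degree is exact.\<close>
    define p where "p = [:0, 1:] * q m - (\<Sum>k\<le>m. smult (B m k) (q k))"
    have r: "degree (\<Sum>k\<le>m. smult (B m k) (q k)) \<le> m"
      by (intro degree_sum_le) (auto intro!: order.trans[OF degree_smult_le] order.trans[OF q(1)])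
    have "degree ([:0, 1:] * q m) \<le> Suc m" using degree_mult_le[of "[:0, 1:]" "q m"] q(1)[of m] by simp
    then have pd: "degree p \<le> Suc m" unfolding p_def using r by (intro degree_diff_le) auto
    have pc: "coeff p (Suc m) = coeff (q m) m" unfolding p_def using r by (simp add: coeff_eq_0)
    have pv: "B m (Suc m) * v (Suc m) $ l = poly p (s l)" if l: "l \<le> d" for l
    proof -
      have "s l * v m $ l = (\<Sum>k\<le>Suc m. B m k * v k $ l)"
        unfolding three[OF Suc_leD[OF Suc.prems] l]
        by (rule sum.mono_neutral_right) (use Suc.prems Bpat[of _ m] in auto)
      moreover have "(\<Sum>k\<le>m. B m k * v k $ l) = (\<Sum>k\<le>m. B m k * poly (q k) (s l))"
        by (rule sum.cong) (use q(3) l in auto)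
      ultimately show ?thesis using q(3)[of m l] l by (simp add: p_def poly_sum algebra_simps)
    qed
    define q' where "q' = q(Suc m := smult (1 / B m (Suc m)) p)"
    have "degree (q' j) \<le> j \<and> coeff (q' j) j \<noteq> 0 \<and> (\<forall>l\<le>d. v j $ l = poly (q' j) (s l))" if j: "j \<le> Suc m" for j
    proof (cases "j = Suc m")
      case True
      have "v (Suc m) $ l = poly (smult (1 / B m (Suc m)) p) (s l)" if "l \<le> d" for l
        using pv[OF that] b by (simp add: field_simps)
      then show ?thesis using True pd pc q(2)[of m] b by (simp add: q'_def)
    next
      case False
      then show ?thesis using q j by (simp add: q'_def)
    qed
    then show ?case by blast
  qed
  from this[OF order_refl] obtain q where q: "\<And>j. j \<le> d \<Longrightarrow> degree (q j) \<le> j" "\<And>j. j \<le> d \<Longrightarrow> coeff (q j) j \<noteq> 0"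
    "\<And>j l. j \<le> d \<Longrightarrow> l \<le> d \<Longrightarrow> v j $ l = poly (q j) (s l)" by auto
  have Aq: "(\<Sum>j\<le>d. A $$ (i,j) * poly (q k) (s j)) = \<theta> k * poly (q k) (s i)" if "k \<le> d" "i \<le> d" for k i
  proof -
    have "(A *\<^sub>v v k) $ i = (\<Sum>j\<le>d. A $$ (i,j) * v k $ j)"
      by (rule mult_vec_index[OF A e.v_carrier[OF that(1)] that(2)])
    moreover have "(A *\<^sub>v v k) $ i = \<theta> k * v k $ i"
      unfolding e.v_eigen[OF that(1)] using e.v_carrier[OF that(1)] that(2) by auto
    ultimately show ?thesis using q(3)[OF that(1)] that(2) by simp
  qed
  have lower: "A $$ (i,j) = 0" if "i \<le> d" "j + 1 < i" for i j
    using tridiagonal_mat_zero[OF A tri, of i j] that by simp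
  have upper: "A $$ (i,j) = 0" if "j \<le> d" "i + 1 < j" for i j
    using tridiagonal_mat_zero[OF A tri, of i j] that by simp
  \<comment> \<open>Subtracting \<theta> n times the Newton polynomial from its image removes degree
    n. The rather short rows of the first n - 1 nodes meet only its zeros, so the remainder is a
    multiple of the polynomial of degree n - 1. The value 0 at n = 0 supplies
    \<open>\<phi>_0\<close>.\<close>
  have "\<exists>f. (n = 0 \<longrightarrow> f = 0) \<and> (\<forall>i\<le>d. (\<Sum>j\<le>d. A $$ (i,j) * poly (node_poly s n) (s j))
      = \<theta> n * poly (node_poly s n) (s i) + f * poly (node_poly s (n - 1)) (s i))" if n: "n \<le> d" for n
  proof (cases n)
    case 0
    have "(\<Sum>j\<le>d. A $$ (i,j)) = \<theta> 0" if "i \<le> d" for i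
      using row that by (simp add: constant_row_sum_def atLeast0AtMost)
    then show ?thesis using 0 by simp
  next
    case (Suc m)
    obtain c where c: "node_poly s n = (\<Sum>k\<le>n. smult (c k) (q k))"
      using poly_basis_expand[of n q "node_poly s n"] q n by auto
    define g where "g = (\<Sum>k\<le>m. smult (c k * (\<theta> k - \<theta> n)) (q k))"
    have g: "(\<Sum>j\<le>d. A $$ (i,j) * poly (node_poly s n) (s j)) = \<theta> n * poly (node_poly s n) (s i) + poly g (s i)"
      if i: "i \<le> d" for i
    proof -
      have "(\<Sum>j\<le>d. A $$ (i,j) * poly (node_poly s n) (s j))
        = (\<Sum>j\<le>d. \<Sum>k\<le>n. c k * (A $$ (i,j) * poly (q k) (s j)))"
        unfolding c by (simp add: poly_sum sum_distrib_left algebra_simps)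
      also have "\<dots> = (\<Sum>k\<le>n. \<Sum>j\<le>d. c k * (A $$ (i,j) * poly (q k) (s j)))" by (rule sum.swap)
      also have "\<dots> = (\<Sum>k\<le>n. c k * (\<theta> k * poly (q k) (s i)))"
        by (rule sum.cong) (use Aq n i in \<open>auto simp flip: sum_distrib_left\<close>)
      also have "\<dots> = \<theta> n * (\<Sum>k\<le>n. c k * poly (q k) (s i)) + (\<Sum>k\<le>n. c k * (\<theta> k - \<theta> n) * poly (q k) (s i))"
        unfolding sum_distrib_left sum.distrib[symmetric] by (rule sum.cong) (auto simp: algebra_simps)
      also have "(\<Sum>k\<le>n. c k * (\<theta> k - \<theta> n) * poly (q k) (s i)) = poly g (s i)"
        by (simp add: g_def poly_sum Suc)
      also have "(\<Sum>k\<le>n. c k * poly (q k) (s i)) = poly (node_poly s n) (s i)"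
        unfolding c by (simp add: poly_sum)
      finally show ?thesis .
    qed
    have "g = smult (coeff g m) (node_poly s m)"
    proof (rule poly_eq_smult_node_poly)
      show "inj_on s {..<m}" by (rule inj_on_subset[OF s_inj]) (use n Suc in auto)
      show "degree g \<le> m" unfolding g_def
        by (intro degree_sum_le) (use q(1) n Suc in \<open>auto intro!: order.trans[OF degree_smult_le] order.trans[OF q(1)]\<close>)
      fix k assume k: "k < m"
      have "(\<Sum>j\<le>d. A $$ (k,j) * poly (node_poly s n) (s j)) = 0"
      proof (rule sum.neutral, rule ballI)
        fix j assume j: "j \<in> {..d}"
        show "A $$ (k,j) * poly (node_poly s n) (s j) = 0"
        proof (cases "j < n")
          case True
          then show ?thesis by (simp add: poly_node_poly_zero)
        next
          case False
          then show ?thesis using upper[of j k] j k Suc by simp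
        qed
      qed
      then show "poly g (s k) = 0"
        using g[of k] poly_node_poly_zero[of k n s] k n Suc by simp
    qed
    from arg_cong[OF this, of poly] have "poly g x = coeff g m * poly (node_poly s m) x" for x by simp
    then show ?thesis using g Suc by (intro exI[of _ "coeff g m"]) simp
  qed
  then have "\<forall>n\<in>{..d}. \<exists>f. (n = 0 \<longrightarrow> f = 0) \<and> (\<forall>i\<le>d. (\<Sum>j\<le>d. A $$ (i,j) * poly (node_poly s n) (s j))
      = \<theta> n * poly (node_poly s n) (s i) + f * poly (node_poly s (n - 1)) (s i))" by blast
  from bchoice[OF this] obtain \<phi> where \<phi>: "\<And>n. n \<le> d \<Longrightarrow> (n = 0 \<longrightarrow> \<phi> n = 0) \<and> (\<forall>i\<le>d. (\<Sum>j\<le>d. A $$ (i,j) * poly (node_poly s n) (s j))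
      = \<theta> n * poly (node_poly s n) (s i) + \<phi> n * poly (node_poly s (n - 1)) (s i))" by auto
  have "split_matrix d A s \<theta> \<phi> As"
  proof
    show "inj_on s {..d}" "inj_on \<theta> {..d}" by (rule s_inj e.\<theta>_inj)+
    show "\<phi> 0 = 0" using \<phi>[of 0] by simp
    show "(\<Sum>j\<le>d. A $$ (i,j) * poly (node_poly s n) (s j))
      = \<theta> n * poly (node_poly s n) (s i) + \<phi> n * poly (node_poly s (n - 1)) (s i)" if "n \<le> d" "i \<le> d" for n i
      using \<phi>[OF that(1)] that(2) by blast
    show "A $$ (i,j) = 0" if "i \<le> d" "j + 1 < i" for i j by (rule lower[OF that])
    show "As $$ (i,j) = (if i = j then s i else 0)" if "i \<le> d" "j \<le> d" for i j by (rule entry[OF that])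
    show "A $$ (i, Suc i) \<noteq> 0" "A $$ (Suc i, i) \<noteq> 0" if "i < d" for i
      using adj[of i "Suc i"] adj[of "Suc i" i] that by simp_all
  qed (rule A As)+
  then show ?thesis using \<theta> unfolding s_def by blast
qed

section \<open>Uniqueness of the array and the equivalence\<close>

lemma parameter_array_of_system_unique:
  assumes A: "A \<in> carrier_mat (Suc d) (Suc d)" and As: "As \<in> carrier_mat (Suc d) (Suc d)"
    and 1: "parameter_array_of_system d A As E Es p" and 2: "parameter_array_of_system d A As E Es p'"
  shows "p = p'"
proof (rule scalar_array.equality)
  note P1 = 1[unfolded parameter_array_of_system_def array_of_diameter_def second_split_sequence_def]
  note P2 = 2[unfolded parameter_array_of_system_def array_of_diameter_def second_split_sequence_def]
  show "eig p = eig p'"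
    by (rule extensionalityI[of _ "{0..d}"])
      (use P1 P2 associated_eigenvalues_unique[OF A, of E "eig p" "eig p'"] in auto)
  show "dual_eig p = dual_eig p'"
    by (rule extensionalityI[of _ "{0..d}"])
      (use P1 P2 associated_eigenvalues_unique[OF As, of Es "dual_eig p" "dual_eig p'"] in auto)
  show "split1 p = split1 p'"
    by (rule extensionalityI[of _ "{1..d}"])
      (use P1 P2 first_split_sequence_unique[OF A As, of E Es "split1 p" "split1 p'"] in auto)
  show "split2 p = split2 p'"
    by (rule extensionalityI[of _ "{1..d}"])
      (use P1 P2 first_split_sequence_unique[OF A As, of "\<lambda>i. E (d - i)" Es "split2 p" "split2 p'"] in auto)
qed simp

text \<open>The array is read off in a fixed order: the dual eigenvalues from \<open>As\<close>, the
  split sequences from the entries next to the diagonal, whose products of node differences are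
  nonzero, and finally the eigenvalues from the diagonal of A.\<close>

lemma parameter_array_entries_unique:
  fixes p p' :: "'a::field scalar_array"
  assumes p: "parameter_array d p" "TD_D_entries d A As p" and p': "parameter_array d p'" "TD_D_entries d A As p'"
  shows "p = p'"
proof -
  note e = p(2)[unfolded TD_D_entries_def Let_def] and e' = p'(2)[unfolded TD_D_entries_def Let_def]
  have ext: "eig x \<in> extensional {0..d}" "dual_eig x \<in> extensional {0..d}"
    "split1 x \<in> extensional {1..d}" "split2 x \<in> extensional {1..d}" if "parameter_array d x" for x :: "'a scalar_array"
    using that by (simp_all add: parameter_array_def array_of_diameter_def)
  have "\<forall>i\<le>d. \<forall>j\<le>d. i \<noteq> j \<longrightarrow> eig p i \<noteq> eig p j \<and> dual_eig p i \<noteq> dual_eig p j"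
    using p(1) by (simp add: parameter_array_def Let_def)
  then have dist: "dual_eig p i - dual_eig p j \<noteq> 0" if "i \<le> d" "j \<le> d" "i \<noteq> j" for i j using that by simp
  have pnz: "prod f K \<noteq> 0" if "finite K" "\<And>h. h \<in> K \<Longrightarrow> f h \<noteq> 0" for f :: "nat \<Rightarrow> 'a" and K
    using that by simp
  have s: "dual_eig p = dual_eig p'"
  proof (rule extensionalityI[OF ext(2)[OF p(1)] ext(2)[OF p'(1)]])
    fix i assume "i \<in> {0..d}"
    then have "i \<le> d" by simp
    then show "dual_eig p i = dual_eig p' i"
      using e[THEN conjunct2, THEN conjunct2, THEN conjunct2, rule_format, of i]
        e'[THEN conjunct2, THEN conjunct2, THEN conjunct2, rule_format, of i] by simp
  qed
  have 1: "split1 p = split1 p'"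
  proof (rule extensionalityI[OF ext(3)[OF p(1)] ext(3)[OF p'(1)]])
    fix i assume i: "i \<in> {1..d}"
    let ?c = "(\<Prod>h=0..<i-1. dual_eig p (i-1) - dual_eig p h) / (\<Prod>h=0..<i. dual_eig p i - dual_eig p h)"
    have "(\<Prod>h=0..<i-1. dual_eig p (i-1) - dual_eig p h) \<noteq> 0"
      by (rule pnz, simp, rule dist) (use i in auto)
    moreover have "(\<Prod>h=0..<i. dual_eig p i - dual_eig p h) \<noteq> 0"
      by (rule pnz, simp, rule dist) (use i in auto)
    ultimately have "?c \<noteq> 0" by simp
    moreover have "split1 p i * ?c = split1 p' i * ?c"
      using bspec[OF e[THEN conjunct2, THEN conjunct1] i] bspec[OF e'[THEN conjunct2, THEN conjunct1] i]
      unfolding s by (rule trans[OF sym])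
    ultimately show "split1 p i = split1 p' i" by (simp only: mult_cancel_right simp_thms)
  qed
  have 2: "split2 p = split2 p'"
  proof (rule extensionalityI[OF ext(4)[OF p(1)] ext(4)[OF p'(1)]])
    fix i assume i: "i \<in> {1..d}"
    let ?c = "(\<Prod>h=i+1..d. dual_eig p i - dual_eig p h) / (\<Prod>h=i..d. dual_eig p (i-1) - dual_eig p h)"
    have "(\<Prod>h=i+1..d. dual_eig p i - dual_eig p h) \<noteq> 0"
      by (rule pnz, simp, rule dist) (use i in auto)
    moreover have "(\<Prod>h=i..d. dual_eig p (i-1) - dual_eig p h) \<noteq> 0"
      by (rule pnz, simp, rule dist) (use i in auto)
    ultimately have "?c \<noteq> 0" by simp
    moreover have "split2 p i * ?c = split2 p' i * ?c"
      using bspec[OF e[THEN conjunct2, THEN conjunct2, THEN conjunct1] i]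
        bspec[OF e'[THEN conjunct2, THEN conjunct2, THEN conjunct1] i]
      unfolding s by (rule trans[OF sym])
    ultimately show "split2 p i = split2 p' i" by (simp only: mult_cancel_right simp_thms)
  qed
  have "eig p = eig p'"
  proof (rule extensionalityI[OF ext(1)[OF p(1)] ext(1)[OF p'(1)]])
    fix i assume "i \<in> {0..d}"
    then have i: "i \<le> d" by simp
    show "eig p i = eig p' i"
      using e[THEN conjunct1, rule_format, OF i] e'[THEN conjunct1, rule_format, OF i] unfolding s 1 by simp
  qed
  then show ?thesis using s 1 2 by (intro scalar_array.equality) simp_all
qed

lemma canonical_form_of_designated:
  assumes "tridiagonal_mat A" "diagonal_mat As" "designated_parameter_array d A As p"
  shows "leonard_pair d A As \<and> TD_D_canonical_form d A As"
proof -
  obtain E Es where "designated_leonard_system d A As E Es"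
    using assms(3) unfolding designated_parameter_array_def by blast
  then obtain \<theta> where sys: "leonard_system d A As E Es" "associated_eigenvalues d A E \<theta>" "constant_row_sum d A (\<theta> 0)"
    unfolding designated_leonard_system_def by blast
  then have "leonard_pair d A As" unfolding leonard_system_def leonard_pair_def by blast
  moreover have "leonard_pair_eigenvalue_sequence d A As \<theta>"
    unfolding leonard_pair_eigenvalue_sequence_def using sys by blast
  ultimately show ?thesis using assms(1,2) sys(3) unfolding TD_D_canonical_form_def by blast
qed

lemma parameter_array_of_designated:
  fixes A As :: "'a::field mat"
  assumes "A \<in> carrier_mat (Suc d) (Suc d)" "As \<in> carrier_mat (Suc d) (Suc d)"
    "tridiagonal_mat A" "diagonal_mat As" "designated_leonard_system d A As E Es"
  shows "\<exists>p. parameter_array d p \<and> TD_D_entries d A As p \<and> parameter_array_of_system d A As E Es p"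
proof -
  obtain \<theta> \<phi> where "split_matrix d A (\<lambda>i. As $$ (i,i)) \<theta> \<phi> As" and \<theta>: "associated_eigenvalues d A E \<theta>"
    using split_matrix_of_designated[OF assms] by blast
  then interpret split_matrix d A "\<lambda>i. As $$ (i,i)" \<theta> \<phi> As by simp
  have "associated_eigenvalues d As Es (\<lambda>i. As $$ (i,i))"
    using assms(5) unfolding designated_leonard_system_def by blast
  from parameter_array_of_system[OF \<theta> this] show ?thesis using parameter_array entries by blast
qed

theorem theorem23p1:
  fixes A As :: "'a::field mat" and d :: nat
  assumes "A \<in> carrier_mat (d+1) (d+1)" and "As \<in> carrier_mat (d+1) (d+1)"
    and "tridiagonal_mat A" and "diagonal_mat As"
  shows "((leonard_pair d A As \<and> TD_D_canonical_form d A As) \<longleftrightarrow>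
            (\<exists>p. parameter_array d p \<and> TD_D_entries d A As p)) \<and>
         ((leonard_pair d A As \<and> TD_D_canonical_form d A As) \<and>
            (\<exists>p. parameter_array d p \<and> TD_D_entries d A As p) \<longrightarrow>
          (\<exists>!p. parameter_array d p \<and> TD_D_entries d A As p) \<and>
          (\<forall>p. parameter_array d p \<and> TD_D_entries d A As p \<longleftrightarrow> designated_parameter_array d A As p))"
proof -
  have A: "A \<in> carrier_mat (Suc d) (Suc d)" and As: "As \<in> carrier_mat (Suc d) (Suc d)"
    using assms(1,2) by simp_all
  let ?P = "\<lambda>p. parameter_array d p \<and> TD_D_entries d A As p"
  have des: "designated_parameter_array d A As p" if "?P p" for p
    using designated_of_parameter_array[OF A As assms(3,4)] that by blast
  have ex: "\<exists>p. ?P p" if TD: "TD_D_canonical_form d A As"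
  proof -
    obtain E Es where "designated_leonard_system d A As E Es"
      using designated_system_ex[OF A As assms(3,4) TD] by blast
    then show ?thesis using parameter_array_of_designated[OF A As assms(3,4)] by blast
  qed
  \<comment> \<open>The designated system has some array with the required entries, and it has only
    one array, so that array is p.\<close>
  have param: "?P p" if D: "designated_parameter_array d A As p" for p
  proof -
    obtain E Es where E: "designated_leonard_system d A As E Es" "parameter_array_of_system d A As E Es p"
      using D unfolding designated_parameter_array_def by blast
    obtain p' where p': "?P p'" "parameter_array_of_system d A As E Es p'"
      using parameter_array_of_designated[OF A As assms(3,4) E(1)] by blast
    have "p = p'" by (rule parameter_array_of_system_unique[OF A As E(2) p'(2)])
    then show ?thesis using p'(1) by simp
  qed
  have uniq: "p = p'" if "?P p" "?P p'" for p p'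
    using parameter_array_entries_unique[of d p A As p'] that by blast
  have canon: "leonard_pair d A As \<and> TD_D_canonical_form d A As" if "?P p" for p
    by (rule canonical_form_of_designated[OF assms(3,4) des[OF that]])
  show ?thesis
  proof (intro conjI impI)
    show "(leonard_pair d A As \<and> TD_D_canonical_form d A As) \<longleftrightarrow> (\<exists>p. ?P p)"
      using ex canon by blast
    assume *: "(leonard_pair d A As \<and> TD_D_canonical_form d A As) \<and> (\<exists>p. ?P p)"
    show "\<exists>!p. ?P p"
    proof (rule ex_ex1I)
      show "\<exists>p. ?P p" by (rule conjunct2[OF *])
    qed (rule uniq)
    show "\<forall>p. ?P p \<longleftrightarrow> designated_parameter_array d A As p" using des param by blast
  qed
qed

end
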